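(* Let $E$ be a complete metric locally compact space, $m$ a $\sigma$-finite positive Radon measure on $E$, and $P^0$ the Poisson measure on the configuration space $\Omega$ over $E$ with intensity $m$. Let $\varphi$ be a bounded continuous function on $E$ with $0<\varphi\le M$ and $\sigma^2:=\int_E\varphi^2\,\mathrm{d}m<+\infty$. Set $c=\sigma^2/M$. Then $$\frac1M\,h_c\big(W_{1,d_\varphi}(Q,P^0)\big)\le H(Q\,|\,P^0)\qquad\text{for all }Q\in\mathcal{M}_1(\Omega).$$
   Context: The configuration space over $E$ is $\Omega=\{\omega=\sum_i\delta_{x_i}\ \text{Radon measure};\ x_i\in E\}$ with the vague topology (coarsest making $\omega\mapsto\int f\,\mathrm{d}\omega$ continuous for every continuous compactly supported $f$) and $\sigma$-field generated by $\omega\mapsto\omega(B)$. The Poisson measure $P^0$ with intensity $m$ is the law on $\Omega$ such that $\omega(B)$ is Poisson distributed with mean $m(B)$ for each Borel $B$, and $\omega(B_1),\dots,\omega(B_n)$ are independent for disjoint $B_1,\dots,B_n$. $d_\varphi(\omega,\omega')=\int_E\varphi\,\mathrm{d}|\omega-\omega'|$, where $|\nu|=\nu^++\nu^-$. For a lower semicontinuous metric $d$ on a Polish space $\mathcal{X}$ and probability measures $\mu,\nu$, $W_{1,d}(\mu,\nu)=\inf_\pi\int\!\!\int d(x,y)\,\mathrm{d}\pi(x,y)$, the infimum over all couplings $\pi$ of $\mu$ and $\nu$. The relative entropy is $H(\nu|\mu)=\int\log\frac{\mathrm{d}\nu}{\mathrm{d}\mu}\,\mathrm{d}\nu$ if $\nu\ll\mu$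 and $+\infty$ otherwise. $\mathcal{M}_1(\mathcal{X})$ is the set of probability measures on $\mathcal{X}$. $h(r)=(1+r)\log(1+r)-r$ and $h_c(r)=c\,h(r/c)$ for $c>0$, $r\ge0$ (with $h_c(+\infty)=+\infty$). *)

theory Defs
  imports "HOL-Probability.Probability"
begin

definition radon_measure :: "'e::metric_space measure \<Rightarrow> bool" where
  "radon_measure m \<longleftrightarrow> sets m = sets borel \<and>
     (\<forall>K. compact K \<longrightarrow> emeasure m K < \<infinity>) \<and>
     (\<forall>B\<in>sets borel. emeasure m B = (SUP K\<in>{K. compact K \<and> K \<subseteq> B}. emeasure m K))"

text \<open>A configuration \<open>\<omega> = \<Sum>\<^sub>i \<delta>\<^sub>x\<^sub>i\<close> (a Radon counting measure) is represented by its
  multiplicity function \<open>\<omega> :: 'e \<Rightarrow> nat\<close>; being Radon means that every compact set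
  contains only finitely many points of the configuration.\<close>
definition configs :: "('e::metric_space \<Rightarrow> nat) set" where
  "configs = {\<omega>. \<forall>K. compact K \<longrightarrow> finite {x\<in>K. \<omega> x \<noteq> 0}}"

definition config_count :: "('e \<Rightarrow> nat) \<Rightarrow> 'e set \<Rightarrow> ennreal" where
  "config_count \<omega> B = (\<integral>\<^sup>+ x. ennreal (real (\<omega> x)) * indicator B x \<partial>count_space UNIV)"

definition config_space :: "('e::metric_space \<Rightarrow> nat) measure" where
  "config_space = sigma configs
     {{\<omega>\<in>configs. config_count \<omega> B \<in> A} | B A. B \<in> sets (borel :: 'e measure) \<and> A \<in> sets (borel :: ennreal measure)}"

definition poisson_measure :: "'e::metric_space measure \<Rightarrow> ('e \<Rightarrow> nat) measure \<Rightarrow> bool" where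
  "poisson_measure m P \<longleftrightarrow> prob_space P \<and> sets P = sets config_space \<and>
     (\<forall>B\<in>sets borel. emeasure m B < \<infinity> \<longrightarrow>
        (\<forall>n::nat. measure P {\<omega>\<in>space P. config_count \<omega> B = of_nat n}
            = exp (- enn2real (emeasure m B)) * enn2real (emeasure m B) ^ n / fact n)) \<and>
     (\<forall>B\<in>sets borel. emeasure m B = \<infinity> \<longrightarrow>
        (AE \<omega> in P. config_count \<omega> B = \<infinity>)) \<and>
     (\<forall>I::nat set. \<forall>Bs::nat \<Rightarrow> 'e set. finite I \<longrightarrow> (\<forall>i\<in>I. Bs i \<in> sets borel) \<longrightarrow>
        disjoint_family_on Bs I \<longrightarrow>
        prob_space.indep_vars P (\<lambda>_. borel) (\<lambda>i \<omega>. config_count \<omega> (Bs i)) I)"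

definition d_phi :: "('e \<Rightarrow> real) \<Rightarrow> ('e \<Rightarrow> nat) \<Rightarrow> ('e \<Rightarrow> nat) \<Rightarrow> ennreal" where
  "d_phi \<phi> \<omega> \<omega>' = (\<integral>\<^sup>+ x. ennreal (\<phi> x * \<bar>real (\<omega> x) - real (\<omega>' x)\<bar>) \<partial>count_space UNIV)"

definition couplings :: "'a measure \<Rightarrow> 'a measure \<Rightarrow> 'a measure \<Rightarrow> ('a \<times> 'a) measure set" where
  "couplings X \<mu> \<nu> = {\<pi>. prob_space \<pi> \<and> sets \<pi> = sets (X \<Otimes>\<^sub>M X) \<and>
                        distr \<pi> X fst = \<mu> \<and> distr \<pi> X snd = \<nu>}"

definition W1 :: "'a measure \<Rightarrow> ('a \<Rightarrow> 'a \<Rightarrow> ennreal) \<Rightarrow> 'a measure \<Rightarrow> 'a measure \<Rightarrow> ennreal" where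
  "W1 X d \<mu> \<nu> = (INF \<pi>\<in>couplings X \<mu> \<nu>. \<integral>\<^sup>+ p. d (fst p) (snd p) \<partial>\<pi>)"

definition rel_entropy :: "'a measure \<Rightarrow> 'a measure \<Rightarrow> ereal" where
  "rel_entropy \<nu> \<mu> =
     (if absolutely_continuous \<mu> \<nu> then
        (let f = (\<lambda>x. enn2real (RN_deriv \<mu> \<nu> x)) in
          enn2ereal (\<integral>\<^sup>+ x. ennreal (max 0 (ln (f x))) \<partial>\<nu>)
          - enn2ereal (\<integral>\<^sup>+ x. ennreal (max 0 (- ln (f x))) \<partial>\<nu>))
      else \<infinity>)"

definition h_fun :: "real \<Rightarrow> real" where
  "h_fun r = (1 + r) * ln (1 + r) - r"

text \<open>\<open>h\<^sub>c(r) = c h(r/c)\<close> for \<open>c > 0\<close>, \<open>h\<^sub>c(+\<infinity>) = +\<infinity>\<close>. For the degenerate value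
  \<open>c = 0\<close> we use the limit \<open>lim\<^sub>c\<^sub>\<rightarrow>\<^sub>0 h\<^sub>c(r)\<close>, i.e. 0 at r = 0 and \<open>+\<infinity>\<close> for \<open>r > 0\<close>.\<close>
definition h_c :: "real \<Rightarrow> ennreal \<Rightarrow> ennreal" where
  "h_c c r = (if r = \<infinity> then \<infinity>
              else if c > 0 then ennreal (c * h_fun (enn2real r / c))
              else if r = 0 then 0 else \<infinity>)"

end

theory Submission
  imports Defs
begin

text \<open>
  An explicit coupling replaces Kantorovich duality. Cut \<open>m\<close> into countably many small pieces, so that
  \<open>P\<^sup>0\<close> becomes the law of the superposition of independent Poisson processes with small intensities,
  and lift the density of \<open>Q\<close> to this product space. Revealing the pieces one after the other, couple
  each piece of \<open>Q\<close>, given the past, with a fresh piece of \<open>P\<^sup>0\<close>: keep the sampled piece as often as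
  the conditional density \<open>r\<close> allows and otherwise redraw it. A mismatch costs at most the total
  \<open>\<phi>\<close>-mass \<open>D\<close> of both pieces, in the mean \<open>\<integral>D \<bar>r - 1\<bar>\<close>, and
  \<open>\<theta> D \<bar>r - 1\<bar> \<le> (r ln r - r + 1) + (e\<^bsup>\<theta>D\<^esup> - 1 - \<theta>D)\<close>. The first terms add up to the relative entropy
  by the chain rule, the second ones to \<open>\<integral>(e\<^bsup>\<theta>\<phi>\<^esup> - 1 - \<theta>\<phi>) dm\<close> up to an error that is quadratic in the
  sizes of the pieces. Hence \<open>\<theta> W \<le> H + \<integral>(e\<^bsup>\<theta>\<phi>\<^esup> - 1 - \<theta>\<phi>) dm\<close> for all \<open>\<theta> \<ge> 0\<close>, and
  \<open>e\<^bsup>\<theta>\<phi>\<^esup> - 1 - \<theta>\<phi> \<le> (\<phi>/M)\<^sup>2 (e\<^bsup>\<theta>M\<^esup> - 1 - \<theta>M)\<close> reduces the claim to optimising over \<open>\<theta>\<close>.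
\<close>

section \<open>Entropy and exponential inequalities\<close>

text \<open>Smallness of the pieces is needed because the exponential error of a piece with rate
  \<open>a\<close> is \<open>exp (a (h - 1)) - 1 - \<theta> a p\<close>, where \<open>h\<close> and
  \<open>p\<close> are the means of \<open>exp (\<theta> \<phi>)\<close> and \<open>\<phi>\<close>
  under its point law. The part linear in \<open>a\<close> is exactly the wanted integral of
  \<open>exp_excess (\<theta> \<phi>)\<close>; the rest is quadratic in \<open>a\<close>, so
  replacing a piece by \<open>N\<close> equal copies divides it by \<open>N\<close>.

  The redrawn sequence has the product law because the step for one coordinate consults only the
  past of the \<open>Q\<close>-sample, never earlier redraws. Given the whole sample all redraws are
  independent, and averaging over a coordinate yields a fresh draw whatever the past.

  The topological obstacle is that the space need not be separable, hence not a countable union of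
  compact sets. Only a closed union \<open>U\<close> of compact sets of full measure is available,
  and the pieces must be laid out in it so that every compact set, also one that leaves
  \<open>U\<close>, meets finitely many of them. The law of their superposition is then recognised
  by generating functionals of counts inside these compact sets.\<close>

definition entropy_fun :: "real \<Rightarrow> real" where
  "entropy_fun u = u * ln u - u + 1"

text \<open>The convex conjugate of \<open>h_fun\<close>, while \<open>entropy_fun u\<close> is
  \<open>h_fun (u - 1)\<close>; the final optimisation over \<theta> is this duality.\<close>

definition exp_excess :: "real \<Rightarrow> real" where
  "exp_excess t = exp t - 1 - t"

lemma exp_excess_nonneg [simp]: "0 \<le> exp_excess t"
  using exp_ge_add_one_self[of t] unfolding exp_excess_def by linarith

lemma borel_measurable_entropy_fun [measurable]: "entropy_fun \<in> borel_measurable borel"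
  unfolding entropy_fun_def[abs_def] by measurable

lemma borel_measurable_exp_excess [measurable]: "exp_excess \<in> borel_measurable borel"
  unfolding exp_excess_def[abs_def] by measurable

text \<open>The tangent inequality \<open>1 + x \<le> exp x\<close> at \<open>x = t - ln u\<close>,
  multiplied by \<open>u\<close>. Equality holds at \<open>u = exp t\<close>.\<close>

lemma exp_young:
  fixes t u :: real
  assumes "0 \<le> u"
  shows "t * u \<le> u * ln u - u + exp t"
proof (cases "u = 0")
  case False
  with assms have u: "u > 0" by simp
  have "u * (1 + (t - ln u)) \<le> u * exp (t - ln u)"
    using u by (intro mult_left_mono exp_ge_add_one_self) auto
  also have "u * exp (t - ln u) = exp t"
    using u by (simp add: exp_diff)
  finally show ?thesis by (simp add: algebra_simps)
qed simp

lemma entropy_fun_nonneg [simp]: "0 \<le> u \<Longrightarrow> 0 \<le> entropy_fun u"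
  using exp_young[of u 0] by (simp add: entropy_fun_def)

text \<open>This is \<open>t \<le> sinh t\<close>, equivalently
  \<open>exp_excess (- t) \<le> exp_excess t\<close>: it lets upward and downward deviations of a
  density share one error term.\<close>

lemma double_le_exp_minus_exp:
  fixes t :: real
  assumes "0 \<le> t"
  shows "2 * t \<le> exp t - exp (- t)"
proof -
  have "(\<lambda>x. exp x - exp (- x) - 2 * x) 0 \<le> (\<lambda>x. exp x - exp (- x) - 2 * x) t"
  proof (rule DERIV_nonneg_imp_nondecreasing[OF assms])
    fix x :: real assume "0 \<le> x"
    have "2 \<le> exp x + exp (- x)"
      using arith_geo_mean_sqrt[of "exp x" "exp (- x)"] by (simp add: exp_minus)
    then show "\<exists>y. ((\<lambda>x. exp x - exp (- x) - 2 * x) has_real_derivative y) (at x) \<and> 0 \<le> y"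
      by (intro exI[of _ "exp x + exp (- x) - 2"]) (auto intro!: derivative_eq_intros)
  qed
  then show ?thesis by simp
qed

text \<open>\<open>exp_young\<close> with slope \<open>t\<close> above 1 and slope
  \<open>- t\<close> below 1. It separates the transport cost into an entropy and a term that no
  longer involves the density.\<close>

lemma abs_diff_le_entropy_fun:
  fixes t u :: real
  assumes "0 \<le> t" "0 \<le> u"
  shows "t * \<bar>u - 1\<bar> \<le> entropy_fun u + exp_excess t"
proof (cases "1 \<le> u")
  case True
  then show ?thesis
    using exp_young[of u t] assms by (simp add: entropy_fun_def exp_excess_def algebra_simps)
next
  case False
  then show ?thesis
    using exp_young[of u "- t"] double_le_exp_minus_exp[of t] assms
    by (simp add: entropy_fun_def exp_excess_def algebra_simps)
qed

text \<open>In other words \<open>exp_excess x / x\<^sup>2\<close> is nondecreasing for positive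
  \<open>x\<close>. Used with \<open>l = \<phi> x / M\<close>, it is the source of the integral of
  the squared weight in the constant.\<close>

lemma exp_excess_scale:
  fixes l t :: real
  assumes "0 \<le> l" "l \<le> 1" "0 \<le> t"
  shows "exp_excess (l * t) \<le> l\<^sup>2 * exp_excess t"
proof -
  let ?g = "\<lambda>x. l\<^sup>2 * (exp x - 1 - x) - (exp (l * x) - 1 - l * x)"
  have "?g 0 \<le> ?g t"
  proof (rule DERIV_nonneg_imp_nondecreasing[OF assms(3)])
    fix x :: real assume "0 \<le> x"
    \<comment> \<open>Convexity of \<open>exp\<close> on the chord from 0 to \<open>x\<close>; this
      is the sign of the derivative of \<open>?g\<close>.\<close>
    have "exp (l * x) \<le> (1 - l) * 1 + l * exp x"
      using exp_convex[THEN convex_onD, of l 0 x] assms by (simp add: algebra_simps)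
    then have "0 \<le> l * (l * (exp x - 1) - (exp (l * x) - 1))"
      using assms by (intro mult_nonneg_nonneg) (auto simp: algebra_simps)
    then show "\<exists>y. (?g has_real_derivative y) (at x) \<and> 0 \<le> y"
      by (intro exI[of _ "l * (l * (exp x - 1) - (exp (l * x) - 1))"])
         (auto intro!: derivative_eq_intros simp: algebra_simps power2_eq_square)
  qed
  then show ?thesis by (simp add: exp_excess_def)
qed

lemma entropy_fun_mult:
  fixes f r :: real
  assumes "0 < f" "0 \<le> r"
  shows "entropy_fun (f * r) = f * entropy_fun r + entropy_fun f + (r - 1) * (f * ln f)"
  using assms by (cases "r = 0") (auto simp: entropy_fun_def ln_mult algebra_simps)

text \<open>Entropies are integrals of the nonnegative function \<open>entropy_fun\<close>, so that no
  integrability is needed; on probability densities this agrees with \<open>\<integral>f ln f\<close>.\<close>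

lemma (in prob_space) entropy_chain_rule:
  fixes f :: real and r :: "'a \<Rightarrow> real"
  assumes [measurable]: "r \<in> borel_measurable M" and f: "0 < f" and r: "\<And>x. 0 \<le> r x"
    and int: "(\<integral>\<^sup>+x. ennreal (r x) \<partial>M) = 1"
  shows "ennreal (entropy_fun f) + ennreal f * (\<integral>\<^sup>+x. ennreal (entropy_fun (r x)) \<partial>M)
    \<le> (\<integral>\<^sup>+x. ennreal (entropy_fun (f * r x)) \<partial>M)"
proof -
  let ?I = "\<integral>\<^sup>+x. ennreal (entropy_fun (f * r x)) \<partial>M"
  let ?J = "\<integral>\<^sup>+x. ennreal (entropy_fun (r x)) \<partial>M"
  \<comment> \<open>\<open>f ln f\<close> may have either sign. Moving its two parts to opposite
    sides keeps all integrals in \<open>ennreal\<close>; they cancel at the end because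
    \<open>r\<close> has integral 1.\<close>
  define p n where "p = max 0 (f * ln f)" and "n = max 0 (- (f * ln f))"
  have pn: "p \<ge> 0" "n \<ge> 0" "f * ln f = p - n" by (auto simp: p_def n_def)
  have eq: "entropy_fun (f * r x) + p + r x * n = f * entropy_fun (r x) + entropy_fun f + r x * p + n" for x
    unfolding entropy_fun_mult[OF f r] pn(3) by (simp add: algebra_simps)
  have "?I + ennreal p + ennreal n =
      (\<integral>\<^sup>+x. ennreal (entropy_fun (f * r x)) + ennreal p + ennreal (r x) * ennreal n \<partial>M)"
    by (simp add: nn_integral_add nn_integral_multc int emeasure_space_1)
  also have "\<dots> = (\<integral>\<^sup>+x. ennreal (f * entropy_fun (r x) + entropy_fun f + r x * p + n) \<partial>M)"
    using f r pn eq by (intro nn_integral_cong) (simp add: ennreal_mult[symmetric] flip: ennreal_plus eq)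
  also have "\<dots> = (\<integral>\<^sup>+x. ennreal f * ennreal (entropy_fun (r x)) + ennreal (entropy_fun f) + ennreal (r x) * ennreal p + ennreal n \<partial>M)"
    using f r pn by (intro nn_integral_cong) (simp add: ennreal_mult)
  also have "\<dots> = ennreal f * ?J + ennreal (entropy_fun f) + ennreal p + ennreal n"
    by (simp add: nn_integral_add nn_integral_multc nn_integral_cmult int emeasure_space_1)
  finally have "?I + (ennreal p + ennreal n) = (ennreal (entropy_fun f) + ennreal f * ?J) + (ennreal p + ennreal n)"
    by (simp add: ac_simps)
  then show ?thesis
    by (simp add: ennreal_add_diff_cancel_right flip: ennreal_plus)
qed

section \<open>Coupling one coordinate\<close>

text \<open>The acceptance probability \<open>min 1 (1 / r)\<close>: what survives of a sample with
  density \<open>r\<close> has density \<open>min r 1\<close>.\<close>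

definition keep_prob :: "real \<Rightarrow> real" where
  "keep_prob r = (if r \<le> 1 then 1 else 1 / r)"

text \<open>The normalised deficit of \<open>r\<close> below 1, since \<open>ennreal\<close> cuts
  negative values off at 0. For a probability density without deficit, \<open>r\<close> is 1 almost
  everywhere and nothing is redrawn; the value 1 then merely keeps the total mass equal to
  one.\<close>

definition refresh_density :: "'a measure \<Rightarrow> ('a \<Rightarrow> real) \<Rightarrow> 'a \<Rightarrow> ennreal" where
  "refresh_density M r v =
    (if (\<integral>\<^sup>+x. ennreal (1 - r x) \<partial>M) = 0 then 1
     else ennreal (1 - r v) / (\<integral>\<^sup>+x. ennreal (1 - r x) \<partial>M))"

definition step_kernel :: "'a measure \<Rightarrow> ('a \<Rightarrow> real) \<Rightarrow> real \<Rightarrow> ('a \<times> bool) measure" where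
  "step_kernel M r \<rho> = density (M \<Otimes>\<^sub>M count_space UNIV)
     (\<lambda>(v, s). if s then ennreal (keep_prob \<rho>) else ennreal (1 - keep_prob \<rho>) * refresh_density M r v)"

lemma keep_prob_bounds [simp]: "0 \<le> keep_prob r" "keep_prob r \<le> 1"
  by (auto simp: keep_prob_def)

lemma borel_measurable_keep_prob [measurable]: "keep_prob \<in> borel_measurable borel"
  unfolding keep_prob_def[abs_def] by measurable

lemma mult_keep_prob: "0 \<le> r \<Longrightarrow> ennreal r * ennreal (keep_prob r) = ennreal (min r 1)"
  by (auto simp: keep_prob_def min_def ennreal_mult[symmetric])

lemma mult_one_minus_keep_prob: "0 \<le> r \<Longrightarrow> ennreal r * ennreal (1 - keep_prob r) = ennreal (r - 1)"
  by (auto simp: keep_prob_def ennreal_mult[symmetric] field_simps ennreal_neg)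

lemma borel_measurable_refresh_density [measurable]:
  "r \<in> borel_measurable M \<Longrightarrow> refresh_density M r \<in> borel_measurable M"
  by (cases "(\<integral>\<^sup>+x. ennreal (1 - r x) \<partial>M) = 0") (simp_all add: refresh_density_def[abs_def])

locale prob_density = prob_space +
  fixes r :: "'a \<Rightarrow> real"
  assumes r_measurable [measurable]: "r \<in> borel_measurable M"
    and r_nonneg: "\<And>x. 0 \<le> r x"
    and r_integral: "(\<integral>\<^sup>+x. ennreal (r x) \<partial>M) = 1"
begin

lemma deficit_finite: "(\<integral>\<^sup>+x. ennreal (1 - r x) \<partial>M) < \<infinity>"
proof -
  have "(\<integral>\<^sup>+x. ennreal (1 - r x) \<partial>M) \<le> (\<integral>\<^sup>+x. 1 \<partial>M)"
    using r_nonneg by (intro nn_integral_mono) (auto simp flip: ennreal_1 intro!: ennreal_leI)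
  also have "\<dots> = 1" by (simp add: emeasure_space_1)
  finally show ?thesis by (rule order.strict_trans1) simp
qed

text \<open>Both \<open>r\<close> and the constant 1 have integral one, so the rejected mass is
  exactly what is missing elsewhere.\<close>

lemma excess_eq_deficit: "(\<integral>\<^sup>+x. ennreal (r x - 1) \<partial>M) = (\<integral>\<^sup>+x. ennreal (1 - r x) \<partial>M)"
proof -
  have "(\<integral>\<^sup>+x. ennreal (r x) + ennreal (1 - r x) \<partial>M) = (\<integral>\<^sup>+x. 1 + ennreal (r x - 1) \<partial>M)"
  proof (rule nn_integral_cong)
    fix x show "ennreal (r x) + ennreal (1 - r x) = 1 + ennreal (r x - 1)"
      using r_nonneg[of x]
      by (cases "r x \<le> 1") (simp_all add: ennreal_neg flip: ennreal_plus ennreal_1)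
  qed
  then have "1 + (\<integral>\<^sup>+x. ennreal (1 - r x) \<partial>M) = 1 + (\<integral>\<^sup>+x. ennreal (r x - 1) \<partial>M)"
    by (simp add: nn_integral_add r_integral emeasure_space_1)
  then show ?thesis
    by (metis ennreal_add_diff_cancel_left ennreal_1 ennreal_neq_top infinity_ennreal_def)
qed

lemma deficit_times_refresh:
  "AE v in M. (\<integral>\<^sup>+x. ennreal (1 - r x) \<partial>M) * refresh_density M r v = ennreal (1 - r v)"
proof (cases "(\<integral>\<^sup>+x. ennreal (1 - r x) \<partial>M) = 0")
  case True
  then have "AE v in M. ennreal (1 - r v) = 0"
    by (subst (asm) nn_integral_0_iff_AE) auto
  then show ?thesis by (auto simp: True)
next
  case False
  then show ?thesis
    using deficit_finite
    by (auto simp: refresh_density_def ennreal_mult_divide_eq ennreal_times_divide mult.commute)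
qed

lemma refresh_density_integral: "(\<integral>\<^sup>+v. refresh_density M r v \<partial>M) = 1"
proof (cases "(\<integral>\<^sup>+x. ennreal (1 - r x) \<partial>M) = 0")
  case False
  then show ?thesis using deficit_finite
    by (auto simp: refresh_density_def nn_integral_divide ennreal_divide_self)
qed (simp add: refresh_density_def emeasure_space_1)

lemma nn_integral_step_kernel:
  assumes [measurable]: "h \<in> borel_measurable (M \<Otimes>\<^sub>M count_space UNIV)"
  shows "(\<integral>\<^sup>+z. h z \<partial>step_kernel M r \<rho>) =
    ennreal (keep_prob \<rho>) * (\<integral>\<^sup>+v. h (v, True) \<partial>M) +
    ennreal (1 - keep_prob \<rho>) * (\<integral>\<^sup>+v. refresh_density M r v * h (v, False) \<partial>M)"
proof -
  interpret B: sigma_finite_measure "count_space (UNIV :: bool set)"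
    by (rule sigma_finite_measure_count_space_countable) simp
  have [measurable]: "h \<in> borel_measurable (M \<Otimes>\<^sub>M count_space (UNIV :: bool set))" by fact
  have "(\<integral>\<^sup>+z. h z \<partial>step_kernel M r \<rho>) =
    (\<integral>\<^sup>+z. (case z of (v, s) \<Rightarrow> if s then ennreal (keep_prob \<rho>) else ennreal (1 - keep_prob \<rho>) * refresh_density M r v) * h z
      \<partial>(M \<Otimes>\<^sub>M count_space UNIV))"
    unfolding step_kernel_def by (subst nn_integral_density) auto
  also have "\<dots> = (\<integral>\<^sup>+v. \<integral>\<^sup>+s. (if s then ennreal (keep_prob \<rho>) else ennreal (1 - keep_prob \<rho>) * refresh_density M r v) * h (v, s) \<partial>count_space UNIV \<partial>M)"
    by (subst B.nn_integral_fst[symmetric]) auto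
  also have "\<dots> = (\<integral>\<^sup>+v. ennreal (keep_prob \<rho>) * h (v, True) + ennreal (1 - keep_prob \<rho>) * (refresh_density M r v * h (v, False)) \<partial>M)"
    by (intro nn_integral_cong) (simp add: nn_integral_count_space_finite UNIV_bool mult.assoc add.commute)
  also have "\<dots> = ennreal (keep_prob \<rho>) * (\<integral>\<^sup>+v. h (v, True) \<partial>M) +
    ennreal (1 - keep_prob \<rho>) * (\<integral>\<^sup>+v. refresh_density M r v * h (v, False) \<partial>M)"
    by (subst nn_integral_add) (auto simp: nn_integral_cmult)
  finally show ?thesis .
qed

lemma prob_space_step_kernel: "prob_space (step_kernel M r \<rho>)"
proof
  have "emeasure (step_kernel M r \<rho>) (space (step_kernel M r \<rho>)) = (\<integral>\<^sup>+z. 1 \<partial>step_kernel M r \<rho>)"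
    by simp
  also have "\<dots> = 1"
    by (subst nn_integral_step_kernel)
       (simp_all add: refresh_density_integral emeasure_space_1 flip: ennreal_plus)
  finally show "emeasure (step_kernel M r \<rho>) (space (step_kernel M r \<rho>)) = 1" .
qed

text \<open>The kept mass has density \<open>min r 1\<close>, and the rejected mass is moved onto
  the deficit \<open>max 0 (1 - r)\<close>; the two add up to 1. Thus a sample with density
  \<open>r\<close> becomes a sample from \<open>M\<close>.\<close>

lemma step_kernel_target:
  assumes [measurable]: "h \<in> borel_measurable M"
  shows "(\<integral>\<^sup>+u. ennreal (r u) * (\<integral>\<^sup>+z. h (if snd z then u else fst z) \<partial>step_kernel M r (r u)) \<partial>M)
    = (\<integral>\<^sup>+u. h u \<partial>M)"
proof -
  let ?t = "\<integral>\<^sup>+x. ennreal (1 - r x) \<partial>M"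
  let ?R = "\<integral>\<^sup>+v. refresh_density M r v * h v \<partial>M"
  have "(\<integral>\<^sup>+u. ennreal (r u) * (\<integral>\<^sup>+z. h (if snd z then u else fst z) \<partial>step_kernel M r (r u)) \<partial>M)
    = (\<integral>\<^sup>+u. ennreal (min (r u) 1) * h u + ennreal (r u - 1) * ?R \<partial>M)"
  proof (rule nn_integral_cong)
    fix u assume [simp]: "u \<in> space M"
    show "ennreal (r u) * (\<integral>\<^sup>+z. h (if snd z then u else fst z) \<partial>step_kernel M r (r u)) =
      ennreal (min (r u) 1) * h u + ennreal (r u - 1) * ?R"
      using r_nonneg[of u]
      by (subst nn_integral_step_kernel)
         (auto simp: distrib_left emeasure_space_1 mult_keep_prob mult_one_minus_keep_prob simp flip: mult.assoc)
  qed
  also have "\<dots> = (\<integral>\<^sup>+u. ennreal (min (r u) 1) * h u \<partial>M) + ?t * ?R"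
    by (simp add: nn_integral_add nn_integral_multc excess_eq_deficit)
  also have "?t * ?R = (\<integral>\<^sup>+v. (?t * refresh_density M r v) * h v \<partial>M)"
    by (simp add: nn_integral_cmult mult.assoc)
  also have "\<dots> = (\<integral>\<^sup>+v. ennreal (1 - r v) * h v \<partial>M)"
    using deficit_times_refresh by (intro nn_integral_cong_AE) auto
  also have "(\<integral>\<^sup>+u. ennreal (min (r u) 1) * h u \<partial>M) + \<dots> = (\<integral>\<^sup>+u. (ennreal (min (r u) 1) + ennreal (1 - r u)) * h u \<partial>M)"
    by (simp add: nn_integral_add distrib_right)
  also have "\<dots> = (\<integral>\<^sup>+u. h u \<partial>M)"
  proof (rule nn_integral_cong)
    fix u show "(ennreal (min (r u) 1) + ennreal (1 - r u)) * h u = h u"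
      using r_nonneg[of u] by (cases "r u \<le> 1") (simp_all add: min_def ennreal_neg flip: ennreal_plus)
  qed
  finally show ?thesis .
qed

text \<open>A rejection is charged at the abandoned point, where it has density
  \<open>max 0 (r - 1)\<close>, and at the new point, where it has density
  \<open>max 0 (1 - r)\<close>. The sum of these densities is
  \<open>\<bar>r - 1\<bar>\<close>.\<close>

lemma step_kernel_cost:
  assumes [measurable]: "D \<in> borel_measurable M"
  shows "(\<integral>\<^sup>+u. ennreal (r u) * (\<integral>\<^sup>+z. (if snd z then 0 else D u + D (fst z)) \<partial>step_kernel M r (r u)) \<partial>M)
    = (\<integral>\<^sup>+u. ennreal \<bar>r u - 1\<bar> * D u \<partial>M)"
proof -
  let ?t = "\<integral>\<^sup>+x. ennreal (1 - r x) \<partial>M"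
  let ?R = "\<integral>\<^sup>+v. refresh_density M r v * D v \<partial>M"
  have "(\<integral>\<^sup>+u. ennreal (r u) * (\<integral>\<^sup>+z. (if snd z then 0 else D u + D (fst z)) \<partial>step_kernel M r (r u)) \<partial>M)
    = (\<integral>\<^sup>+u. ennreal (r u - 1) * D u + ennreal (r u - 1) * ?R \<partial>M)"
  proof (rule nn_integral_cong)
    fix u assume [simp]: "u \<in> space M"
    show "ennreal (r u) * (\<integral>\<^sup>+z. (if snd z then 0 else D u + D (fst z)) \<partial>step_kernel M r (r u)) =
      ennreal (r u - 1) * D u + ennreal (r u - 1) * ?R"
      using r_nonneg[of u]
      by (subst nn_integral_step_kernel)
         (auto simp: distrib_left nn_integral_add nn_integral_multc refresh_density_integral
           mult_one_minus_keep_prob simp flip: mult.assoc)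
  qed
  also have "\<dots> = (\<integral>\<^sup>+u. ennreal (r u - 1) * D u \<partial>M) + ?t * ?R"
    by (simp add: nn_integral_add nn_integral_multc excess_eq_deficit)
  also have "?t * ?R = (\<integral>\<^sup>+v. (?t * refresh_density M r v) * D v \<partial>M)"
    by (simp add: nn_integral_cmult mult.assoc)
  also have "\<dots> = (\<integral>\<^sup>+v. ennreal (1 - r v) * D v \<partial>M)"
    using deficit_times_refresh by (intro nn_integral_cong_AE) auto
  also have "(\<integral>\<^sup>+u. ennreal (r u - 1) * D u \<partial>M) + \<dots> = (\<integral>\<^sup>+u. (ennreal (r u - 1) + ennreal (1 - r u)) * D u \<partial>M)"
    by (simp add: nn_integral_add distrib_right)
  also have "\<dots> = (\<integral>\<^sup>+u. ennreal \<bar>r u - 1\<bar> * D u \<partial>M)"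
  proof (rule nn_integral_cong)
    fix u show "(ennreal (r u - 1) + ennreal (1 - r u)) * D u = ennreal \<bar>r u - 1\<bar> * D u"
      by (cases "r u \<le> 1") (simp_all add: ennreal_neg)
  qed
  finally show ?thesis .
qed

lemma step_kernel_cost_bound:
  fixes D :: "'a \<Rightarrow> real"
  assumes [measurable]: "D \<in> borel_measurable M" and D: "\<And>x. 0 \<le> D x" and \<theta>: "0 \<le> \<theta>"
  shows "ennreal \<theta> * (\<integral>\<^sup>+u. ennreal (r u) *
      (\<integral>\<^sup>+z. (if snd z then 0 else ennreal (D u) + ennreal (D (fst z))) \<partial>step_kernel M r (r u)) \<partial>M)
    \<le> (\<integral>\<^sup>+u. ennreal (entropy_fun (r u)) \<partial>M) + (\<integral>\<^sup>+u. ennreal (exp_excess (\<theta> * D u)) \<partial>M)"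
proof -
  have "ennreal \<theta> * (\<integral>\<^sup>+u. ennreal \<bar>r u - 1\<bar> * ennreal (D u) \<partial>M)
    = (\<integral>\<^sup>+u. ennreal (\<theta> * D u * \<bar>r u - 1\<bar>) \<partial>M)"
    using D \<theta> by (subst nn_integral_cmult[symmetric])
      (auto intro!: nn_integral_cong simp: ennreal_mult[symmetric] algebra_simps)
  also have "\<dots> \<le> (\<integral>\<^sup>+u. ennreal (entropy_fun (r u)) + ennreal (exp_excess (\<theta> * D u)) \<partial>M)"
    using D \<theta> r_nonneg
    by (intro nn_integral_mono) (simp add: abs_diff_le_entropy_fun ennreal_leI flip: ennreal_plus)
  also have "\<dots> = (\<integral>\<^sup>+u. ennreal (entropy_fun (r u)) \<partial>M) + (\<integral>\<^sup>+u. ennreal (exp_excess (\<theta> * D u)) \<partial>M)"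
    by (rule nn_integral_add) auto
  finally show ?thesis
    by (subst step_kernel_cost) auto
qed

end

section \<open>Densities on sequence space\<close>

lemma (in product_prob_space) nn_integral_PiM_prod:
  assumes J: "finite J" "J \<subseteq> I" and h: "\<And>j. j \<in> J \<Longrightarrow> h j \<in> borel_measurable (M j)"
  shows "(\<integral>\<^sup>+x. (\<Prod>j\<in>J. h j (x j)) \<partial>PiM I M) = (\<Prod>j\<in>J. \<integral>\<^sup>+x. h j x \<partial>M j)"
proof -
  have "(\<integral>\<^sup>+x. (\<Prod>j\<in>J. h j (x j)) \<partial>PiM I M) = (\<integral>\<^sup>+x. (\<Prod>j\<in>J. h j (restrict x J j)) \<partial>PiM I M)"
    by (intro nn_integral_cong prod.cong) auto
  also have "\<dots> = (\<integral>\<^sup>+x. (\<Prod>j\<in>J. h j (x j)) \<partial>distr (PiM I M) (PiM J M) (\<lambda>x. restrict x J))"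
    using J by (subst nn_integral_distr)
      (auto intro!: measurable_restrict_subset borel_measurable_prod_ennreal measurable_compose[OF _ h] measurable_component_singleton)
  also have "\<dots> = (\<integral>\<^sup>+x. (\<Prod>j\<in>J. h j (x j)) \<partial>PiM J M)"
    using J by (simp add: distr_PiM_restrict_finite)
  also have "\<dots> = (\<Prod>j\<in>J. \<integral>\<^sup>+x. h j x \<partial>M j)"
    by (rule product_nn_integral_prod) (use J h in auto)
  finally show ?thesis .
qed

section \<open>Splicing sequences; marginal and conditional densities\<close>

definition splice_seq :: "nat \<Rightarrow> (nat \<Rightarrow> 'a) \<Rightarrow> (nat \<Rightarrow> 'a) \<Rightarrow> nat \<Rightarrow> 'a" where
  "splice_seq n x w i = (if i < n then x i else w i)"

lemma measurable_splice_seq [measurable (raw)]: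
  assumes f: "f \<in> N \<rightarrow>\<^sub>M PiM UNIV M" and g: "g \<in> N \<rightarrow>\<^sub>M PiM UNIV M"
  shows "(\<lambda>x. splice_seq n (f x) (g x)) \<in> N \<rightarrow>\<^sub>M PiM UNIV M"
proof (rule measurable_PiM_single')
  fix i :: nat
  have "(\<lambda>x. f x i) \<in> N \<rightarrow>\<^sub>M M i" "(\<lambda>x. g x i) \<in> N \<rightarrow>\<^sub>M M i"
    using measurable_compose[OF f measurable_component_singleton] measurable_compose[OF g measurable_component_singleton]
    by auto
  then show "(\<lambda>x. splice_seq n (f x) (g x) i) \<in> N \<rightarrow>\<^sub>M M i"
    by (cases "i < n") (simp_all add: splice_seq_def)
qed (use measurable_space[OF f] measurable_space[OF g] in \<open>auto simp: space_PiM splice_seq_def PiE_iff\<close>)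

lemma measurable_fun_upd_UNIV [measurable (raw)]:
  assumes f: "f \<in> N \<rightarrow>\<^sub>M PiM UNIV M" and g: "g \<in> N \<rightarrow>\<^sub>M M n"
  shows "(\<lambda>x. (f x)(n := g x)) \<in> N \<rightarrow>\<^sub>M PiM UNIV M"
  by (rule measurable_fun_upd[where J = UNIV]) (use f g in auto)

text \<open>\<open>g\<close> stands for the density of \<open>Q\<close> lifted to the product of the
  independent pieces.\<close>

locale sequence_density = product_prob_space M "UNIV :: nat set" for M :: "nat \<Rightarrow> 'a measure" +
  fixes g :: "(nat \<Rightarrow> 'a) \<Rightarrow> ennreal"
  assumes g_measurable [measurable]: "g \<in> borel_measurable (PiM UNIV M)"
    and g_integral: "(\<integral>\<^sup>+x. g x \<partial>PiM UNIV M) = 1"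
begin

abbreviation "PP \<equiv> PiM UNIV M"

lemma nn_integral_fun_upd:
  assumes [measurable]: "h \<in> borel_measurable PP"
  shows "(\<integral>\<^sup>+x. \<integral>\<^sup>+u. h (x(n := u)) \<partial>M n \<partial>PP) = (\<integral>\<^sup>+x. h x \<partial>PP)"
proof -
  interpret pair_sigma_finite "M n" PP ..
  have "(\<integral>\<^sup>+x. h x \<partial>PP) = (\<integral>\<^sup>+x. h x \<partial>distr (M n \<Otimes>\<^sub>M PP) PP (\<lambda>(u, X). X(n := u)))"
    using distr_pair_PiM_eq_PiM[of UNIV M n] M.prob_space_axioms by simp
  also have "\<dots> = (\<integral>\<^sup>+z. (case z of (u, X) \<Rightarrow> h (X(n := u))) \<partial>(M n \<Otimes>\<^sub>M PP))"
    by (subst nn_integral_distr) (auto simp: case_prod_beta')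
  also have "\<dots> = (\<integral>\<^sup>+x. \<integral>\<^sup>+u. h (x(n := u)) \<partial>M n \<partial>PP)"
    by (subst nn_integral_snd[symmetric]) auto
  finally show ?thesis ..
qed

text \<open>On a cylinder the constraints split into those below \<open>n\<close>, which concern
  only \<open>x\<close>, and the others, which concern only \<open>w\<close>.\<close>

lemma distr_splice_seq: "distr (PP \<Otimes>\<^sub>M PP) PP (\<lambda>(x, w). splice_seq n x w) = PP"
proof (rule PiM_eq)
  fix J :: "nat set" and F assume J: "finite J" and F: "\<And>j. j \<in> J \<Longrightarrow> F j \<in> sets (M j)"
  let ?A = "{j \<in> J. j < n}" and ?B = "{j \<in> J. \<not> j < n}"
  let ?S = "\<lambda>J. {x \<in> space PP. \<forall>j\<in>J. x j \<in> F j}"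
  have S_sets: "?S A \<in> sets PP" if "A \<subseteq> J" for A
  proof -
    have "?S A = prod_emb UNIV M A (\<Pi>\<^sub>E j\<in>A. F j)"
      by (auto simp: prod_emb_def space_PiM PiE_iff)
    then show ?thesis
      using that finite_subset[OF that J] F by (auto intro!: sets_PiM_I)
  qed
  have emb: "prod_emb UNIV M J (\<Pi>\<^sub>E j\<in>J. F j) = ?S J"
    by (auto simp: prod_emb_def space_PiM PiE_iff)
  have "emeasure (distr (PP \<Otimes>\<^sub>M PP) PP (\<lambda>(x, w). splice_seq n x w)) (?S J) =
      emeasure (PP \<Otimes>\<^sub>M PP) ((\<lambda>(x, w). splice_seq n x w) -` ?S J \<inter> space (PP \<Otimes>\<^sub>M PP))"
    by (rule emeasure_distr[OF _ S_sets]) auto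
  also have "(\<lambda>(x, w). splice_seq n x w) -` ?S J \<inter> space (PP \<Otimes>\<^sub>M PP) = ?S ?A \<times> ?S ?B"
    by (auto simp: space_pair_measure splice_seq_def space_PiM PiE_iff split: if_splits)
  also have "emeasure (PP \<Otimes>\<^sub>M PP) (?S ?A \<times> ?S ?B) = emeasure PP (?S ?A) * emeasure PP (?S ?B)"
    by (intro emeasure_pair_measure_Times S_sets) blast+
  also have "\<dots> = (\<Prod>j\<in>?A. emeasure (M j) (F j)) * (\<Prod>j\<in>?B. emeasure (M j) (F j))"
    using J F by (intro arg_cong2[where f="(*)"] emeasure_PiM_Collect) auto
  also have "\<dots> = (\<Prod>j\<in>J. emeasure (M j) (F j))"
    using J by (subst prod.union_disjoint[symmetric]) (auto intro!: prod.cong)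
  finally show "emeasure (distr (PP \<Otimes>\<^sub>M PP) PP (\<lambda>(x, w). splice_seq n x w)) (prod_emb UNIV M J (\<Pi>\<^sub>E j\<in>J. F j))
    = (\<Prod>j\<in>J. emeasure (M j) (F j))"
    unfolding emb .
qed simp

lemma nn_integral_splice_seq:
  assumes [measurable]: "h \<in> borel_measurable PP"
  shows "(\<integral>\<^sup>+x. \<integral>\<^sup>+w. h (splice_seq n x w) \<partial>PP \<partial>PP) = (\<integral>\<^sup>+x. h x \<partial>PP)"
proof -
  have "(\<integral>\<^sup>+x. h x \<partial>PP) = (\<integral>\<^sup>+x. h x \<partial>distr (PP \<Otimes>\<^sub>M PP) PP (\<lambda>(x, w). splice_seq n x w))"
    by (simp add: distr_splice_seq)
  also have "\<dots> = (\<integral>\<^sup>+z. (case z of (x, w) \<Rightarrow> h (splice_seq n x w)) \<partial>(PP \<Otimes>\<^sub>M PP))"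
    by (subst nn_integral_distr) (auto simp: case_prod_beta')
  also have "\<dots> = (\<integral>\<^sup>+x. \<integral>\<^sup>+w. h (splice_seq n x w) \<partial>PP \<partial>PP)"
    by (subst nn_integral_fst[symmetric]) auto
  finally show ?thesis ..
qed

text \<open>The marginal density of the first \<open>n\<close> coordinates, kept as a function of
  the whole sequence so that all marginals live on one space.\<close>

definition marg :: "nat \<Rightarrow> (nat \<Rightarrow> 'a) \<Rightarrow> ennreal" where
  "marg n x = (\<integral>\<^sup>+w. g (splice_seq n x w) \<partial>PP)"

lemma marg_measurable [measurable]: "marg n \<in> borel_measurable PP"
  unfolding marg_def[abs_def] by measurable

lemma fun_upd_measurable [measurable]: "x \<in> space PP \<Longrightarrow> (\<lambda>u. x(n := u)) \<in> M n \<rightarrow>\<^sub>M PP"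
  by (rule measurable_fun_upd_UNIV) auto

lemma marg_Suc:
  assumes [measurable]: "x \<in> space PP"
  shows "(\<integral>\<^sup>+u. marg (Suc n) (x(n := u)) \<partial>M n) = marg n x"
proof -
  interpret pair_sigma_finite "M n" PP ..
  have eq: "splice_seq (Suc n) (x(n := u)) w = splice_seq n x (w(n := u))" for u w
    by (auto simp: splice_seq_def fun_eq_iff less_Suc_eq)
  have "marg n x = (\<integral>\<^sup>+w. \<integral>\<^sup>+u. g (splice_seq n x (w(n := u))) \<partial>M n \<partial>PP)"
    unfolding marg_def by (rule nn_integral_fun_upd[symmetric]) measurable
  also have "\<dots> = (\<integral>\<^sup>+u. \<integral>\<^sup>+w. g (splice_seq n x (w(n := u))) \<partial>PP \<partial>M n)"
    by (rule Fubini') measurable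
  finally show ?thesis
    by (simp add: marg_def eq)
qed

lemma marg_integral: "(\<integral>\<^sup>+x. marg n x \<partial>PP) = 1"
  unfolding marg_def by (subst nn_integral_splice_seq) (auto simp: g_integral)

lemma marg_finite_AE: "AE x in PP. marg n x < \<infinity>"
proof -
  have "AE x in PP. marg n x \<noteq> \<infinity>"
    by (rule nn_integral_PInf_AE) (auto simp: marg_integral)
  then show ?thesis by (simp add: less_top)
qed

text \<open>The assumption on \<open>K\<close> expresses dependence on the first \<open>n\<close>
  coordinates only, so that the tail can be integrated out of \<open>g\<close> alone.\<close>

lemma nn_integral_marg:
  assumes [measurable]: "K \<in> borel_measurable PP"
    and K: "\<And>x w. x \<in> space PP \<Longrightarrow> w \<in> space PP \<Longrightarrow> K (splice_seq n x w) = K x"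
  shows "(\<integral>\<^sup>+x. g x * K x \<partial>PP) = (\<integral>\<^sup>+x. marg n x * K x \<partial>PP)"
proof -
  have "(\<integral>\<^sup>+x. g x * K x \<partial>PP) = (\<integral>\<^sup>+x. \<integral>\<^sup>+w. g (splice_seq n x w) * K (splice_seq n x w) \<partial>PP \<partial>PP)"
    by (rule nn_integral_splice_seq[symmetric]) measurable
  also have "\<dots> = (\<integral>\<^sup>+x. \<integral>\<^sup>+w. g (splice_seq n x w) * K x \<partial>PP \<partial>PP)"
    by (intro nn_integral_cong) (simp add: K)
  also have "\<dots> = (\<integral>\<^sup>+x. marg n x * K x \<partial>PP)"
    unfolding marg_def by (intro nn_integral_cong nn_integral_multc) measurable
  finally show ?thesis .
qed

text \<open>The conditional density of coordinate \<open>n\<close> given the earlier ones; it is set to \<open>1\<close> where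
  the quotient is meaningless, so that it is a probability density for every past.\<close>

definition cond_density :: "nat \<Rightarrow> (nat \<Rightarrow> 'a) \<Rightarrow> real" where
  "cond_density n x = (if 0 < marg n x \<and> marg n x < \<infinity>
     then enn2real (marg (Suc n) x) / enn2real (marg n x) else 1)"

lemma cond_density_measurable [measurable]: "cond_density n \<in> borel_measurable PP"
  unfolding cond_density_def[abs_def] by measurable

lemma cond_density_nonneg [simp]: "0 \<le> cond_density n x"
  by (simp add: cond_density_def)

lemma marg_fun_upd [simp]: "n \<le> k \<Longrightarrow> marg n (x(k := u)) = marg n x"
  by (auto simp: marg_def splice_seq_def fun_eq_iff intro!: nn_integral_cong arg_cong[where f=g])

lemma marg_splice_seq: "n \<le> k \<Longrightarrow> marg n (splice_seq k x w) = marg n x"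
  by (auto simp: marg_def splice_seq_def fun_eq_iff intro!: nn_integral_cong arg_cong[where f=g])

text \<open>Where \<open>marg n x\<close> vanishes, \<open>marg (Suc n)\<close> has integral zero
  over the new coordinate and vanishes almost everywhere, so the default value of
  \<open>cond_density\<close> does no harm.\<close>

lemma marg_Suc_factor:
  assumes x[measurable]: "x \<in> space PP" and fin: "marg n x < \<infinity>"
  shows "AE u in M n. marg (Suc n) (x(n := u)) = marg n x * ennreal (cond_density n (x(n := u)))"
proof (cases "marg n x = 0")
  case True
  with marg_Suc[OF x, of n] have "(\<integral>\<^sup>+u. marg (Suc n) (x(n := u)) \<partial>M n) = 0"
    by simp
  then have "AE u in M n. marg (Suc n) (x(n := u)) = 0"
    by (rule nn_integral_0_iff_AE[THEN iffD1, rotated]) measurable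
  then show ?thesis by (simp add: True)
next
  case False
  with marg_Suc[OF x, of n] fin have "AE u in M n. marg (Suc n) (x(n := u)) \<noteq> \<infinity>"
    using x by (intro nn_integral_PInf_AE) auto
  then show ?thesis
  proof eventually_elim
    case (elim u)
    define a b where "a = enn2real (marg n x)" and "b = enn2real (marg (Suc n) (x(n := u)))"
    have ab: "marg n x = ennreal a" "marg (Suc n) (x(n := u)) = ennreal b"
      using fin elim by (simp_all add: a_def b_def less_top)
    have "0 < a"
      using False fin by (simp add: a_def enn2real_positive_iff zero_less_iff_neq_zero)
    moreover have "cond_density n (x(n := u)) = b / a"
      using False fin by (simp add: cond_density_def a_def b_def zero_less_iff_neq_zero)
    moreover have "0 \<le> b" by (simp add: b_def)
    ultimately show ?case
      by (simp add: ab ennreal_mult[symmetric])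
  qed
qed

text \<open>Stated for every past, not almost every one: the kernels built from it must all be
  probability measures before their infinite product can be formed.\<close>

lemma prob_density_cond_density:
  assumes x[measurable]: "x \<in> space PP"
  shows "prob_density (M n) (\<lambda>u. cond_density n (x(n := u)))"
proof unfold_locales
  show "(\<lambda>u. cond_density n (x(n := u))) \<in> borel_measurable (M n)"
    using x by measurable
  show "(\<integral>\<^sup>+u. ennreal (cond_density n (x(n := u))) \<partial>M n) = 1"
  proof (cases "0 < marg n x \<and> marg n x < \<infinity>")
    case True
    have "marg n x = (\<integral>\<^sup>+u. marg (Suc n) (x(n := u)) \<partial>M n)"
      by (rule marg_Suc[OF x, symmetric])
    also have "\<dots> = (\<integral>\<^sup>+u. marg n x * ennreal (cond_density n (x(n := u))) \<partial>M n)"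
      using marg_Suc_factor[OF x, of n] True by (intro nn_integral_cong_AE) auto
    also have "\<dots> = marg n x * (\<integral>\<^sup>+u. ennreal (cond_density n (x(n := u))) \<partial>M n)"
      using x by (intro nn_integral_cmult) measurable
    finally have "marg n x * 1 = marg n x * (\<integral>\<^sup>+u. ennreal (cond_density n (x(n := u))) \<partial>M n)"
      by simp
    then show ?thesis
      using True by (subst (asm) ennreal_mult_cancel_left) auto
  next
    case False
    then have "\<not> (0 < marg n (x(n := u)) \<and> marg n (x(n := u)) < \<infinity>)" for u
      by (simp only: marg_fun_upd order_refl) simp
    then have "cond_density n (x(n := u)) = 1" for u
      unfolding cond_density_def by (rule if_not_P)
    then show ?thesis by (simp add: M.emeasure_space_1)
  qed
qed simp

end

text \<open>Jensen's inequality read off from the chain rule: divide \<open>F\<close> by its mean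
  and drop the nonnegative entropy of the quotient.\<close>

lemma (in prob_space) entropy_jensen:
  assumes [measurable]: "F \<in> borel_measurable M" and fin: "(\<integral>\<^sup>+x. F x \<partial>M) < \<infinity>"
  shows "ennreal (entropy_fun (enn2real (\<integral>\<^sup>+x. F x \<partial>M))) \<le> (\<integral>\<^sup>+x. ennreal (entropy_fun (enn2real (F x))) \<partial>M)"
proof (cases "(\<integral>\<^sup>+x. F x \<partial>M) = 0")
  case True
  then have "AE x in M. F x = 0"
    by (subst (asm) nn_integral_0_iff_AE) auto
  then have "(\<integral>\<^sup>+x. ennreal (entropy_fun (enn2real (F x))) \<partial>M) = (\<integral>\<^sup>+x. 1 \<partial>M)"
    by (intro nn_integral_cong_AE) (auto simp: entropy_fun_def)
  then show ?thesis
    by (simp add: True emeasure_space_1 entropy_fun_def)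
next
  case False
  define f where "f = enn2real (\<integral>\<^sup>+x. F x \<partial>M)"
  have f: "0 < f" and f_eq: "ennreal f = (\<integral>\<^sup>+x. F x \<partial>M)"
    using False fin by (auto simp: f_def enn2real_positive_iff zero_less_iff_neq_zero)
  have F_fin: "AE x in M. F x \<noteq> \<infinity>"
    using fin by (intro nn_integral_PInf_AE) auto
  have "ennreal f * (\<integral>\<^sup>+x. ennreal (enn2real (F x) / f) \<partial>M) = (\<integral>\<^sup>+x. ennreal f * ennreal (enn2real (F x) / f) \<partial>M)"
    by (simp add: nn_integral_cmult)
  also have "\<dots> = (\<integral>\<^sup>+x. F x \<partial>M)"
    using F_fin f by (intro nn_integral_cong_AE) (auto simp: less_top simp flip: ennreal_mult)
  finally have "ennreal f * (\<integral>\<^sup>+x. ennreal (enn2real (F x) / f) \<partial>M) = ennreal f * 1"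
    by (simp add: f_eq)
  then have "(\<integral>\<^sup>+x. ennreal (enn2real (F x) / f) \<partial>M) = 1"
    using f by (subst (asm) ennreal_mult_cancel_left) auto
  then have "ennreal (entropy_fun f) + ennreal f * (\<integral>\<^sup>+x. ennreal (entropy_fun (enn2real (F x) / f)) \<partial>M)
      \<le> (\<integral>\<^sup>+x. ennreal (entropy_fun (f * (enn2real (F x) / f))) \<partial>M)"
    using f by (intro entropy_chain_rule) auto
  also have "\<dots> = (\<integral>\<^sup>+x. ennreal (entropy_fun (enn2real (F x))) \<partial>M)"
    using f by simp
  finally show ?thesis
    unfolding f_def[symmetric] by (rule order_trans[rotated]) simp
qed

section \<open>The joint law of a sample and its redraws\<close>

context sequence_density
begin

text \<open>The refresh density uses only coordinates of \<open>x\<close> below \<open>n\<close>;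
  the acceptance probability uses coordinate \<open>n\<close> as well.\<close>

definition ker :: "nat \<Rightarrow> (nat \<Rightarrow> 'a) \<Rightarrow> ('a \<times> bool) measure" where
  "ker n x = step_kernel (M n) (\<lambda>u. cond_density n (x(n := u))) (cond_density n x)"

abbreviation "ZZ \<equiv> PiM UNIV (\<lambda>n. M n \<Otimes>\<^sub>M count_space (UNIV :: bool set))"

text \<open>A plain product is possible because no kernel refers to the outcome of another one:
  every past is the past of \<open>x\<close>.\<close>

definition ker_seq :: "(nat \<Rightarrow> 'a) \<Rightarrow> (nat \<Rightarrow> 'a \<times> bool) measure" where
  "ker_seq x = PiM UNIV (\<lambda>n. ker n x)"

lemma sets_ker [measurable_cong]: "sets (ker n x) = sets (M n \<Otimes>\<^sub>M count_space UNIV)"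
  by (simp add: ker_def step_kernel_def)

lemma sets_ker_seq [measurable_cong]: "sets (ker_seq x) = sets ZZ"
  unfolding ker_seq_def by (intro sets_PiM_cong refl sets_ker)

lemma prob_space_ker: "x \<in> space PP \<Longrightarrow> prob_space (ker n x)"
  unfolding ker_def by (intro prob_density.prob_space_step_kernel prob_density_cond_density)

lemma product_prob_space_ker: "x \<in> space PP \<Longrightarrow> product_prob_space (\<lambda>n. ker n x)"
  unfolding product_prob_space_def product_sigma_finite_def product_prob_space_axioms_def
  by (auto simp: prob_space_ker prob_space_imp_sigma_finite)

lemma nn_integral_ker_measurable:
  assumes h[measurable]: "h \<in> borel_measurable (PP \<Otimes>\<^sub>M (M n \<Otimes>\<^sub>M count_space UNIV))"
  shows "(\<lambda>x. \<integral>\<^sup>+z. h (x, z) \<partial>ker n x) \<in> borel_measurable PP"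
proof -
  have [measurable]: "(\<lambda>(x, u). cond_density n (x(n := u))) \<in> borel_measurable (PP \<Otimes>\<^sub>M M n)"
    by measurable
  have refresh[measurable]: "(\<lambda>(x, v). refresh_density (M n) (\<lambda>u. cond_density n (x(n := u))) v) \<in> borel_measurable (PP \<Otimes>\<^sub>M M n)"
    unfolding refresh_density_def by measurable
  have *: "(\<integral>\<^sup>+z. h (x, z) \<partial>ker n x) = ennreal (keep_prob (cond_density n x)) * (\<integral>\<^sup>+v. h (x, (v, True)) \<partial>M n) +
    ennreal (1 - keep_prob (cond_density n x)) * (\<integral>\<^sup>+v. refresh_density (M n) (\<lambda>u. cond_density n (x(n := u))) v * h (x, (v, False)) \<partial>M n)"
    if x: "x \<in> space PP" for x
    unfolding ker_def
    by (rule prob_density.nn_integral_step_kernel[OF prob_density_cond_density[OF x]]) (use x in measurable)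
  show ?thesis
    by (subst measurable_cong[OF *], assumption) measurable
qed

text \<open>Cylinders generate the product and are stable under intersection, and the probability of
  each is a finite product of functions measurable in \<open>x\<close>.\<close>

lemma ker_seq_measurable: "ker_seq \<in> PP \<rightarrow>\<^sub>M prob_algebra ZZ"
proof (rule measurable_prob_algebra_generated[OF sets_PiM Int_stable_prod_algebra prod_algebra_sets_into_space])
  fix x assume x: "x \<in> space PP"
  show "prob_space (ker_seq x)"
    unfolding ker_seq_def by (intro prob_space_PiM prob_space_ker x)
  show "sets (ker_seq x) = sets ZZ"
    by (rule sets_ker_seq)
next
  fix A assume "A \<in> prod_algebra UNIV (\<lambda>n. M n \<Otimes>\<^sub>M count_space (UNIV :: bool set))"
  then obtain J E where A: "A = prod_emb UNIV (\<lambda>n. M n \<Otimes>\<^sub>M count_space UNIV) J (Pi\<^sub>E J E)"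
    and J: "finite J" and E: "\<And>j. j \<in> J \<Longrightarrow> E j \<in> sets (M j \<Otimes>\<^sub>M count_space UNIV)"
    by (auto elim!: prod_algebraE)
  have *: "emeasure (ker_seq x) A = (\<Prod>j\<in>J. emeasure (ker j x) (E j))" if x: "x \<in> space PP" for x
  proof -
    have "A = prod_emb UNIV (\<lambda>n. ker n x) J (Pi\<^sub>E J E)"
      unfolding A prod_emb_def using sets_eq_imp_space_eq[OF sets_ker] by simp
    then show ?thesis
      unfolding ker_seq_def using J E x
      by (simp add: product_prob_space.emeasure_PiM_emb[OF product_prob_space_ker] sets_ker)
  qed
  have "(\<lambda>x. emeasure (ker j x) (E j)) \<in> borel_measurable PP" if "j \<in> J" for j
  proof -
    note [measurable] = E[OF that]
    have "(\<lambda>x. \<integral>\<^sup>+z. indicator (E j) (snd (x, z)) \<partial>ker j x) \<in> borel_measurable PP"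
      by (rule nn_integral_ker_measurable) measurable
    then show ?thesis
      using E[OF that] by (simp add: sets_ker)
  qed
  then show "(\<lambda>x. emeasure (ker_seq x) A) \<in> borel_measurable PP"
    by (subst measurable_cong[OF *]) (auto intro!: borel_measurable_prod_ennreal)
qed

definition joint_law :: "((nat \<Rightarrow> 'a) \<times> (nat \<Rightarrow> 'a \<times> bool)) measure" where
  "joint_law = density PP g \<bind> (\<lambda>x. distr (ker_seq x) (PP \<Otimes>\<^sub>M ZZ) (\<lambda>z. (x, z)))"

lemma joint_kernel_measurable:
  "(\<lambda>x. distr (ker_seq x) (PP \<Otimes>\<^sub>M ZZ) (\<lambda>z. (x, z))) \<in> PP \<rightarrow>\<^sub>M prob_algebra (PP \<Otimes>\<^sub>M ZZ)"
  by (rule measurable_distr_prob_space2[OF ker_seq_measurable]) measurable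

lemma density_in_prob_algebra: "density PP g \<in> space (prob_algebra PP)"
  by (auto simp: space_prob_algebra emeasure_density g_integral intro!: prob_spaceI cong: nn_integral_cong)

lemma sets_joint_law [measurable_cong]: "sets joint_law = sets (PP \<Otimes>\<^sub>M ZZ)"
  unfolding joint_law_def by (rule sets_bind'[OF density_in_prob_algebra joint_kernel_measurable])

lemma prob_space_joint_law: "prob_space joint_law"
  unfolding joint_law_def by (rule prob_space_bind'[OF density_in_prob_algebra joint_kernel_measurable])

lemma nn_integral_joint_law:
  assumes [measurable]: "h \<in> borel_measurable (PP \<Otimes>\<^sub>M ZZ)"
  shows "(\<integral>\<^sup>+y. h y \<partial>joint_law) = (\<integral>\<^sup>+x. g x * (\<integral>\<^sup>+z. h (x, z) \<partial>ker_seq x) \<partial>PP)"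
proof -
  let ?L = "\<lambda>x. distr (ker_seq x) (PP \<Otimes>\<^sub>M ZZ) (\<lambda>z. (x, z))"
  note L = measurable_prob_algebraD[OF joint_kernel_measurable]
  have m: "(\<lambda>x. \<integral>\<^sup>+y. h y \<partial>?L x) \<in> borel_measurable PP"
    by (rule measurable_compose[OF L nn_integral_measurable_subprob_algebra]) measurable
  have "(\<integral>\<^sup>+y. h y \<partial>joint_law) = (\<integral>\<^sup>+x. \<integral>\<^sup>+y. h y \<partial>?L x \<partial>density PP g)"
    unfolding joint_law_def by (rule nn_integral_bind) (use L in \<open>auto cong: measurable_cong_sets\<close>)
  also have "\<dots> = (\<integral>\<^sup>+x. g x * (\<integral>\<^sup>+y. h y \<partial>?L x) \<partial>PP)"
    by (rule nn_integral_density) (auto intro: m)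
  also have "\<dots> = (\<integral>\<^sup>+x. g x * (\<integral>\<^sup>+z. h (x, z) \<partial>ker_seq x) \<partial>PP)"
  proof (rule nn_integral_cong)
    fix x assume "x \<in> space PP"
    then have "(\<integral>\<^sup>+y. h y \<partial>?L x) = (\<integral>\<^sup>+z. h (x, z) \<partial>ker_seq x)"
      by (subst nn_integral_distr) (auto cong: measurable_cong_sets[OF sets_ker_seq refl])
    then show "g x * (\<integral>\<^sup>+y. h y \<partial>?L x) = g x * (\<integral>\<^sup>+z. h (x, z) \<partial>ker_seq x)"
      by simp
  qed
  finally show ?thesis .
qed

lemma nn_integral_ker_seq_prod:
  assumes x: "x \<in> space PP" and J: "finite J"
    and h: "\<And>j. j \<in> J \<Longrightarrow> h j \<in> borel_measurable (M j \<Otimes>\<^sub>M count_space UNIV)"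
  shows "(\<integral>\<^sup>+z. (\<Prod>j\<in>J. h j (z j)) \<partial>ker_seq x) = (\<Prod>j\<in>J. \<integral>\<^sup>+z. h j z \<partial>ker j x)"
  unfolding ker_seq_def
  by (rule product_prob_space.nn_integral_PiM_prod[OF product_prob_space_ker[OF x]])
     (use J h in \<open>auto cong: measurable_cong_sets[OF sets_ker refl]\<close>)

lemma nn_integral_ker_seq_component:
  assumes x: "x \<in> space PP" and h: "h \<in> borel_measurable (M j \<Otimes>\<^sub>M count_space UNIV)"
  shows "(\<integral>\<^sup>+z. h (z j) \<partial>ker_seq x) = (\<integral>\<^sup>+z. h z \<partial>ker j x)"
  using nn_integral_ker_seq_prod[OF x, of "{j}" "\<lambda>_. h"] h by simp

text \<open>The disintegration step behind both the law of the redrawn sequence and its cost: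
  coordinate \<open>n\<close> is integrated against its conditional density, while a factor
  \<open>W\<close> blind to it stays outside.\<close>

lemma nn_integral_marg_Suc:
  assumes [measurable]: "W \<in> borel_measurable PP" "c \<in> borel_measurable PP"
    and W: "\<And>x u. W (x(n := u)) = W x"
  shows "(\<integral>\<^sup>+x. marg (Suc n) x * (W x * c x) \<partial>PP) =
    (\<integral>\<^sup>+x. marg n x * (W x * (\<integral>\<^sup>+u. ennreal (cond_density n (x(n := u))) * c (x(n := u)) \<partial>M n)) \<partial>PP)"
proof -
  have "(\<integral>\<^sup>+x. marg (Suc n) x * (W x * c x) \<partial>PP) =
    (\<integral>\<^sup>+x. \<integral>\<^sup>+u. marg (Suc n) (x(n := u)) * (W x * c (x(n := u))) \<partial>M n \<partial>PP)"
    by (subst nn_integral_fun_upd[symmetric, of _ n]) (auto simp: W)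
  also have "\<dots> = (\<integral>\<^sup>+x. marg n x * (W x * (\<integral>\<^sup>+u. ennreal (cond_density n (x(n := u))) * c (x(n := u)) \<partial>M n)) \<partial>PP)"
  proof (rule nn_integral_cong_AE)
    show "AE x in PP. (\<integral>\<^sup>+u. marg (Suc n) (x(n := u)) * (W x * c (x(n := u))) \<partial>M n) =
      marg n x * (W x * (\<integral>\<^sup>+u. ennreal (cond_density n (x(n := u))) * c (x(n := u)) \<partial>M n))"
      using marg_finite_AE[of n] AE_space
    proof eventually_elim
      case (elim x)
      note [measurable] = elim(2)
      have "(\<integral>\<^sup>+u. marg (Suc n) (x(n := u)) * (W x * c (x(n := u))) \<partial>M n)
        = (\<integral>\<^sup>+u. (marg n x * W x) * (ennreal (cond_density n (x(n := u))) * c (x(n := u))) \<partial>M n)"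
        using marg_Suc_factor[OF elim(2,1)] by (intro nn_integral_cong_AE) (auto simp: ac_simps)
      also have "\<dots> = (marg n x * W x) * (\<integral>\<^sup>+u. ennreal (cond_density n (x(n := u))) * c (x(n := u)) \<partial>M n)"
        by (rule nn_integral_cmult) measurable
      finally show ?case by (simp add: mult.assoc)
    qed
  qed
  finally show ?thesis .
qed

end

context sequence_density
begin

lemma cond_density_splice_seq: "n < k \<Longrightarrow> cond_density n (splice_seq k x w) = cond_density n x"
  by (simp add: cond_density_def marg_splice_seq)

lemma ker_splice_seq:
  assumes "n < k"
  shows "ker n (splice_seq k x w) = ker n x"
proof -
  have "(splice_seq k x w)(n := u) = splice_seq k (x(n := u)) w" for u
    using assms by (auto simp: splice_seq_def fun_eq_iff)
  then show ?thesis
    using assms by (simp add: ker_def cond_density_splice_seq)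
qed

lemma ker_fun_upd:
  assumes "n < k"
  shows "ker n (x(k := u)) = ker n x"
proof -
  have "splice_seq k (x(k := u)) w = splice_seq k x w" for w
    by (auto simp: splice_seq_def fun_eq_iff)
  then show ?thesis
    using ker_splice_seq[OF assms] by metis
qed

section \<open>The redrawn sequence has the product law\<close>

definition target :: "(nat \<Rightarrow> 'a) \<times> (nat \<Rightarrow> 'a \<times> bool) \<Rightarrow> nat \<Rightarrow> 'a" where
  "target y n = (if snd (snd y n) then fst y n else fst (snd y n))"

lemma target_measurable [measurable]: "target \<in> PP \<Otimes>\<^sub>M ZZ \<rightarrow>\<^sub>M PP"
proof (rule measurable_PiM_single')
  fix n :: nat
  have [measurable]: "(\<lambda>z. z n) \<in> ZZ \<rightarrow>\<^sub>M M n \<Otimes>\<^sub>M count_space UNIV"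
    by (rule measurable_component_singleton) simp
  show "(\<lambda>y. target y n) \<in> PP \<Otimes>\<^sub>M ZZ \<rightarrow>\<^sub>M M n"
    unfolding target_def by measurable
qed (auto simp: target_def space_pair_measure space_PiM PiE_iff, metis mem_Times_iff)

text \<open>The conditional probability of \<open>target y n\<close> lying in \<open>A\<close> given
  the sample; a function of the first \<open>n + 1\<close> coordinates.\<close>

definition hit :: "'a set \<Rightarrow> nat \<Rightarrow> (nat \<Rightarrow> 'a) \<Rightarrow> ennreal" where
  "hit A n x = (\<integral>\<^sup>+z. indicator A (if snd z then x n else fst z) \<partial>ker n x)"

lemma hit_measurable: "A \<in> sets (M n) \<Longrightarrow> hit A n \<in> borel_measurable PP"
proof -
  assume [measurable]: "A \<in> sets (M n)"
  have "(\<lambda>x. \<integral>\<^sup>+z. (\<lambda>(x, z). indicator A (if snd z then x n else fst z)) (x, z) \<partial>ker n x) \<in> borel_measurable PP"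
    by (rule nn_integral_ker_measurable) measurable
  then show ?thesis by (simp add: hit_def[abs_def])
qed

lemma hit_fun_upd: "n < k \<Longrightarrow> hit A n (x(k := u)) = hit A n x"
  unfolding hit_def by (subst fun_upd_other) (simp_all add: ker_fun_upd)

lemma splice_seq_less: "n < k \<Longrightarrow> splice_seq k x w n = x n"
  by (simp add: splice_seq_def)

lemma hit_splice_seq: "n < k \<Longrightarrow> hit A n (splice_seq k x w) = hit A n x"
  unfolding hit_def by (subst splice_seq_less) (simp_all add: ker_splice_seq)

text \<open>Peel off the last coordinate. By \<open>step_kernel_target\<close> its average is the
  mass of \<open>A n\<close> whatever the past, so it leaves the integral as a constant; this is the
  independence of the target coordinates.\<close>

lemma nn_integral_marg_hit:
  assumes A: "\<And>i. A i \<in> sets (M i)"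
  shows "(\<integral>\<^sup>+x. marg n x * (\<Prod>i<n. hit (A i) i x) \<partial>PP) = (\<Prod>i<n. emeasure (M i) (A i))"
proof (induction n)
  case 0
  then show ?case by (simp add: marg_integral)
next
  case (Suc n)
  have [measurable]: "hit (A i) i \<in> borel_measurable PP" for i
    by (rule hit_measurable[OF A])
  have inner: "(\<integral>\<^sup>+u. ennreal (cond_density n (x(n := u))) * hit (A n) n (x(n := u)) \<partial>M n) = emeasure (M n) (A n)"
    if x: "x \<in> space PP" for x
    using prob_density.step_kernel_target[OF prob_density_cond_density[OF x], of "indicator (A n)" n] A[of n]
    unfolding hit_def ker_def fun_upd_same fun_upd_upd by simp
  have "(\<integral>\<^sup>+x. marg (Suc n) x * (\<Prod>i<Suc n. hit (A i) i x) \<partial>PP) =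
    (\<integral>\<^sup>+x. marg (Suc n) x * ((\<Prod>i<n. hit (A i) i x) * hit (A n) n x) \<partial>PP)"
    by simp
  also have "\<dots> = (\<integral>\<^sup>+x. marg n x * ((\<Prod>i<n. hit (A i) i x) * (\<integral>\<^sup>+u. ennreal (cond_density n (x(n := u))) * hit (A n) n (x(n := u)) \<partial>M n)) \<partial>PP)"
    by (rule nn_integral_marg_Suc) (auto intro!: prod.cong simp: hit_fun_upd)
  also have "\<dots> = (\<integral>\<^sup>+x. (marg n x * (\<Prod>i<n. hit (A i) i x)) * emeasure (M n) (A n) \<partial>PP)"
    by (intro nn_integral_cong) (simp add: inner mult.assoc)
  also have "\<dots> = (\<Prod>i<Suc n. emeasure (M i) (A i))"
    by (subst nn_integral_multc) (auto simp: Suc.IH)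
  finally show ?case .
qed

lemma distr_joint_law_target: "distr joint_law PP target = PP"
proof (rule PiM_eq)
  fix J :: "nat set" and F assume J: "finite J" and F: "\<And>j. j \<in> J \<Longrightarrow> F j \<in> sets (M j)"
  from J obtain n where n: "J \<subseteq> {..<n}"
    by (metis finite_nat_bounded)
  \<comment> \<open>Padding with whole spaces replaces \<open>J\<close> by an initial segment, on
    which the induction over coordinates runs.\<close>
  define A where "A i = (if i \<in> J then F i else space (M i))" for i
  have A[measurable]: "A i \<in> sets (M i)" for i
    using F by (auto simp: A_def)
  have [measurable]: "(\<lambda>z. z i) \<in> ZZ \<rightarrow>\<^sub>M M i \<Otimes>\<^sub>M count_space UNIV" for i
    by (rule measurable_component_singleton) simp
  have emb: "prod_emb UNIV M J (\<Pi>\<^sub>E j\<in>J. F j) \<in> sets PP"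
    using J F by (auto intro!: sets_PiM_I)
  have ind: "indicator (prod_emb UNIV M J (\<Pi>\<^sub>E j\<in>J. F j)) y = (\<Prod>i<n. indicator (A i) (y i) :: ennreal)"
    if "y \<in> space PP" for y
  proof -
    have "y \<in> prod_emb UNIV M J (\<Pi>\<^sub>E j\<in>J. F j) \<longleftrightarrow> (\<forall>i<n. y i \<in> A i)"
      using n that by (auto simp: prod_emb_def A_def space_PiM PiE_iff)
    then show ?thesis
      by (auto simp: indicator_def)
  qed
  have "emeasure (distr joint_law PP target) (prod_emb UNIV M J (\<Pi>\<^sub>E j\<in>J. F j)) =
    (\<integral>\<^sup>+y. indicator (prod_emb UNIV M J (\<Pi>\<^sub>E j\<in>J. F j)) y \<partial>distr joint_law PP target)"
    using emb by simp
  also have "\<dots> = (\<integral>\<^sup>+y. indicator (prod_emb UNIV M J (\<Pi>\<^sub>E j\<in>J. F j)) (target y) \<partial>joint_law)"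
    using emb by (subst nn_integral_distr) auto
  also have "\<dots> = (\<integral>\<^sup>+y. (\<Prod>i<n. indicator (A i) (target y i)) \<partial>joint_law)"
    using measurable_space[OF target_measurable] sets_eq_imp_space_eq[OF sets_joint_law]
    by (intro nn_integral_cong ind) auto
  also have "\<dots> = (\<integral>\<^sup>+x. g x * (\<integral>\<^sup>+z. (\<Prod>i<n. indicator (A i) (target (x, z) i)) \<partial>ker_seq x) \<partial>PP)"
    unfolding target_def by (rule nn_integral_joint_law) measurable
  also have "\<dots> = (\<integral>\<^sup>+x. g x * (\<Prod>i<n. hit (A i) i x) \<partial>PP)"
  proof (rule nn_integral_cong)
    fix x assume x: "x \<in> space PP"
    then have xi: "x i \<in> space (M i)" for i by (auto simp: space_PiM)
    have "(\<lambda>z. indicator (A i) (if snd z then x i else fst z) :: ennreal) \<in> borel_measurable (M i \<Otimes>\<^sub>M count_space UNIV)" for i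
      using xi[of i] by measurable
    then show "g x * (\<integral>\<^sup>+z. (\<Prod>i<n. indicator (A i) (target (x, z) i)) \<partial>ker_seq x) = g x * (\<Prod>i<n. hit (A i) i x)"
      using nn_integral_ker_seq_prod[OF x, of "{..<n}" "\<lambda>i z. indicator (A i) (if snd z then x i else fst z)"]
      unfolding target_def hit_def fst_conv snd_conv by simp
  qed
  also have "\<dots> = (\<integral>\<^sup>+x. marg n x * (\<Prod>i<n. hit (A i) i x) \<partial>PP)"
    by (rule nn_integral_marg)
       (auto intro!: borel_measurable_prod_ennreal hit_measurable A prod.cong simp: hit_splice_seq)
  also have "\<dots> = (\<Prod>i<n. emeasure (M i) (A i))"
    by (rule nn_integral_marg_hit) (rule A)
  also have "\<dots> = (\<Prod>j\<in>J. emeasure (M j) (F j))"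
    by (rule prod.mono_neutral_cong_right) (use n in \<open>auto simp: A_def M.emeasure_space_1\<close>)
  finally show "emeasure (distr joint_law PP target) (prod_emb UNIV M J (\<Pi>\<^sub>E j\<in>J. F j)) = (\<Prod>j\<in>J. emeasure (M j) (F j))" .
qed simp

lemma distr_joint_law_fst: "distr joint_law PP fst = density PP g"
proof (rule measure_eqI)
  fix A assume "A \<in> sets (distr joint_law PP fst)"
  then have [measurable]: "A \<in> sets PP" by simp
  have ps: "prob_space (ker_seq x)" if "x \<in> space PP" for x
    unfolding ker_seq_def by (intro prob_space_PiM prob_space_ker that)
  have "emeasure (distr joint_law PP fst) A = (\<integral>\<^sup>+x. indicator A x \<partial>distr joint_law PP fst)"
    by simp
  also have "\<dots> = (\<integral>\<^sup>+y. indicator A (fst y) \<partial>joint_law)"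
    by (rule nn_integral_distr) measurable
  also have "\<dots> = (\<integral>\<^sup>+x. g x * (\<integral>\<^sup>+z. indicator A (fst (x, z)) \<partial>ker_seq x) \<partial>PP)"
    by (rule nn_integral_joint_law) measurable
  also have "\<dots> = (\<integral>\<^sup>+x. g x * indicator A x \<partial>PP)"
    by (intro nn_integral_cong) (simp add: prob_space.emeasure_space_1[OF ps])
  also have "\<dots> = emeasure (density PP g) A"
    by (simp add: emeasure_density)
  finally show "emeasure (distr joint_law PP fst) A = emeasure (density PP g) A" .
qed simp

section \<open>Entropy and cost, coordinate by coordinate\<close>

abbreviation "entr F \<equiv> \<integral>\<^sup>+x. ennreal (entropy_fun (enn2real (F x))) \<partial>PP"

text \<open>\<open>marg n\<close> averages \<open>g\<close> over the unrevealed tail, so Jensen's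
  inequality applies for almost every past.\<close>

lemma entropy_marg_le: "entr (marg n) \<le> entr g"
proof -
  have "entr (marg n) \<le> (\<integral>\<^sup>+x. \<integral>\<^sup>+w. ennreal (entropy_fun (enn2real (g (splice_seq n x w)))) \<partial>PP \<partial>PP)"
  proof (rule nn_integral_mono_AE)
    show "AE x in PP. ennreal (entropy_fun (enn2real (marg n x))) \<le> (\<integral>\<^sup>+w. ennreal (entropy_fun (enn2real (g (splice_seq n x w)))) \<partial>PP)"
      using marg_finite_AE[of n] AE_space
    proof eventually_elim
      case (elim x)
      note [measurable] = elim(2)
      show ?case
        using elim(1) unfolding marg_def by (intro entropy_jensen) auto
    qed
  qed
  also have "\<dots> = entr g"
    by (rule nn_integral_splice_seq) measurable
  finally show ?thesis .
qed

text \<open>The chain rule for a fixed past. A past of density 0 is treated separately: its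
  conditional term has weight 0 and the other two terms are \<open>entropy_fun 0\<close>.\<close>

lemma entropy_marg_Suc:
  "entr (marg n) + (\<integral>\<^sup>+x. marg n x * (\<integral>\<^sup>+u. ennreal (entropy_fun (cond_density n (x(n := u)))) \<partial>M n) \<partial>PP)
    \<le> entr (marg (Suc n))"
proof -
  have "entr (marg n) + (\<integral>\<^sup>+x. marg n x * (\<integral>\<^sup>+u. ennreal (entropy_fun (cond_density n (x(n := u)))) \<partial>M n) \<partial>PP)
    = (\<integral>\<^sup>+x. ennreal (entropy_fun (enn2real (marg n x))) + marg n x * (\<integral>\<^sup>+u. ennreal (entropy_fun (cond_density n (x(n := u)))) \<partial>M n) \<partial>PP)"
    by (rule nn_integral_add[symmetric]) measurable
  also have "\<dots> \<le> (\<integral>\<^sup>+x. \<integral>\<^sup>+u. ennreal (entropy_fun (enn2real (marg (Suc n) (x(n := u))))) \<partial>M n \<partial>PP)"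
  proof (rule nn_integral_mono_AE)
    show "AE x in PP. ennreal (entropy_fun (enn2real (marg n x))) + marg n x * (\<integral>\<^sup>+u. ennreal (entropy_fun (cond_density n (x(n := u)))) \<partial>M n)
      \<le> (\<integral>\<^sup>+u. ennreal (entropy_fun (enn2real (marg (Suc n) (x(n := u))))) \<partial>M n)"
      using marg_finite_AE[of n] AE_space
    proof eventually_elim
      case (elim x)
      note x[measurable] = elim(2)
      interpret r: prob_density "M n" "\<lambda>u. cond_density n (x(n := u))"
        by (rule prob_density_cond_density[OF x])
      define f where "f = enn2real (marg n x)"
      have f_eq: "marg n x = ennreal f" "0 \<le> f"
        using elim by (simp_all add: f_def less_top)
      have "AE u in M n. enn2real (marg (Suc n) (x(n := u))) = f * cond_density n (x(n := u))"
        using marg_Suc_factor[OF x elim(1)] by eventually_elim (simp add: f_eq ennreal_mult[symmetric])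
      then have eq: "(\<integral>\<^sup>+u. ennreal (entropy_fun (enn2real (marg (Suc n) (x(n := u))))) \<partial>M n)
        = (\<integral>\<^sup>+u. ennreal (entropy_fun (f * cond_density n (x(n := u)))) \<partial>M n)"
        by (intro nn_integral_cong_AE) auto
      show ?case
      proof (cases "f = 0")
        case True
        then show ?thesis
          unfolding eq f_eq by (simp add: entropy_fun_def M.emeasure_space_1)
      next
        case False
        then show ?thesis
          unfolding eq f_eq(1) enn2real_ennreal[OF f_eq(2)] using f_eq(2) r.r_integral
          by (intro prob_space.entropy_chain_rule[OF M.prob_space_axioms]) auto
      qed
    qed
  qed
  also have "\<dots> = entr (marg (Suc n))"
    by (rule nn_integral_fun_upd) measurable
  finally show ?thesis .
qed

lemma entropy_increments_le:
  "(\<Sum>n. \<integral>\<^sup>+x. marg n x * (\<integral>\<^sup>+u. ennreal (entropy_fun (cond_density n (x(n := u)))) \<partial>M n) \<partial>PP) \<le> entr g"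
proof -
  let ?I = "\<lambda>n. \<integral>\<^sup>+x. marg n x * (\<integral>\<^sup>+u. ennreal (entropy_fun (cond_density n (x(n := u)))) \<partial>M n) \<partial>PP"
  have "(\<Sum>i<n. ?I i) \<le> entr (marg n)" for n
  proof (induction n)
    case (Suc n)
    have "(\<Sum>i<Suc n. ?I i) \<le> entr (marg n) + ?I n"
      unfolding sum.lessThan_Suc by (rule add_right_mono[OF Suc])
    also have "\<dots> \<le> entr (marg (Suc n))"
      by (rule entropy_marg_Suc)
    finally show ?case .
  qed simp
  then have "(\<Sum>i<n. ?I i) \<le> entr g" for n
    using entropy_marg_le order_trans by blast
  then show ?thesis
    by (intro suminf_le_const) auto
qed

context
  fixes D :: "nat \<Rightarrow> 'a \<Rightarrow> real" and \<theta> :: real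
  assumes D_measurable [measurable]: "\<And>n. D n \<in> borel_measurable (M n)"
    and D_nonneg: "\<And>n x. 0 \<le> D n x" and \<theta>: "0 \<le> \<theta>"
begin

text \<open>Charging the full mass of both pieces forgets which points they share; for small pieces
  this is affordable. A kept coordinate costs nothing because it agrees with its target.\<close>

definition mismatch_cost :: "nat \<Rightarrow> (nat \<Rightarrow> 'a) \<times> (nat \<Rightarrow> 'a \<times> bool) \<Rightarrow> ennreal" where
  "mismatch_cost n y = (if snd (snd y n) then 0 else ennreal (D n (fst y n)) + ennreal (D n (fst (snd y n))))"

lemma mismatch_cost_measurable [measurable]: "mismatch_cost n \<in> borel_measurable (PP \<Otimes>\<^sub>M ZZ)"
proof -
  have [measurable]: "(\<lambda>z. z n) \<in> ZZ \<rightarrow>\<^sub>M M n \<Otimes>\<^sub>M count_space UNIV"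
    by (rule measurable_component_singleton) simp
  show ?thesis
    unfolding mismatch_cost_def[abs_def] by measurable
qed

text \<open>The conditional cost \<open>C\<close> sees only the first \<open>n + 1\<close>
  coordinates, which reduces \<open>g\<close> to \<open>marg (Suc n)\<close>. With the past frozen,
  what remains is the bound for one coordinate; its error term does not depend on the past and
  \<open>marg n\<close> has integral 1.\<close>

lemma mismatch_cost_bound:
  "ennreal \<theta> * (\<integral>\<^sup>+y. mismatch_cost n y \<partial>joint_law) \<le>
    (\<integral>\<^sup>+x. marg n x * (\<integral>\<^sup>+u. ennreal (entropy_fun (cond_density n (x(n := u)))) \<partial>M n) \<partial>PP)
    + (\<integral>\<^sup>+u. ennreal (exp_excess (\<theta> * D n u)) \<partial>M n)"
proof -
  define C where "C x = (\<integral>\<^sup>+z. (if snd z then 0 else ennreal (D n (x n)) + ennreal (D n (fst z))) \<partial>ker n x)" for x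
  let ?J = "\<lambda>x. \<integral>\<^sup>+u. ennreal (entropy_fun (cond_density n (x(n := u)))) \<partial>M n"
  let ?a = "\<integral>\<^sup>+u. ennreal (exp_excess (\<theta> * D n u)) \<partial>M n"
  have C_measurable[measurable]: "C \<in> borel_measurable PP"
  proof -
    have "(\<lambda>x. \<integral>\<^sup>+z. (\<lambda>(x, z). if snd z then 0 else ennreal (D n (x n)) + ennreal (D n (fst z))) (x, z) \<partial>ker n x) \<in> borel_measurable PP"
      by (rule nn_integral_ker_measurable) measurable
    then show ?thesis by (simp add: C_def[abs_def])
  qed
  have bound: "ennreal \<theta> * (\<integral>\<^sup>+u. ennreal (cond_density n (x(n := u))) * C (x(n := u)) \<partial>M n) \<le> ?J x + ?a"
    if x: "x \<in> space PP" for x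
    using prob_density.step_kernel_cost_bound[OF prob_density_cond_density[OF x], where D = "D n" and \<theta> = \<theta>] D_nonneg \<theta>
    unfolding C_def ker_def fun_upd_same fun_upd_upd by simp
  have "(\<integral>\<^sup>+y. mismatch_cost n y \<partial>joint_law) = (\<integral>\<^sup>+x. g x * (\<integral>\<^sup>+z. mismatch_cost n (x, z) \<partial>ker_seq x) \<partial>PP)"
    by (rule nn_integral_joint_law) measurable
  also have "\<dots> = (\<integral>\<^sup>+x. g x * C x \<partial>PP)"
  proof (rule nn_integral_cong)
    fix x assume x: "x \<in> space PP"
    then have "x n \<in> space (M n)" by (auto simp: space_PiM)
    then have "(\<lambda>z. if snd z then 0 else ennreal (D n (x n)) + ennreal (D n (fst z))) \<in> borel_measurable (M n \<Otimes>\<^sub>M count_space UNIV)"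
      by measurable
    from nn_integral_ker_seq_component[OF x this]
    show "g x * (\<integral>\<^sup>+z. mismatch_cost n (x, z) \<partial>ker_seq x) = g x * C x"
      unfolding mismatch_cost_def C_def fst_conv snd_conv by simp
  qed
  also have "\<dots> = (\<integral>\<^sup>+x. marg (Suc n) x * C x \<partial>PP)"
  proof (rule nn_integral_marg)
    show "C (splice_seq (Suc n) x w) = C x" for x w
      unfolding C_def by (subst splice_seq_less) (simp_all add: ker_splice_seq)
  qed measurable
  also have "\<dots> = (\<integral>\<^sup>+x. marg (Suc n) x * (1 * C x) \<partial>PP)"
    by simp
  also have "\<dots> = (\<integral>\<^sup>+x. marg n x * (1 * (\<integral>\<^sup>+u. ennreal (cond_density n (x(n := u))) * C (x(n := u)) \<partial>M n)) \<partial>PP)"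
    by (rule nn_integral_marg_Suc) auto
  finally have "ennreal \<theta> * (\<integral>\<^sup>+y. mismatch_cost n y \<partial>joint_law) =
    (\<integral>\<^sup>+x. marg n x * (ennreal \<theta> * (\<integral>\<^sup>+u. ennreal (cond_density n (x(n := u))) * C (x(n := u)) \<partial>M n)) \<partial>PP)"
    by (simp add: nn_integral_cmult[symmetric] ac_simps)
  also have "\<dots> \<le> (\<integral>\<^sup>+x. marg n x * (?J x + ?a) \<partial>PP)"
    by (intro nn_integral_mono mult_left_mono bound) auto
  also have "\<dots> = (\<integral>\<^sup>+x. marg n x * ?J x \<partial>PP) + ?a"
    by (simp add: distrib_left nn_integral_add nn_integral_multc marg_integral)
  finally show ?thesis .
qed

lemma transport_cost_bound:
  "ennreal \<theta> * (\<integral>\<^sup>+y. (\<Sum>n. mismatch_cost n y) \<partial>joint_law) \<le>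
    entr g + (\<Sum>n. \<integral>\<^sup>+u. ennreal (exp_excess (\<theta> * D n u)) \<partial>M n)"
proof -
  let ?I = "\<lambda>n. \<integral>\<^sup>+x. marg n x * (\<integral>\<^sup>+u. ennreal (entropy_fun (cond_density n (x(n := u)))) \<partial>M n) \<partial>PP"
  let ?a = "\<lambda>n. \<integral>\<^sup>+u. ennreal (exp_excess (\<theta> * D n u)) \<partial>M n"
  have "ennreal \<theta> * (\<integral>\<^sup>+y. (\<Sum>n. mismatch_cost n y) \<partial>joint_law) = (\<Sum>n. ennreal \<theta> * (\<integral>\<^sup>+y. mismatch_cost n y \<partial>joint_law))"
    by (subst nn_integral_suminf) (auto simp: ennreal_suminf_cmult)
  also have "\<dots> \<le> (\<Sum>n. ?I n + ?a n)"
    by (intro suminf_le mismatch_cost_bound) auto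
  also have "\<dots> = (\<Sum>n. ?I n) + (\<Sum>n. ?a n)"
    by (rule suminf_add[symmetric]) auto
  also have "\<dots> \<le> entr g + (\<Sum>n. ?a n)"
    by (intro add_right_mono entropy_increments_le)
  finally show ?thesis .
qed

end

end

section \<open>Compound Poisson laws\<close>

definition poisson_law :: "real \<Rightarrow> nat measure" where
  "poisson_law a = density (count_space UNIV) (\<lambda>k. ennreal (a ^ k / fact k * exp (- a)))"

lemma sets_poisson_law [simp, measurable_cong]: "sets (poisson_law a) = sets (count_space UNIV)"
  by (simp add: poisson_law_def)

lemma nn_integral_poisson_law:
  assumes "0 \<le> a" "\<And>k. 0 \<le> f k" "(\<lambda>k. a ^ k / fact k * exp (- a) * f k) sums s"
  shows "(\<integral>\<^sup>+k. ennreal (f k) \<partial>poisson_law a) = ennreal s"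
proof -
  have "(\<integral>\<^sup>+k. ennreal (f k) \<partial>poisson_law a) = (\<Sum>k. ennreal (a ^ k / fact k * exp (- a) * f k))"
    unfolding poisson_law_def using assms(1,2)
    by (subst nn_integral_density)
       (auto simp: nn_integral_count_space_nat ennreal_mult[symmetric] intro!: suminf_cong)
  also have "\<dots> = ennreal s"
    using assms by (simp add: suminf_ennreal2 sums_iff)
  finally show ?thesis .
qed

lemma nn_integral_poisson_law_power:
  assumes "0 \<le> a" "0 \<le> h"
  shows "(\<integral>\<^sup>+k. ennreal h ^ k \<partial>poisson_law a) = ennreal (exp (a * (h - 1)))"
proof -
  have "(\<lambda>k. exp (- a) * ((a * h) ^ k /\<^sub>R fact k)) sums (exp (- a) * exp (a * h))"
    by (intro sums_mult exp_converges)
  also have "(\<lambda>k. exp (- a) * ((a * h) ^ k /\<^sub>R fact k)) = (\<lambda>k. a ^ k / fact k * exp (- a) * h ^ k)"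
    by (auto simp: fun_eq_iff power_mult_distrib divide_inverse)
  also have "exp (- a) * exp (a * h) = exp (a * (h - 1))"
    by (simp add: exp_add[symmetric] algebra_simps)
  finally show ?thesis
    using nn_integral_poisson_law[of a "\<lambda>k. h ^ k"] assms by (simp add: ennreal_power)
qed

lemma prob_space_poisson_law: "0 \<le> a \<Longrightarrow> prob_space (poisson_law a)"
  using nn_integral_poisson_law_power[of a 1] by (intro prob_spaceI) simp

lemma nn_integral_poisson_law_mean:
  assumes "0 \<le> a"
  shows "(\<integral>\<^sup>+k. ennreal (real k) \<partial>poisson_law a) = ennreal a"
proof -
  have "(\<lambda>k. a * exp (- a) * (a ^ k /\<^sub>R fact k)) sums (a * exp (- a) * exp a)"
    by (intro sums_mult exp_converges)
  also have "a * exp (- a) * exp a = a"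
    by (simp add: exp_minus)
  also have "(\<lambda>k. a * exp (- a) * (a ^ k /\<^sub>R fact k)) = (\<lambda>k. a ^ Suc k / fact (Suc k) * exp (- a) * real (Suc k))"
  proof
    fix k :: nat
    have "fact (Suc k) = real (Suc k) * fact k" "real (Suc k) \<noteq> 0" by simp_all
    then show "a * exp (- a) * (a ^ k /\<^sub>R fact k) = a ^ Suc k / fact (Suc k) * exp (- a) * real (Suc k)"
      by (simp only: power_Suc) (simp add: divide_inverse)
  qed
  finally have "(\<lambda>k. a ^ k / fact k * exp (- a) * real k) sums a"
    using sums_Suc_iff[of "\<lambda>k. a ^ k / fact k * exp (- a) * real k" a] by simp
  then show ?thesis
    using assms by (intro nn_integral_poisson_law) auto
qed

text \<open>A number of points together with an infinite independent sequence of which only that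
  many terms count. This avoids a union of product spaces of varying length.\<close>

definition compound_poisson :: "real \<Rightarrow> 'e measure \<Rightarrow> (nat \<times> (nat \<Rightarrow> 'e)) measure" where
  "compound_poisson a \<nu> = poisson_law a \<Otimes>\<^sub>M PiM UNIV (\<lambda>_. \<nu>)"

lemma sets_compound_poisson [measurable_cong]:
  "sets \<nu> = sets N \<Longrightarrow> sets (compound_poisson a \<nu>) = sets (count_space UNIV \<Otimes>\<^sub>M PiM UNIV (\<lambda>_. N))"
  unfolding compound_poisson_def by (intro sets_pair_measure_cong sets_PiM_cong) auto

lemma measurable_point_prod:
  assumes [measurable]: "H \<in> borel_measurable N"
  shows "(\<lambda>(n, z). \<Prod>k<n. H (z k) :: ennreal) \<in> borel_measurable (count_space UNIV \<Otimes>\<^sub>M PiM UNIV (\<lambda>_::nat. N))"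
  unfolding case_prod_beta
  by (rule measurable_compose_countable[where g = fst]) measurable

lemma measurable_point_sum:
  fixes H :: "'e \<Rightarrow> 'b :: {second_countable_topology, topological_comm_monoid_add}"
  assumes [measurable]: "H \<in> borel_measurable N"
  shows "(\<lambda>(n, z). \<Sum>k<n. H (z k)) \<in> borel_measurable (count_space UNIV \<Otimes>\<^sub>M PiM UNIV (\<lambda>_::nat. N))"
  unfolding case_prod_beta
  by (rule measurable_compose_countable[where g = fst]) measurable

lemma prob_space_compound_poisson:
  assumes "0 \<le> a" "prob_space \<nu>"
  shows "prob_space (compound_poisson a \<nu>)"
  unfolding compound_poisson_def
  by (intro prob_space_pair prob_space_poisson_law prob_space_PiM assms)

lemma nn_integral_compound_poisson:
  assumes "prob_space \<nu>" and f: "f \<in> borel_measurable (count_space UNIV \<Otimes>\<^sub>M PiM UNIV (\<lambda>_::nat. \<nu>))"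
  shows "(\<integral>\<^sup>+y. f y \<partial>compound_poisson a \<nu>) = (\<integral>\<^sup>+n. \<integral>\<^sup>+z. f (n, z) \<partial>PiM UNIV (\<lambda>_. \<nu>) \<partial>poisson_law a)"
proof -
  interpret Z: prob_space "PiM (UNIV :: nat set) (\<lambda>_. \<nu>)"
    by (intro prob_space_PiM assms)
  have "sets (poisson_law a \<Otimes>\<^sub>M PiM (UNIV :: nat set) (\<lambda>_. \<nu>)) = sets (count_space UNIV \<Otimes>\<^sub>M PiM UNIV (\<lambda>_. \<nu>))"
    by (intro sets_pair_measure_cong) auto
  with f have "f \<in> borel_measurable (poisson_law a \<Otimes>\<^sub>M PiM UNIV (\<lambda>_::nat. \<nu>))"
    by (simp cong: measurable_cong_sets)
  then show ?thesis
    unfolding compound_poisson_def by (rule Z.nn_integral_fst[symmetric])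
qed

text \<open>Given \<open>n\<close> points the mean is \<open>h ^ n\<close>, and the Poisson
  generating function does the rest. Taking \<open>H\<close> as \<open>exp (\<theta> \<phi>)\<close>
  gives exponential moments; \<open>H\<close> bounded by 1 serves to identify laws.\<close>

lemma compound_poisson_functional:
  assumes a: "0 \<le> a" and \<nu>: "prob_space \<nu>" and [measurable]: "H \<in> borel_measurable \<nu>"
    and h: "(\<integral>\<^sup>+x. H x \<partial>\<nu>) = ennreal h" "0 \<le> h"
  shows "(\<integral>\<^sup>+(n, z). (\<Prod>k<n. H (z k)) \<partial>compound_poisson a \<nu>) = ennreal (exp (a * (h - 1)))"
proof -
  interpret product_prob_space "\<lambda>_::nat. \<nu>" UNIV
    using \<nu> by (simp add: product_prob_space_def product_sigma_finite_def product_prob_space_axioms_def prob_space_imp_sigma_finite)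
  have "(\<integral>\<^sup>+(n, z). (\<Prod>k<n. H (z k)) \<partial>compound_poisson a \<nu>) =
    (\<integral>\<^sup>+n. \<integral>\<^sup>+z. (\<Prod>k<n. H (z k)) \<partial>PiM UNIV (\<lambda>_. \<nu>) \<partial>poisson_law a)"
    by (subst nn_integral_compound_poisson[OF \<nu> measurable_point_prod]) auto
  also have "\<dots> = (\<integral>\<^sup>+n. ennreal h ^ n \<partial>poisson_law a)"
    by (intro nn_integral_cong) (subst nn_integral_PiM_prod, auto simp: h)
  also have "\<dots> = ennreal (exp (a * (h - 1)))"
    by (rule nn_integral_poisson_law_power[OF a h(2)])
  finally show ?thesis .
qed

lemma compound_poisson_mean:
  assumes a: "0 \<le> a" and \<nu>: "prob_space \<nu>" and [measurable]: "H \<in> borel_measurable \<nu>"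
  shows "(\<integral>\<^sup>+(n, z). (\<Sum>k<n. H (z k)) \<partial>compound_poisson a \<nu>) = ennreal a * (\<integral>\<^sup>+x. H x \<partial>\<nu>)"
proof -
  interpret product_prob_space "\<lambda>_::nat. \<nu>" UNIV
    using \<nu> by (simp add: product_prob_space_def product_sigma_finite_def product_prob_space_axioms_def prob_space_imp_sigma_finite)
  have component: "(\<integral>\<^sup>+z. H (z k) \<partial>PiM UNIV (\<lambda>_. \<nu>)) = (\<integral>\<^sup>+x. H x \<partial>\<nu>)" for k :: nat
    using nn_integral_PiM_prod[of "{k}" "\<lambda>_. H"] by simp
  have "(\<integral>\<^sup>+(n, z). (\<Sum>k<n. H (z k)) \<partial>compound_poisson a \<nu>) =
    (\<integral>\<^sup>+n. \<integral>\<^sup>+z. (\<Sum>k<n. H (z k)) \<partial>PiM UNIV (\<lambda>_. \<nu>) \<partial>poisson_law a)"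
    by (subst nn_integral_compound_poisson[OF \<nu> measurable_point_sum]) auto
  also have "\<dots> = (\<integral>\<^sup>+n. ennreal (real n) * (\<integral>\<^sup>+x. H x \<partial>\<nu>) \<partial>poisson_law a)"
    by (intro nn_integral_cong) (simp add: nn_integral_sum component ennreal_of_nat_eq_real_of_nat)
  also have "\<dots> = ennreal a * (\<integral>\<^sup>+x. H x \<partial>\<nu>)"
    by (subst nn_integral_multc) (auto simp: nn_integral_poisson_law_mean[OF a])
  finally show ?thesis .
qed

text \<open>The quadratic error term is what disappears when the intensity is cut into small pieces.\<close>

lemma compound_poisson_exp_excess:
  fixes \<phi> :: "'e \<Rightarrow> real"
  assumes a: "0 \<le> a" and \<nu>: "prob_space \<nu>" and [measurable]: "\<phi> \<in> borel_measurable \<nu>"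
    and \<phi>: "\<And>x. 0 \<le> \<phi> x" "\<And>x. \<phi> x \<le> K" and \<theta>: "0 \<le> \<theta>"
    and small: "a * (exp (\<theta> * K) - 1) \<le> 1"
  shows "(\<integral>\<^sup>+(n, z). ennreal (exp_excess (\<theta> * (\<Sum>k<n. \<phi> (z k)))) \<partial>compound_poisson a \<nu>)
    \<le> ennreal (a * (\<integral>x. exp_excess (\<theta> * \<phi> x) \<partial>\<nu>) + (a * (exp (\<theta> * K) - 1))\<^sup>2)"
proof -
  interpret prob_space \<nu> by fact
  interpret C: prob_space "compound_poisson a \<nu>"
    by (rule prob_space_compound_poisson[OF a \<nu>])
  note [measurable_cong] = sets_compound_poisson[OF refl, of a \<nu>]
  have [measurable]: "(\<lambda>(n, z). \<Sum>k<n. \<phi> (z k)) \<in> borel_measurable (compound_poisson a \<nu>)"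
    using measurable_point_sum[of \<phi> \<nu>] by (simp cong: measurable_cong_sets)
  define I where "I = (\<integral>\<^sup>+(n, z). ennreal (exp_excess (\<theta> * (\<Sum>k<n. \<phi> (z k)))) \<partial>compound_poisson a \<nu>)"
  define p e where "p = (\<integral>x. \<phi> x \<partial>\<nu>)" and "e = (\<integral>x. exp (\<theta> * \<phi> x) \<partial>\<nu>)"
  have int\<phi>: "integrable \<nu> \<phi>"
    using \<phi> by (intro integrable_const_bound[of _ K]) auto
  have exp_bounds: "1 \<le> exp (\<theta> * \<phi> x)" "exp (\<theta> * \<phi> x) \<le> exp (\<theta> * K)" for x
    using \<phi> \<theta> by (auto intro!: mult_left_mono)
  have inte: "integrable \<nu> (\<lambda>x. exp (\<theta> * \<phi> x))"
    using exp_bounds by (intro integrable_const_bound[of _ "exp (\<theta> * K)"]) auto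
  have p: "0 \<le> p" "(\<integral>\<^sup>+x. ennreal (\<phi> x) \<partial>\<nu>) = ennreal p"
    unfolding p_def using \<phi> by (auto intro!: nn_integral_eq_integral int\<phi> integral_nonneg_AE)
  have e_eq: "(\<integral>\<^sup>+x. ennreal (exp (\<theta> * \<phi> x)) \<partial>\<nu>) = ennreal e"
    unfolding e_def by (auto intro!: nn_integral_eq_integral inte)
  have e: "1 \<le> e" "e \<le> exp (\<theta> * K)"
    unfolding e_def
    using integral_mono[OF integrable_const[of 1] inte] integral_mono[OF inte integrable_const[of "exp (\<theta> * K)"]] exp_bounds
    by (auto simp: prob_space)
  have ex: "(\<integral>x. exp_excess (\<theta> * \<phi> x) \<partial>\<nu>) = e - 1 - \<theta> * p"
    unfolding exp_excess_def e_def p_def using int\<phi> inte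
    by (subst Bochner_Integration.integral_diff) (auto simp: prob_space)
  \<comment> \<open>Adding the affine part back turns \<open>exp_excess\<close> into
    \<open>exp\<close>, which is multiplicative over the points, without any subtraction in
    \<open>ennreal\<close>.\<close>
  have "I + ennreal (1 + \<theta> * (a * p)) = (\<integral>\<^sup>+y. (case y of (n, z) \<Rightarrow> ennreal (exp_excess (\<theta> * (\<Sum>k<n. \<phi> (z k)))))
      + (1 + ennreal \<theta> * (case y of (n, z) \<Rightarrow> \<Sum>k<n. ennreal (\<phi> (z k)))) \<partial>compound_poisson a \<nu>)"
  proof -
    have m: "(\<lambda>y. case y of (n, z) \<Rightarrow> \<Sum>k<n. ennreal (\<phi> (z k))) \<in> borel_measurable (compound_poisson a \<nu>)"
      using measurable_point_sum[of "\<lambda>x. ennreal (\<phi> x)" \<nu>] by (simp cong: measurable_cong_sets)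
    have m2: "(\<lambda>y. case y of (n, z) \<Rightarrow> ennreal (exp_excess (\<theta> * (\<Sum>k<n. \<phi> (z k))))) \<in> borel_measurable (compound_poisson a \<nu>)"
      using measurable_point_sum[of \<phi> \<nu>] unfolding case_prod_beta by (simp cong: measurable_cong_sets)
    have "(\<integral>\<^sup>+y. 1 + ennreal \<theta> * (case y of (n, z) \<Rightarrow> \<Sum>k<n. ennreal (\<phi> (z k))) \<partial>compound_poisson a \<nu>) = ennreal (1 + \<theta> * (a * p))"
      using m compound_poisson_mean[OF a \<nu>, of "\<lambda>x. ennreal (\<phi> x)"] \<theta> a p
      by (simp add: nn_integral_add nn_integral_cmult C.emeasure_space_1 ennreal_mult)
    then show ?thesis
      unfolding I_def by (subst nn_integral_add) (use m m2 in auto)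
  qed
  also have "\<dots> = (\<integral>\<^sup>+(n, z). (\<Prod>k<n. ennreal (exp (\<theta> * \<phi> (z k)))) \<partial>compound_poisson a \<nu>)"
  proof (intro nn_integral_cong)
    fix y :: "nat \<times> (nat \<Rightarrow> 'e)"
    obtain n z where y: "y = (n, z)" by (cases y)
    let ?D = "\<Sum>k<n. \<phi> (z k)"
    have D: "0 \<le> ?D" using \<phi> by (auto intro!: sum_nonneg)
    have "ennreal (exp_excess (\<theta> * ?D)) + (1 + ennreal \<theta> * (\<Sum>k<n. ennreal (\<phi> (z k)))) = ennreal (exp (\<theta> * ?D))"
      using \<phi> \<theta> D by (simp add: sum_ennreal ennreal_mult[symmetric] flip: ennreal_1 ennreal_plus)
        (simp add: exp_excess_def)
    also have "\<dots> = (\<Prod>k<n. ennreal (exp (\<theta> * \<phi> (z k))))"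
      by (simp add: sum_distrib_left exp_sum prod_ennreal)
    finally show "(case y of (n, z) \<Rightarrow> ennreal (exp_excess (\<theta> * (\<Sum>k<n. \<phi> (z k)))))
      + (1 + ennreal \<theta> * (case y of (n, z) \<Rightarrow> \<Sum>k<n. ennreal (\<phi> (z k)))) = (case y of (n, z) \<Rightarrow> \<Prod>k<n. ennreal (exp (\<theta> * \<phi> (z k))))"
      by (simp add: y)
  qed
  also have "\<dots> = ennreal (exp (a * (e - 1)))"
    using e by (intro compound_poisson_functional[OF a \<nu>]) (auto simp: e_eq)
  also have "\<dots> \<le> ennreal ((a * (e - 1 - \<theta> * p) + (a * (exp (\<theta> * K) - 1))\<^sup>2) + (1 + \<theta> * (a * p)))"
  proof (rule ennreal_leI)
    have le: "a * (e - 1) \<le> a * (exp (\<theta> * K) - 1)" "0 \<le> a * (e - 1)"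
      using a e by (auto intro!: mult_left_mono)
    \<comment> \<open>The bound \<open>exp x \<le> 1 + x + x\<^sup>2\<close> on the unit interval;
      \<open>small\<close> places \<open>a (e - 1)\<close> there.\<close>
    then have "exp (a * (e - 1)) \<le> 1 + a * (e - 1) + (a * (e - 1))\<^sup>2"
      using small by (intro exp_bound) auto
    also have "(a * (e - 1))\<^sup>2 \<le> (a * (exp (\<theta> * K) - 1))\<^sup>2"
      using le by (intro power_mono) auto
    finally show "exp (a * (e - 1)) \<le> (a * (e - 1 - \<theta> * p) + (a * (exp (\<theta> * K) - 1))\<^sup>2) + (1 + \<theta> * (a * p))"
      by (simp add: algebra_simps)
  qed
  also have "\<dots> = ennreal (a * (e - 1 - \<theta> * p) + (a * (exp (\<theta> * K) - 1))\<^sup>2) + ennreal (1 + \<theta> * (a * p))"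
  proof (rule ennreal_plus)
    have "0 \<le> (\<integral>x. exp_excess (\<theta> * \<phi> x) \<partial>\<nu>)" by simp
    then show "0 \<le> a * (e - 1 - \<theta> * p) + (a * (exp (\<theta> * K) - 1))\<^sup>2"
      using a unfolding ex by simp
  qed (use \<theta> a p in auto)
  finally show ?thesis
    unfolding I_def[symmetric] ex by (simp add: ennreal_add_left_cancel_le add.commute)
qed

section \<open>Compact exhaustions\<close>

text \<open>Closed balls need not be compact, so the radii must depend on the point. The factor 2
  leaves room for moving the centre, and the bound 1 makes the supremum finite.\<close>

definition compact_radii :: "'a::metric_space \<Rightarrow> real set" where
  "compact_radii x = {r. 0 < r \<and> r \<le> 1 \<and> compact (cball x (2 * r))}"

definition radial_nbhd :: "'a::metric_space set \<Rightarrow> 'a set" where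
  "radial_nbhd K = {y. \<exists>x\<in>K. \<exists>r\<in>compact_radii x. dist x y \<le> r}"

lemma compact_cball_subset:
  fixes x y :: "'a::metric_space"
  assumes "compact (cball x r)" "dist x y + s \<le> r"
  shows "compact (cball y s)"
proof -
  have "cball y s \<subseteq> cball x r"
  proof
    fix z assume "z \<in> cball y s"
    then show "z \<in> cball x r"
      using assms(2) dist_triangle[of x z y] by auto
  qed
  then have "cball y s = cball x r \<inter> cball y s" by blast
  then show ?thesis
    using compact_Int_closed[OF assms(1), of "cball y s"] by simp
qed

text \<open>A compact ball about a nearby point contains a slightly smaller one about
  \<open>x\<close>, so admissible radii near \<open>x\<close> hardly exceed those at
  \<open>x\<close>. Hence one compact ball about \<open>x\<close> contains the radial neighbourhoods
  of all points near \<open>x\<close>, and finitely many such balls suffice for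
  \<open>K\<close>.\<close>

lemma compact_closure_radial_nbhd:
  fixes K :: "'a::metric_space set"
  assumes K: "compact K" and ne: "\<And>x::'a. compact_radii x \<noteq> {}"
  shows "compact (closure (radial_nbhd K))"
proof -
  have "\<exists>s C. 0 < s \<and> compact C \<and> (\<forall>x'\<in>ball x s. radial_nbhd {x'} \<subseteq> C)" for x :: 'a
  proof -
    define \<rho> where "\<rho> = Sup (compact_radii x)"
    have bdd: "bdd_above (compact_radii x)"
      by (rule bdd_aboveI[of _ 1]) (auto simp: compact_radii_def)
    obtain r where r: "r \<in> compact_radii x" using ne by blast
    then have "0 < \<rho>"
      using cSup_upper[OF r bdd] by (auto simp: \<rho>_def compact_radii_def)
    \<comment> \<open>The constants fit together: for centres within \<open>\<rho> / 4\<close> of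
      \<open>x\<close> every admissible radius is at most \<open>9/8 * \<rho>\<close>, so the points
      reached are within \<open>11/8 * \<rho>\<close> of \<open>x\<close>, less than
      \<open>2 * r0\<close>.\<close>
    then have "3/4 * \<rho> < Sup (compact_radii x)" by (simp add: \<rho>_def)
    then obtain r0 where r0: "r0 \<in> compact_radii x" "3/4 * \<rho> < r0"
      using less_cSup_iff[OF ne bdd] by blast
    have "radial_nbhd {x'} \<subseteq> cball x (2 * r0)" if x': "x' \<in> ball x (\<rho> / 4)" for x'
    proof
      fix y assume "y \<in> radial_nbhd {x'}"
      then obtain r where r: "r \<in> compact_radii x'" "dist x' y \<le> r"
        by (auto simp: radial_nbhd_def)
      have "r - \<rho> / 8 \<le> \<rho>"
      proof (cases "0 < r - \<rho> / 8")
        case True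
        have "compact (cball x (2 * (r - \<rho> / 8)))"
          by (rule compact_cball_subset[of x' "2 * r"])
             (use r x' in \<open>auto simp: compact_radii_def dist_commute\<close>)
        then have "r - \<rho> / 8 \<in> compact_radii x"
          using r True \<open>0 < \<rho>\<close> by (auto simp: compact_radii_def)
        then show ?thesis
          unfolding \<rho>_def using bdd by (rule cSup_upper)
      qed (use \<open>0 < \<rho>\<close> in auto)
      then have "dist x y \<le> 2 * r0"
        using r(2) x' r0(2) \<open>0 < \<rho>\<close> dist_triangle[of x y x'] by auto
      then show "y \<in> cball x (2 * r0)" by simp
    qed
    then show ?thesis
      using \<open>0 < \<rho>\<close> r0(1)
      by (intro exI[of _ "\<rho> / 4"] exI[of _ "cball x (2 * r0)"]) (auto simp: compact_radii_def)
  qed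
  then have "\<forall>x::'a. \<exists>s C. 0 < s \<and> compact C \<and> (\<forall>x'\<in>ball x s. radial_nbhd {x'} \<subseteq> C)"
    by blast
  then have "\<exists>s C. \<forall>x::'a. 0 < s x \<and> compact (C x) \<and> (\<forall>x'\<in>ball x (s x). radial_nbhd {x'} \<subseteq> C x)"
    unfolding choice_iff .
  then obtain s C where sC: "\<And>x::'a. 0 < s x" "\<And>x. compact (C x)" "\<And>x x'. x' \<in> ball x (s x) \<Longrightarrow> radial_nbhd {x'} \<subseteq> C x"
    by blast
  have cover: "K \<subseteq> (\<Union>x\<in>K. ball x (s x))"
    using sC(1) by force
  obtain F where F: "F \<subseteq> K" "finite F" "K \<subseteq> (\<Union>x\<in>F. ball x (s x))"
    by (rule compactE_image[OF K _ cover]) (rule open_ball)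
  have sub: "radial_nbhd K \<subseteq> (\<Union>x\<in>F. C x)"
  proof
    fix y assume "y \<in> radial_nbhd K"
    then obtain x' where x': "x' \<in> K" "y \<in> radial_nbhd {x'}"
      by (auto simp: radial_nbhd_def)
    then obtain x where "x \<in> F" "x' \<in> ball x (s x)" using F by blast
    then show "y \<in> (\<Union>x\<in>F. C x)" using sC(3) x'(2) by blast
  qed
  have comp: "compact (\<Union>x\<in>F. C x)"
    using F(2) sC(2) by (intro compact_UN)
  have "closure (radial_nbhd K) \<subseteq> (\<Union>x\<in>F. C x)"
    by (rule closure_minimal[OF sub compact_imp_closed[OF comp]])
  then have "(\<Union>x\<in>F. C x) \<inter> closure (radial_nbhd K) = closure (radial_nbhd K)"
    by blast
  then show ?thesis
    using compact_Int_closed[OF comp closed_closure, of "radial_nbhd K"] by simp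
qed

lemma locally_compact_space_compact_radii:
  assumes "locally_compact_space (euclidean :: 'a::metric_space topology)"
  shows "compact_radii (x :: 'a) \<noteq> {}"
proof -
  have "\<exists>U K. open U \<and> compact K \<and> x \<in> U \<and> U \<subseteq> K"
    using assms unfolding locally_compact_space_def by (simp add: compactin_euclidean_iff)
  then obtain U K where UK: "open U" "compact K" "x \<in> U" "U \<subseteq> K"
    by blast
  then obtain e where e: "0 < e" "cball x e \<subseteq> U"
    using open_contains_cball by blast
  have "compact (K \<inter> cball x e)"
    using UK by (intro compact_Int_closed) auto
  moreover have "K \<inter> cball x e = cball x e" using e UK by blast
  ultimately have "compact (cball x (2 * min 1 (e / 2)))"
    using e by - (rule compact_cball_subset[of x e], auto)
  then have "min 1 (e / 2) \<in> compact_radii x"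
    using e by (auto simp: compact_radii_def)
  then show ?thesis by blast
qed

text \<open>Each \<open>K n\<close> lies in the interior of the next one, so the union is open. It
  is also closed: a limit point has a compact ball, so points of the union near it have admissible
  radii that reach it. A compact set therefore meets the union in a compact set, which a single
  \<open>K n\<close> contains. Without closedness a compact set could accumulate at the boundary and
  meet infinitely many layers.\<close>

lemma locally_compact_exhaustion:
  fixes L :: "nat \<Rightarrow> 'a::metric_space set"
  assumes lc: "locally_compact_space (euclidean :: 'a topology)" and L: "\<And>n. compact (L n)"
  obtains K where "\<And>n. compact (K n)" "incseq K" "\<And>n. L n \<subseteq> K n"
    "\<And>C. compact C \<Longrightarrow> \<exists>n. C \<inter> (\<Union>n. K n) \<subseteq> K n"
proof -
  note ne = locally_compact_space_compact_radii[OF lc]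
  define K where "K = rec_nat (L 0) (\<lambda>n K. K \<union> closure (radial_nbhd K) \<union> L (Suc n))"
  have K_0: "K 0 = L 0" and K_Suc: "K (Suc n) = K n \<union> closure (radial_nbhd (K n)) \<union> L (Suc n)" for n
    by (simp_all add: K_def)
  have K: "compact (K n)" for n
    by (induction n) (auto simp: K_0 K_Suc L intro!: compact_Un compact_closure_radial_nbhd ne)
  have mono: "incseq K"
    by (rule incseq_SucI) (auto simp: K_Suc)
  have LK: "L n \<subseteq> K n" for n
    by (cases n) (auto simp: K_0 K_Suc)
  let ?U = "\<Union>n. K n"
  have nbhd: "radial_nbhd (K n) \<subseteq> K (Suc n)" for n
    using closure_subset by (auto simp: K_Suc)
  have inner: "K n \<subseteq> interior (K (Suc n))" for n
  proof
    fix x assume x: "x \<in> K n"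
    obtain r where r: "r \<in> compact_radii x" using ne[of x] by blast
    have "ball x r \<subseteq> K (Suc n)"
    proof
      fix y assume "y \<in> ball x r"
      then have "y \<in> radial_nbhd (K n)"
        using x r by (auto simp: radial_nbhd_def intro!: bexI[of _ x] bexI[of _ r])
      then show "y \<in> K (Suc n)" using nbhd by blast
    qed
    moreover have "x \<in> ball x r" using r by (simp add: compact_radii_def)
    ultimately show "x \<in> interior (K (Suc n))"
      by (meson interior_maximal open_ball subsetD)
  qed
  have "closed ?U"
  proof (rule closed_limpt[THEN iffD2], intro allI impI)
    fix y assume y: "y islimpt ?U"
    obtain r where r: "0 < r" "r \<le> 1" "compact (cball y (2 * r))"
      using ne[of y] by (auto simp: compact_radii_def)
    from y obtain x where x: "x \<in> ?U" "dist x y < r / 2"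
      using r(1) unfolding islimpt_approachable by (metis half_gt_zero)
    then obtain n where n: "x \<in> K n" by blast
    \<comment> \<open>Distance below \<open>r / 2\<close> plus radius \<open>r\<close> stays within
      \<open>2 * r\<close>; and \<open>y\<close> itself is within \<open>r / 2\<close> of
      \<open>x\<close>, hence in its radial neighbourhood.\<close>
    have "compact (cball x (2 * (r / 2)))"
      by (rule compact_cball_subset[OF r(3)]) (use x r in \<open>auto simp: dist_commute\<close>)
    then have "r / 2 \<in> compact_radii x"
      using r by (auto simp: compact_radii_def)
    then have "y \<in> radial_nbhd (K n)"
      using n x by (auto simp: radial_nbhd_def intro!: bexI[of _ x] bexI[of _ "r / 2"])
    then show "y \<in> ?U" using nbhd by blast
  qed
  have "\<exists>n. C \<inter> ?U \<subseteq> K n" if "compact C" for C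
  proof -
    have c1: "compact (C \<inter> ?U)"
      using that \<open>closed ?U\<close> by (rule compact_Int_closed)
    have c2: "C \<inter> ?U \<subseteq> (\<Union>n. interior (K (Suc n)))"
      using inner by blast
    obtain F where F: "finite F" "C \<inter> ?U \<subseteq> (\<Union>n\<in>F. interior (K (Suc n)))"
      by (rule compactE_image[OF c1 _ c2]) (rule open_interior)
    obtain N where "F \<subseteq> {..<N}"
      using finite_nat_bounded[OF F(1)] ..
    then have N: "n < N" if "n \<in> F" for n
      using that by auto
    have "interior (K (Suc n)) \<subseteq> K N" if "n \<in> F" for n
      using interior_subset[of "K (Suc n)"] incseqD[OF mono, of "Suc n" N] N[OF that] by auto
    then show ?thesis using F(2) by blast
  qed
  then show ?thesis
    by (rule that[OF K mono LK])
qed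

text \<open>Inner regularity fills each set of a cover by sets of finite measure with countably many
  compact sets up to a null set; finiteness permits the subtraction. \<open>prod_decode\<close>
  lists them all in one sequence.\<close>

lemma radon_measure_compact_exhaustion:
  fixes m :: "'a::metric_space measure"
  assumes m: "radon_measure m" and "sigma_finite_measure m"
  obtains L where "\<And>n::nat. compact (L n)" "emeasure m (- (\<Union>n. L n)) = 0"
proof -
  interpret sigma_finite_measure m by fact
  have sets_m[simp, measurable_cong]: "sets m = sets borel"
    and inner: "\<And>B. B \<in> sets borel \<Longrightarrow> emeasure m B = (SUP K\<in>{K. compact K \<and> K \<subseteq> B}. emeasure m K)"
    using m by (auto simp: radon_measure_def)
  have space_m[simp]: "space m = UNIV"
    using sets_eq_imp_space_eq[OF sets_m] by simp
  obtain A :: "nat \<Rightarrow> 'a set" where A: "range A \<subseteq> sets m" "(\<Union>i. A i) = space m" "\<And>i. emeasure m (A i) \<noteq> \<infinity>"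
    using sigma_finite by blast
  have "\<exists>K :: nat \<Rightarrow> 'a set. (\<forall>n. compact (K n) \<and> K n \<subseteq> A i) \<and> emeasure m (A i) = (SUP n. emeasure m (K n))" for i
  proof -
    let ?S = "emeasure m ` {K. compact K \<and> K \<subseteq> A i}"
    have "{} \<in> {K. compact K \<and> K \<subseteq> A i}" by simp
    then have "?S \<noteq> {}" by blast
    then obtain f :: "nat \<Rightarrow> ennreal" where f: "range f \<subseteq> ?S" "Sup ?S = (SUP n. f n)"
      by (metis ennreal_Sup_countable_SUP)
    then have "\<forall>n. \<exists>K. compact K \<and> K \<subseteq> A i \<and> f n = emeasure m K" by blast
    then obtain K where K: "\<And>n. compact (K n) \<and> K n \<subseteq> A i \<and> f n = emeasure m (K n)" by metis
    moreover have "A i \<in> sets borel" using A(1) by auto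
    ultimately show ?thesis using f inner by (intro exI[of _ K]) auto
  qed
  then obtain K :: "nat \<Rightarrow> nat \<Rightarrow> 'a set" where K: "\<And>i n. compact (K i n)" "\<And>i n. K i n \<subseteq> A i"
    "\<And>i. emeasure m (A i) = (SUP n. emeasure m (K i n))" by metis
  define L where "L k = K (fst (prod_decode k)) (snd (prod_decode k))" for k
  have K_sets[measurable]: "K i n \<in> sets borel" for i n
    using K(1) by (simp add: borel_compact)
  have A_sets[measurable]: "A i \<in> sets borel" for i using A(1) by auto
  have null: "emeasure m (A i - (\<Union>n. K i n)) = 0" for i
  proof -
    have sub: "(\<Union>n. K i n) \<subseteq> A i" using K(2) by blast
    have "emeasure m (A i) \<le> emeasure m (\<Union>n. K i n)"
      unfolding K(3) by (intro SUP_least emeasure_mono) auto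
    moreover have "emeasure m (\<Union>n. K i n) \<le> emeasure m (A i)"
      using sub by (intro emeasure_mono) auto
    ultimately have "emeasure m (\<Union>n. K i n) = emeasure m (A i)"
      by (rule antisym[rotated])
    then show ?thesis
      using A(3)[of i] sub by (subst emeasure_Diff) auto
  qed
  have KL: "K i n \<subseteq> (\<Union>k. L k)" for i n
    using UN_upper[of "prod_encode (i, n)" UNIV L] by (simp add: L_def)
  have sub: "- (\<Union>k. L k) \<subseteq> (\<Union>i. A i - (\<Union>n. K i n))"
  proof
    fix x assume x: "x \<in> - (\<Union>k. L k)"
    have "x \<in> (\<Union>i. A i)" by (simp add: A(2))
    then obtain i where "x \<in> A i" by blast
    then show "x \<in> (\<Union>i. A i - (\<Union>n. K i n))"
      using x KL by blast
  qed
  have "emeasure m (\<Union>i. A i - (\<Union>n. K i n)) = 0"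
    by (rule emeasure_UN_eq_0) (auto simp: null)
  moreover have "emeasure m (- (\<Union>k. L k)) \<le> emeasure m (\<Union>i. A i - (\<Union>n. K i n))"
    by (rule emeasure_mono[OF sub]) simp
  ultimately have "emeasure m (- (\<Union>k. L k)) = 0"
    by simp
  then show ?thesis
    by (rule that[rotated]) (simp add: L_def K(1))
qed

section \<open>Laws of configurations\<close>

lemma config_count_eq_emeasure:
  "config_count \<omega> B = emeasure (density (count_space UNIV) (\<lambda>x. ennreal (real (\<omega> x)))) B"
  by (simp add: config_count_def emeasure_density)

text \<open>A natural number, as generating functions require. It agrees with
  \<open>config_count\<close> when the support in \<open>B\<close> is finite, for instance inside a
  compact set; for an infinite support the sum is 0 by convention.\<close>

definition point_count :: "('e \<Rightarrow> nat) \<Rightarrow> 'e set \<Rightarrow> nat" where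
  "point_count \<omega> B = (\<Sum>x\<in>{x\<in>B. \<omega> x \<noteq> 0}. \<omega> x)"

lemma config_count_eq_point_count:
  assumes "finite {x\<in>B. \<omega> x \<noteq> 0}"
  shows "config_count \<omega> B = of_nat (point_count \<omega> B)"
proof -
  have "config_count \<omega> B = (\<Sum>x\<in>{x\<in>B. \<omega> x \<noteq> 0}. ennreal (real (\<omega> x)) * indicator B x)"
    unfolding config_count_def by (rule nn_integral_count_space'[OF assms]) (auto simp: indicator_def)
  also have "\<dots> = of_nat (point_count \<omega> B)"
    by (simp add: point_count_def ennreal_of_nat_eq_real_of_nat)
  finally show ?thesis .
qed

lemma configs_finite_subset: "\<omega> \<in> configs \<Longrightarrow> compact C \<Longrightarrow> B \<subseteq> C \<Longrightarrow> finite {x\<in>B. \<omega> x \<noteq> 0}"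
  unfolding configs_def by (auto elim!: allE[of _ C] rev_finite_subset)

lemma config_count_compact:
  "\<omega> \<in> configs \<Longrightarrow> compact C \<Longrightarrow> B \<subseteq> C \<Longrightarrow> config_count \<omega> B = of_nat (point_count \<omega> B)"
  by (rule config_count_eq_point_count[OF configs_finite_subset])

definition count_events :: "('e::metric_space \<Rightarrow> nat) set set" where
  "count_events = {{\<omega>\<in>configs. config_count \<omega> B \<in> A} | B A. B \<in> sets (borel :: 'e measure) \<and> A \<in> sets (borel :: ennreal measure)}"

lemma config_space_eq: "config_space = sigma configs count_events"
  by (simp add: config_space_def count_events_def)

lemma count_events_Pow: "count_events \<subseteq> Pow configs"
  by (auto simp: count_events_def)

lemma space_config_space [simp]: "space config_space = configs"
  by (simp add: config_space_eq space_measure_of[OF count_events_Pow])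

lemma sets_config_space: "sets config_space = sigma_sets configs count_events"
  by (simp add: config_space_eq count_events_Pow)

lemma config_count_measurable [measurable]:
  "B \<in> sets borel \<Longrightarrow> (\<lambda>\<omega>. config_count \<omega> B) \<in> borel_measurable config_space"
  by (rule measurableI)
     (auto simp: sets_config_space count_events_def vimage_def Int_def conj_commute intro!: sigma_sets.Basic exI[of _ B])

lemma measurable_config_spaceI:
  assumes f: "\<And>x. x \<in> space N \<Longrightarrow> f x \<in> configs"
    and m: "\<And>B. B \<in> sets borel \<Longrightarrow> (\<lambda>x. config_count (f x) B) \<in> borel_measurable N"
  shows "f \<in> N \<rightarrow>\<^sub>M config_space"
proof (rule measurable_sigma_sets[OF sets_config_space count_events_Pow])
  show "f \<in> space N \<rightarrow> configs" using f by auto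
  fix y :: "('b \<Rightarrow> nat) set" assume "y \<in> count_events"
  then obtain B A where y: "y = {\<omega>\<in>configs. config_count \<omega> B \<in> A}"
    and B: "B \<in> sets (borel :: 'b measure)" and A: "A \<in> sets (borel :: ennreal measure)"
    by (auto simp: count_events_def)
  have "f -` y \<inter> space N = (\<lambda>x. config_count (f x) B) -` A \<inter> space N"
    using f by (auto simp: y)
  then show "f -` y \<inter> space N \<in> sets N"
    using measurable_sets[OF m[OF B] A] by simp
qed

lemma point_count_event:
  assumes "B \<in> sets borel" "compact C" "B \<subseteq> C"
  shows "{\<omega>\<in>configs. point_count \<omega> B = n} \<in> sets config_space"
proof -
  have "{\<omega>\<in>configs. point_count \<omega> B = n} = {\<omega>\<in>space config_space. config_count \<omega> B = of_nat n}"
    using assms by (auto simp: config_count_compact)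
  also have "\<dots> \<in> sets config_space"
    using assms(1) by measurable
  finally show ?thesis .
qed

text \<open>Counts of subsets of the \<open>K n\<close> do not generate the \<open>\<sigma>\<close>-algebra when the space is not separable;
  erasing the points outside \<open>\<Union>n. K n\<close> does not change the laws and makes them suffice.\<close>

lemma config_law_eqI:
  fixes \<mu> \<mu>' :: "('e::metric_space \<Rightarrow> nat) measure"
  assumes \<mu>: "prob_space \<mu>" "sets \<mu> = sets config_space" and \<mu>': "prob_space \<mu>'" "sets \<mu>' = sets config_space"
    and K: "\<And>n::nat. compact (K n)" "incseq K"
    and null: "AE \<omega> in \<mu>. config_count \<omega> (- (\<Union>n. K n)) = 0" "AE \<omega> in \<mu>'. config_count \<omega> (- (\<Union>n. K n)) = 0"
    and eq: "\<And>(k::nat) B n J. (\<And>i. i < k \<Longrightarrow> B i \<in> sets borel) \<Longrightarrow> (\<And>i. i < k \<Longrightarrow> B i \<subseteq> K J) \<Longrightarrow>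
      emeasure \<mu> {\<omega>\<in>configs. \<forall>i<k. point_count \<omega> (B i) = n i} =
      emeasure \<mu>' {\<omega>\<in>configs. \<forall>i<k. point_count \<omega> (B i) = n i}"
  shows "\<mu> = \<mu>'"
proof -
  define U where "U = (\<Union>n. K n)"
  \<comment> \<open>Events on finitely many counts jointly, so that two of them intersect in a third
    one by concatenating their lists of sets.\<close>
  define G where "G = {{\<omega>\<in>configs. \<forall>i<k. point_count \<omega> (B i) = n i} | (k::nat) B n J.
     (\<forall>i<k. B i \<in> sets (borel :: 'e measure) \<and> B i \<subseteq> K J)}"
  let ?G = "sigma configs G"
  have G_Pow: "G \<subseteq> Pow configs"
    by (auto simp: G_def)
  have G_sets: "G \<subseteq> sets config_space"
  proof
    fix X assume "X \<in> G"
    then obtain k :: nat and B n J where X: "X = {\<omega>\<in>configs. \<forall>i<k. point_count \<omega> (B i) = n i}"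
      and B: "\<forall>i<k. B i \<in> sets (borel :: 'e measure) \<and> B i \<subseteq> K J"
      unfolding G_def by blast
    have "X = {\<omega>\<in>space config_space. \<forall>i\<in>{..<k}. \<omega> \<in> {\<omega>\<in>configs. point_count \<omega> (B i) = n i}}"
      by (auto simp: X)
    also have "\<dots> \<in> sets config_space"
      using B K(1)[of J] point_count_event[of _ "K J"]
      by (intro sets.sets_Collect_finite_All) (auto simp: Int_def[symmetric] Int_absorb1)
    finally show "X \<in> sets config_space" .
  qed
  have id: "(\<lambda>\<omega>. \<omega>) \<in> config_space \<rightarrow>\<^sub>M ?G"
  proof (rule measurable_measure_of[OF G_Pow])
    fix y assume "y \<in> G"
    then have "y \<subseteq> configs" "y \<in> sets config_space" using G_Pow G_sets by auto
    then show "(\<lambda>\<omega>. \<omega>) -` y \<inter> space config_space \<in> sets config_space"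
      by (simp add: Int_absorb2)
  qed simp
  have Int: "Int_stable G"
  proof (rule Int_stableI)
    fix a b assume "a \<in> G" "b \<in> G"
    then obtain k k' :: nat and B n J B' n' J' where
      a: "a = {\<omega>\<in>configs. \<forall>i<k. point_count \<omega> (B i) = n i}" "\<forall>i<k. B i \<in> sets borel \<and> B i \<subseteq> K J" and
      b: "b = {\<omega>\<in>configs. \<forall>i<k'. point_count \<omega> (B' i) = n' i}" "\<forall>i<k'. B' i \<in> sets borel \<and> B' i \<subseteq> K J'"
      unfolding G_def by blast
    let ?B = "\<lambda>i. if i < k then B i else B' (i - k)" and ?n = "\<lambda>i. if i < k then n i else n' (i - k)"
    have split: "(\<forall>i<k + k'. P i) \<longleftrightarrow> (\<forall>i<k. P i) \<and> (\<forall>i<k'. P (k + i))" for P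
      by (metis add_less_cancel_left le_add_diff_inverse not_less trans_less_add1)
    have ab: "a \<inter> b = {\<omega>\<in>configs. \<forall>i<k + k'. point_count \<omega> (?B i) = ?n i}"
      unfolding split a b by auto
    have mono: "K J \<subseteq> K (max J J')" "K J' \<subseteq> K (max J J')"
      using K(2) by (auto simp: incseq_def)
    have "B i \<subseteq> K (max J J')" if "i < k" for i
      using a(2) that mono(1) by (meson subset_trans)
    moreover have "B' i \<subseteq> K (max J J')" if "i < k'" for i
      using b(2) that mono(2) by (meson subset_trans)
    ultimately have BB: "\<forall>i<k + k'. ?B i \<in> sets borel \<and> ?B i \<subseteq> K (max J J')"
      unfolding split using a(2) b(2) by simp
    show "a \<inter> b \<in> G"
      unfolding G_def
      by (rule CollectI, rule exI[of _ "k + k'"], rule exI[of _ ?B], rule exI[of _ ?n], rule exI[of _ "max J J'"])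
         (rule conjI[OF ab BB])
  qed
  have configs_G: "configs \<in> G"
    unfolding G_def by (rule CollectI, rule exI[of _ 0]) auto
  have distr_eq: "distr \<mu> ?G (\<lambda>\<omega>. \<omega>) = distr \<mu>' ?G (\<lambda>\<omega>. \<omega>)"
  proof (rule measure_eqI_generator_eq[OF Int G_Pow])
    show "range (\<lambda>_::nat. configs) \<subseteq> G" "(\<Union>i::nat. configs) = configs"
      using configs_G by auto
    have id': "(\<lambda>\<omega>. \<omega>) \<in> \<mu> \<rightarrow>\<^sub>M ?G" "(\<lambda>\<omega>. \<omega>) \<in> \<mu>' \<rightarrow>\<^sub>M ?G"
      using id by (simp_all add: measurable_cong_sets[OF \<mu>(2) refl] measurable_cong_sets[OF \<mu>'(2) refl])
    have space: "space \<mu> = configs" "space \<mu>' = configs"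
      using sets_eq_imp_space_eq[OF \<mu>(2)] sets_eq_imp_space_eq[OF \<mu>'(2)] by auto
    fix X assume X: "X \<in> G"
    then have X': "X \<in> sets ?G" "X \<subseteq> configs" using G_Pow by auto
    obtain k :: nat and B n J where "X = {\<omega>\<in>configs. \<forall>i<k. point_count \<omega> (B i) = n i}"
      "\<forall>i<k. B i \<in> sets borel \<and> B i \<subseteq> K J"
      using X unfolding G_def by blast
    then have "emeasure \<mu> X = emeasure \<mu>' X"
      using eq[of k B J n] by simp
    then show "emeasure (distr \<mu> ?G (\<lambda>\<omega>. \<omega>)) X = emeasure (distr \<mu>' ?G (\<lambda>\<omega>. \<omega>)) X"
      using X' by (simp add: emeasure_distr[OF id'(1)] emeasure_distr[OF id'(2)] space Int_absorb2)
  next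
    interpret prob_space \<mu> by fact
    have "prob_space (distr \<mu> ?G (\<lambda>\<omega>. \<omega>))"
      by (rule prob_space_distr) (use id in \<open>simp add: measurable_cong_sets[OF \<mu>(2) refl]\<close>)
    then show "emeasure (distr \<mu> ?G (\<lambda>\<omega>. \<omega>)) configs \<noteq> \<infinity>"
      by (metis finite_measure.emeasure_finite prob_space_def infinity_ennreal_def)
  qed (simp_all add: G_Pow)
  \<comment> \<open>Erasure of the points outside \<open>U\<close>. It is measurable already from
    the smaller \<open>?G\<close>, since a count after erasure is a supremum of counts in
    \<open>B \<inter> K n\<close>, and it fixes almost every configuration. Agreement on
    \<open>?G\<close> thus extends to \<open>config_space\<close>.\<close>
  define R where "R \<omega> = (\<lambda>x. if x \<in> U then \<omega> x else 0)" for \<omega> :: "'e \<Rightarrow> nat"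
  have U[measurable]: "U \<in> sets borel"
    unfolding U_def using K(1) by (intro sets.countable_UN) (auto intro!: borel_compact)
  have R: "R \<in> ?G \<rightarrow>\<^sub>M config_space"
  proof (rule measurable_config_spaceI)
    fix \<omega> assume "\<omega> \<in> space ?G"
    then have \<omega>: "\<omega> \<in> configs" by (simp add: space_measure_of[OF G_Pow])
    show "R \<omega> \<in> configs"
      unfolding configs_def
    proof (intro CollectI allI impI)
      fix C :: "'e set" assume "compact C"
      then have "finite {x\<in>C. \<omega> x \<noteq> 0}" by (rule configs_finite_subset[OF \<omega> _ order_refl])
      then show "finite {x\<in>C. R \<omega> x \<noteq> 0}"
        by (rule rev_finite_subset) (auto simp: R_def)
    qed
  next
    fix B :: "'e set" assume B[measurable]: "B \<in> sets borel"
    have K_borel[measurable]: "K n \<in> sets borel" for n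
      using K(1) by (rule borel_compact)
    have pc[measurable]: "(\<lambda>\<omega>. point_count \<omega> (B \<inter> K n)) \<in> ?G \<rightarrow>\<^sub>M count_space UNIV" for n
    proof (subst measurable_count_space_eq_countable, simp, intro conjI ballI)
      fix j
      have "{\<omega>\<in>configs. \<forall>i<Suc 0. point_count \<omega> (B \<inter> K n) = j} \<in> G"
        unfolding G_def
        by (rule CollectI, rule exI[of _ "Suc 0"], rule exI[of _ "\<lambda>_. B \<inter> K n"], rule exI[of _ "\<lambda>_. j"], rule exI[of _ n])
           auto
      also have "{\<omega>\<in>configs. \<forall>i<Suc 0. point_count \<omega> (B \<inter> K n) = j} = (\<lambda>\<omega>. point_count \<omega> (B \<inter> K n)) -` {j} \<inter> space ?G"
        by (auto simp: space_measure_of[OF G_Pow])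
      finally show "(\<lambda>\<omega>. point_count \<omega> (B \<inter> K n)) -` {j} \<inter> space ?G \<in> sets ?G"
        using G_Pow by auto
    qed simp
    have "config_count (R \<omega>) B = (SUP n. of_nat (point_count \<omega> (B \<inter> K n)))" if "\<omega> \<in> configs" for \<omega>
    proof -
      have "config_count (R \<omega>) B = config_count \<omega> (B \<inter> U)"
        unfolding config_count_def by (intro nn_integral_cong) (auto simp: R_def indicator_def)
      also have "\<dots> = (SUP n. config_count \<omega> (B \<inter> K n))"
        unfolding config_count_eq_emeasure U_def Int_UN_distrib
        using K(2) by (intro SUP_emeasure_incseq[symmetric]) (auto simp: incseq_def)
      also have "\<dots> = (SUP n. of_nat (point_count \<omega> (B \<inter> K n)))"
        by (intro SUP_cong refl config_count_compact[OF that K(1) Int_lower2])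
      finally show ?thesis .
    qed
    then have "(\<lambda>\<omega>. config_count (R \<omega>) B) \<in> borel_measurable ?G \<longleftrightarrow>
        (\<lambda>\<omega>. SUP n. of_nat (point_count \<omega> (B \<inter> K n)) :: ennreal) \<in> borel_measurable ?G"
      by (intro measurable_cong) (simp add: space_measure_of[OF G_Pow])
    also have \<dots>
      by measurable
    finally show "(\<lambda>\<omega>. config_count (R \<omega>) B) \<in> borel_measurable ?G" .
  qed
  have distr_R: "distr \<nu> config_space R = \<nu>"
    if \<nu>: "sets \<nu> = sets config_space" and ae: "AE \<omega> in \<nu>. config_count \<omega> (- U) = 0" for \<nu>
  proof -
    have "distr \<nu> config_space R = distr \<nu> config_space (\<lambda>\<omega>. \<omega>)"
    proof (rule distr_cong_AE)
      show "AE \<omega> in \<nu>. R \<omega> = \<omega>"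
        using ae
      proof eventually_elim
        case (elim \<omega>)
        then have "AE x in count_space UNIV. ennreal (real (\<omega> x)) * indicator (- U) x = 0"
          unfolding config_count_def by (subst (asm) nn_integral_0_iff_AE) auto
        then have "ennreal (real (\<omega> x)) * indicator (- U) x = 0" for x
          by (simp add: AE_count_space)
        then show ?case
          by (auto simp: R_def fun_eq_iff indicator_def split: if_splits)
      qed
      show "R \<in> \<nu> \<rightarrow>\<^sub>M config_space"
        using measurable_comp[OF id R] by (simp add: comp_def measurable_cong_sets[OF \<nu> refl])
      show "(\<lambda>\<omega>. \<omega>) \<in> \<nu> \<rightarrow>\<^sub>M config_space"
        using \<nu> by (rule measurable_ident_sets)
    qed auto
    also have "\<dots> = \<nu>"
      by (rule distr_id2[OF \<nu>[symmetric]])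
    finally show ?thesis .
  qed
  have "\<mu> = distr \<mu> config_space R"
    using \<mu> null by (intro distr_R[symmetric]) (auto simp: U_def)
  also have "\<dots> = distr (distr \<mu> ?G (\<lambda>\<omega>. \<omega>)) config_space R"
    by (subst distr_distr[OF R]) (use id in \<open>auto simp: comp_def measurable_cong_sets[OF \<mu>(2) refl]\<close>)
  also have "\<dots> = distr (distr \<mu>' ?G (\<lambda>\<omega>. \<omega>)) config_space R"
    by (simp add: distr_eq)
  also have "\<dots> = distr \<mu>' config_space R"
    by (subst distr_distr[OF R]) (use id in \<open>auto simp: comp_def measurable_cong_sets[OF \<mu>'(2) refl]\<close>)
  also have "\<dots> = \<mu>'"
    using \<mu>' null by (intro distr_R) (auto simp: U_def)
  finally show ?thesis .
qed

section \<open>Generating functions determine joint laws of counts\<close>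

lemma powser_zero_coeffs:
  fixes c :: "nat \<Rightarrow> real"
  assumes bound: "\<And>n. \<bar>c n\<bar> \<le> C" and zero: "\<And>s. 0 < s \<Longrightarrow> s < 1 \<Longrightarrow> (\<lambda>n. c n * s ^ n) sums 0"
  shows "c n = 0"
proof (induction n rule: less_induct)
  case (less n)
  define f where "f x = (\<Sum>k. c (k + n) * x ^ k)" for x
  have summable: "summable (\<lambda>k. c (k + n) * x ^ k)" if "norm x < 1" for x
  proof (rule summable_comparison_test')
    show "summable (\<lambda>k. C * norm x ^ k)"
      using that by (intro summable_mult summable_geometric) auto
    show "norm (c (k + n) * x ^ k) \<le> C * norm x ^ k" if "0 \<le> k" for k
      using bound[of "k + n"] by (auto simp: abs_mult power_abs intro!: mult_right_mono)
  qed
  \<comment> \<open>The lower coefficients vanish by induction, so the series can be divided by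
    \<open>x ^ n\<close>. As only positive arguments are available, \<open>c n\<close> is found as
    the limit at 0 from the right.\<close>
  have "f x = 0" if x: "0 < x" "x < 1" for x
  proof -
    have "(\<lambda>k. c (k + n) * x ^ (k + n)) sums (0 - (\<Sum>k<n. c k * x ^ k))"
      using zero[OF x] by (rule sums_split_initial_segment)
    also have "(\<Sum>k<n. c k * x ^ k) = 0"
      using less.IH by simp
    also have "(\<lambda>k. c (k + n) * x ^ (k + n)) = (\<lambda>k. x ^ n * (c (k + n) * x ^ k))"
      by (auto simp: power_add)
    finally have "(\<lambda>k. x ^ n * (c (k + n) * x ^ k)) sums (x ^ n * 0)" by simp
    then have "(\<lambda>k. c (k + n) * x ^ k) sums 0"
      using x by (subst (asm) sums_mult_iff) auto
    then show ?thesis by (simp add: f_def sums_iff)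
  qed
  then have "\<forall>\<^sub>F x in at_right 0. f x = 0"
    by (subst eventually_at_right[of 0 1]) (auto intro!: exI[of _ 1])
  then have "(f \<longlongrightarrow> 0) (at_right 0)"
    by (rule tendsto_eventually)
  moreover have "(f \<longlongrightarrow> c (0 + n)) (at 0)"
    by (rule powser_limit_0[of 1]) (use summable in \<open>auto simp: f_def summable_sums\<close>)
  then have "(f \<longlongrightarrow> c n) (at_right 0)"
    by (simp add: filterlim_at_split)
  ultimately show "c n = 0"
    using tendsto_unique[of "at_right (0::real)"] by (metis trivial_limit_at_right_real)
qed

lemma nn_integral_power_expand:
  assumes [measurable]: "w \<in> borel_measurable M" "N \<in> M \<rightarrow>\<^sub>M count_space UNIV"
  shows "(\<integral>\<^sup>+x. w x * ennreal s ^ N x \<partial>M) = (\<Sum>k. ennreal s ^ k * (\<integral>\<^sup>+x. w x * indicator {x. N x = k} x \<partial>M))"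
proof -
  have [measurable]: "(\<lambda>x. indicator {x. N x = k} x :: ennreal) \<in> borel_measurable M" for k
    by (rule borel_measurable_indicator') (auto simp: vimage_def)
  have "w x * ennreal s ^ N x = (\<Sum>k. ennreal s ^ k * (w x * indicator {x. N x = k} x))" for x
    by (subst suminf_finite[of "{N x}"]) (auto simp: indicator_def mult.commute)
  then show ?thesis
    by (simp add: nn_integral_suminf nn_integral_cmult)
qed

text \<open>The difference of the two coefficient sequences is bounded and its power series vanishes
  on the open unit interval. The weights \<open>w\<close> and \<open>w'\<close> are carried along
  for the induction over several counts.\<close>

lemma generating_function_determines_coeffs:
  assumes M: "finite_measure M" and M': "finite_measure M'"
    and [measurable]: "w \<in> borel_measurable M" "N \<in> M \<rightarrow>\<^sub>M count_space UNIV"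
      "w' \<in> borel_measurable M'" "N' \<in> M' \<rightarrow>\<^sub>M count_space UNIV"
    and w: "\<And>x. w x \<le> 1" "\<And>x. w' x \<le> 1"
    and eq: "\<And>s. 0 < s \<Longrightarrow> s < 1 \<Longrightarrow> (\<integral>\<^sup>+x. w x * ennreal s ^ N x \<partial>M) = (\<integral>\<^sup>+x. w' x * ennreal s ^ N' x \<partial>M')"
  shows "(\<integral>\<^sup>+x. w x * indicator {x. N x = k} x \<partial>M) = (\<integral>\<^sup>+x. w' x * indicator {x. N' x = k} x \<partial>M')"
proof -
  interpret M: finite_measure M by fact
  interpret M': finite_measure M' by fact
  let ?a = "\<lambda>k. \<integral>\<^sup>+x. w x * indicator {x. N x = k} x \<partial>M" and ?b = "\<lambda>k. \<integral>\<^sup>+x. w' x * indicator {x. N' x = k} x \<partial>M'"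
  define a b where "a k = enn2real (?a k)" and "b k = enn2real (?b k)" for k
  have "?a k \<le> (\<integral>\<^sup>+x. 1 \<partial>M)" for k
    using w by (intro nn_integral_mono) (auto simp: indicator_def)
  then have a_le: "?a k \<le> emeasure M (space M)" for k by simp
  have "?b k \<le> (\<integral>\<^sup>+x. 1 \<partial>M')" for k
    using w by (intro nn_integral_mono) (auto simp: indicator_def)
  then have b_le: "?b k \<le> emeasure M' (space M')" for k by simp
  have fin: "emeasure M (space M) < \<top>" "emeasure M' (space M') < \<top>"
    using M.emeasure_finite M'.emeasure_finite by (simp_all only: less_top infinity_ennreal_def)
  have a: "?a k = ennreal (a k)" "0 \<le> a k" "a k \<le> measure M (space M)" for k
    using enn2real_mono[OF a_le[of k] fin(1)] le_less_trans[OF a_le[of k] fin(1)]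
    by (simp_all add: a_def measure_def)
  have b: "?b k = ennreal (b k)" "0 \<le> b k" "b k \<le> measure M' (space M')" for k
    using enn2real_mono[OF b_le[of k] fin(2)] le_less_trans[OF b_le[of k] fin(2)]
    by (simp_all add: b_def measure_def)
  have "a k - b k = 0"
  proof (rule powser_zero_coeffs[where C = "measure M (space M) + measure M' (space M')"])
    show "\<bar>a n - b n\<bar> \<le> measure M (space M) + measure M' (space M')" for n
      using a[of n] b[of n] by auto
    fix s :: real assume s: "0 < s" "s < 1"
    have sums: "(\<lambda>k. c k * s ^ k) sums suminf (\<lambda>k. c k * s ^ k)" if "\<And>k. 0 \<le> c k" "\<And>k. c k \<le> C" for c C
    proof (rule summable_sums, rule summable_comparison_test')
      show "summable (\<lambda>k. C * s ^ k)"
        using s by (intro summable_mult summable_geometric) auto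
      show "norm (c k * s ^ k) \<le> C * s ^ k" if "0 \<le> k" for k
        using s that \<open>\<And>k. 0 \<le> c k\<close> \<open>\<And>k. c k \<le> C\<close> by (auto simp: abs_mult intro!: mult_right_mono)
    qed
    have "ennreal (suminf (\<lambda>k. a k * s ^ k)) = (\<Sum>k. ennreal (a k * s ^ k))"
      using sums[of a, OF a(2,3)] a(2) s by (intro suminf_ennreal2[symmetric]) (auto simp: sums_iff)
    also have "\<dots> = (\<Sum>k. ennreal s ^ k * ?a k)"
      using a s by (simp add: ennreal_mult ennreal_power mult.commute)
    also have "\<dots> = (\<Sum>k. ennreal s ^ k * ?b k)"
      using eq[OF s] by (simp add: nn_integral_power_expand)
    also have "\<dots> = (\<Sum>k. ennreal (b k * s ^ k))"
      using b s by (simp add: ennreal_mult ennreal_power mult.commute)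
    also have "\<dots> = ennreal (suminf (\<lambda>k. b k * s ^ k))"
      using sums[of b, OF b(2,3)] b(2) s by (intro suminf_ennreal2) (auto simp: sums_iff)
    finally have "suminf (\<lambda>k. a k * s ^ k) = suminf (\<lambda>k. b k * s ^ k)"
      using a(2) b(2) s sums[of a, OF a(2,3)] sums[of b, OF b(2,3)]
      by (subst (asm) ennreal_inj) (auto intro!: suminf_nonneg simp: sums_iff)
    then have "(\<lambda>k. a k * s ^ k - b k * s ^ k) sums 0"
      using sums_diff[OF sums[of a, OF a(2,3)] sums[of b, OF b(2,3)]] by simp
    then show "(\<lambda>k. (a k - b k) * s ^ k) sums 0"
      by (simp add: algebra_simps)
  qed
  then show ?thesis using a(1) b(1) by simp
qed

text \<open>Induction on \<open>T\<close> with varying weight. The powers of the other counts are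
  first absorbed into the weight, so that the coefficients of count \<open>t\<close> can be
  compared; the indicator so obtained then becomes part of the weight in the induction
  hypothesis.\<close>

lemma generating_function_determines_joint_law:
  fixes N :: "'t \<Rightarrow> 'a \<Rightarrow> nat" and N' :: "'t \<Rightarrow> 'b \<Rightarrow> nat"
  assumes M: "finite_measure M" and M': "finite_measure M'" and T: "finite T"
    and N: "\<And>t. t \<in> T \<Longrightarrow> N t \<in> M \<rightarrow>\<^sub>M count_space UNIV"
    and N': "\<And>t. t \<in> T \<Longrightarrow> N' t \<in> M' \<rightarrow>\<^sub>M count_space UNIV"
    and w: "w \<in> borel_measurable M" "\<And>x. w x \<le> 1" "w' \<in> borel_measurable M'" "\<And>x. w' x \<le> 1"
    and eq: "\<And>s. (\<And>t. 0 < s t \<and> s t < 1) \<Longrightarrow>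
      (\<integral>\<^sup>+x. w x * (\<Prod>t\<in>T. ennreal (s t) ^ N t x) \<partial>M) = (\<integral>\<^sup>+x. w' x * (\<Prod>t\<in>T. ennreal (s t) ^ N' t x) \<partial>M')"
  shows "(\<integral>\<^sup>+x. w x * (\<Prod>t\<in>T. indicator {x. N t x = n t} x) \<partial>M) =
    (\<integral>\<^sup>+x. w' x * (\<Prod>t\<in>T. indicator {x. N' t x = n t} x) \<partial>M')"
  using T N N' w eq
proof (induction T arbitrary: w w' rule: finite_induct)
  case empty
  show ?case using empty.prems(7)[of "\<lambda>_. 1 / 2"] by simp
next
  case (insert t T)
  note [measurable] = insert.prems(3,5)
  have Nm: "N t \<in> M \<rightarrow>\<^sub>M count_space UNIV" "N' t \<in> M' \<rightarrow>\<^sub>M count_space UNIV"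
    using insert.prems(1,2) by auto
  have ind[measurable]: "(\<lambda>x. indicator {x. N t x = n t} x :: ennreal) \<in> borel_measurable M"
    "(\<lambda>x. indicator {x. N' t x = n t} x :: ennreal) \<in> borel_measurable M'"
    using Nm by (auto intro!: borel_measurable_indicator' simp: vimage_def)
  have "(\<integral>\<^sup>+x. (w x * indicator {x. N t x = n t} x) * (\<Prod>u\<in>T. indicator {x. N u x = n u} x) \<partial>M) =
    (\<integral>\<^sup>+x. (w' x * indicator {x. N' t x = n t} x) * (\<Prod>u\<in>T. indicator {x. N' u x = n u} x) \<partial>M')"
  proof (rule insert.IH)
    show "w x * indicator {x. N t x = n t} x \<le> 1" for x
      using insert.prems(4)[of x] by (auto simp: indicator_def)
    show "w' x * indicator {x. N' t x = n t} x \<le> 1" for x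
      using insert.prems(6)[of x] by (auto simp: indicator_def)
    fix s :: "'t \<Rightarrow> real" assume s: "\<And>t. 0 < s t \<and> s t < 1"
    have pw: "(\<lambda>x. ennreal (s u) ^ N u x) \<in> borel_measurable M" "(\<lambda>x. ennreal (s u) ^ N' u x) \<in> borel_measurable M'" if "u \<in> T" for u
      using insert.prems(1,2) that by (auto intro!: measurable_compose[where N = "count_space UNIV" and g = "\<lambda>n. ennreal (s u) ^ n"])
    have le: "(\<Prod>u\<in>T. ennreal (s u) ^ f u) \<le> 1" for f
      using s by (intro prod_le_1) (auto intro!: power_le_one simp: ennreal_le_1 less_imp_le)
    have "(\<integral>\<^sup>+x. (w x * (\<Prod>u\<in>T. ennreal (s u) ^ N u x)) * indicator {x. N t x = n t} x \<partial>M) =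
      (\<integral>\<^sup>+x. (w' x * (\<Prod>u\<in>T. ennreal (s u) ^ N' u x)) * indicator {x. N' t x = n t} x \<partial>M')"
    proof (rule generating_function_determines_coeffs[OF M M'])
      show "(\<lambda>x. w x * (\<Prod>u\<in>T. ennreal (s u) ^ N u x)) \<in> borel_measurable M"
        using pw by (intro borel_measurable_times_ennreal borel_measurable_prod_ennreal) auto
      show "(\<lambda>x. w' x * (\<Prod>u\<in>T. ennreal (s u) ^ N' u x)) \<in> borel_measurable M'"
        using pw by (intro borel_measurable_times_ennreal borel_measurable_prod_ennreal) auto
      show "w x * (\<Prod>u\<in>T. ennreal (s u) ^ N u x) \<le> 1" for x
        using mult_mono[OF insert.prems(4)[of x] le] by simp
      show "w' x * (\<Prod>u\<in>T. ennreal (s u) ^ N' u x) \<le> 1" for x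
        using mult_mono[OF insert.prems(6)[of x] le] by simp
      fix \<sigma> :: real assume \<sigma>: "0 < \<sigma>" "\<sigma> < 1"
      have upd: "(\<Prod>u\<in>insert t T. ennreal ((s(t := \<sigma>)) u) ^ f u) = (\<Prod>u\<in>T. ennreal (s u) ^ f u) * ennreal \<sigma> ^ f t" for f
      proof -
        have "(\<Prod>u\<in>T. ennreal ((s(t := \<sigma>)) u) ^ f u) = (\<Prod>u\<in>T. ennreal (s u) ^ f u)"
          using insert.hyps by (intro prod.cong) auto
        then show ?thesis
          using insert.hyps by (simp add: mult.commute)
      qed
      have "(\<integral>\<^sup>+x. w x * (\<Prod>u\<in>insert t T. ennreal ((s(t := \<sigma>)) u) ^ N u x) \<partial>M) =
        (\<integral>\<^sup>+x. w' x * (\<Prod>u\<in>insert t T. ennreal ((s(t := \<sigma>)) u) ^ N' u x) \<partial>M')"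
        by (rule insert.prems(7)) (use s \<sigma> in auto)
      then show "(\<integral>\<^sup>+x. w x * (\<Prod>u\<in>T. ennreal (s u) ^ N u x) * ennreal \<sigma> ^ N t x \<partial>M) =
        (\<integral>\<^sup>+x. w' x * (\<Prod>u\<in>T. ennreal (s u) ^ N' u x) * ennreal \<sigma> ^ N' t x \<partial>M')"
        unfolding upd by (simp add: mult.assoc)
    qed (use Nm in auto)
    then show "(\<integral>\<^sup>+x. w x * indicator {x. N t x = n t} x * (\<Prod>u\<in>T. ennreal (s u) ^ N u x) \<partial>M) =
      (\<integral>\<^sup>+x. w' x * indicator {x. N' t x = n t} x * (\<Prod>u\<in>T. ennreal (s u) ^ N' u x) \<partial>M')"
      by (simp add: ac_simps)
  qed (use insert.prems in auto)
  then show ?case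
    using insert.hyps by (simp add: mult.assoc)
qed

text \<open>Its mean is the probability generating functional of the point process, restricted to
  \<open>C\<close>.\<close>

definition point_functional :: "'e set \<Rightarrow> ('e \<Rightarrow> ennreal) \<Rightarrow> ('e \<Rightarrow> nat) \<Rightarrow> ennreal" where
  "point_functional C H \<omega> = (\<Prod>x\<in>{x\<in>C. \<omega> x \<noteq> 0}. H x ^ \<omega> x)"

lemma power_point_count:
  fixes c :: ennreal
  assumes fin: "finite {x\<in>C. \<omega> x \<noteq> 0}" and "B \<subseteq> C"
  shows "c ^ point_count \<omega> B = (\<Prod>x\<in>{x\<in>C. \<omega> x \<noteq> 0}. (if x \<in> B then c else 1) ^ \<omega> x)"
proof -
  have "point_count \<omega> B = (\<Sum>x\<in>{x\<in>C. \<omega> x \<noteq> 0}. if x \<in> B then \<omega> x else 0)"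
    unfolding point_count_def using assms by (intro sum.mono_neutral_cong_left) auto
  also have "c ^ \<dots> = (\<Prod>x\<in>{x\<in>C. \<omega> x \<noteq> 0}. (if x \<in> B then c else 1) ^ \<omega> x)"
    by (simp add: power_sum) (intro prod.cong, auto)
  finally show ?thesis .
qed

text \<open>The sets \<open>B t\<close> may overlap. Sorting the factors by points instead of sets
  turns a joint generating function of overlapping counts into a single functional, with no
  refinement into disjoint sets.\<close>

lemma point_functional_prod:
  fixes c :: "'t \<Rightarrow> ennreal"
  assumes fin: "finite {x\<in>C. \<omega> x \<noteq> 0}" and B: "\<And>t. t \<in> T \<Longrightarrow> B t \<subseteq> C"
  shows "(\<Prod>t\<in>T. c t ^ point_count \<omega> (B t)) = point_functional C (\<lambda>x. \<Prod>t\<in>T. if x \<in> B t then c t else 1) \<omega>"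
proof -
  have "(\<Prod>t\<in>T. c t ^ point_count \<omega> (B t)) = (\<Prod>t\<in>T. \<Prod>x\<in>{x\<in>C. \<omega> x \<noteq> 0}. (if x \<in> B t then c t else 1) ^ \<omega> x)"
    using power_point_count[OF fin B] by (intro prod.cong) auto
  also have "\<dots> = (\<Prod>x\<in>{x\<in>C. \<omega> x \<noteq> 0}. \<Prod>t\<in>T. (if x \<in> B t then c t else 1) ^ \<omega> x)"
    by (rule prod.swap)
  finally show ?thesis
    by (simp add: point_functional_def prod_power_distrib)
qed

definition ennreal_to_nat :: "ennreal \<Rightarrow> nat" where
  "ennreal_to_nat c = nat \<lfloor>enn2real c\<rfloor>"

lemma ennreal_to_nat_of_nat [simp]: "ennreal_to_nat (of_nat n) = n"
  by (simp add: ennreal_to_nat_def ennreal_of_nat_eq_real_of_nat)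

lemma measurable_ennreal_to_nat [measurable]: "ennreal_to_nat \<in> borel \<rightarrow>\<^sub>M count_space UNIV"
  unfolding ennreal_to_nat_def[abs_def] by measurable

lemma emeasure_poisson_law_singleton: "emeasure (poisson_law a) {n} = ennreal (a ^ n / fact n * exp (- a))"
  unfolding poisson_law_def
  by (subst emeasure_density) (auto simp: nn_integral_count_space'[of "{n}"])

context
  fixes m :: "'e::metric_space measure" and P :: "('e \<Rightarrow> nat) measure" and C :: "'e set"
  assumes P: "poisson_measure m P" and C: "compact C" and m_C: "emeasure m C < \<infinity>" and sets_m: "sets m = sets borel"
begin

interpretation P: prob_space P
  using P by (simp add: poisson_measure_def)

lemma sets_poisson: "sets P = sets config_space"
  using P by (simp add: poisson_measure_def)

lemma space_poisson: "space P = configs"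
  using sets_eq_imp_space_eq[OF sets_poisson] by simp

lemma distr_poisson_count:
  assumes B: "B \<in> sets borel" "B \<subseteq> C"
  shows "distr P (count_space UNIV) (\<lambda>\<omega>. ennreal_to_nat (config_count \<omega> B)) = poisson_law (enn2real (emeasure m B))"
proof (rule measure_eqI_countable[where A = UNIV])
  fix n :: nat
  note [measurable_cong] = sets_poisson
  have fin: "emeasure m B < \<infinity>"
    using emeasure_mono[OF B(2), of m] m_C C by (auto simp: sets_m borel_compact intro: le_less_trans)
  have [measurable]: "(\<lambda>\<omega>. config_count \<omega> B) \<in> borel_measurable P"
    using B(1) by measurable
  have "emeasure (distr P (count_space UNIV) (\<lambda>\<omega>. ennreal_to_nat (config_count \<omega> B))) {n} =
    emeasure P {\<omega>\<in>space P. config_count \<omega> B = of_nat n}"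
    by (subst emeasure_distr)
       (auto intro!: arg_cong[where f = "emeasure P"] simp: space_poisson config_count_compact[OF _ C B(2)])
  also have "\<dots> = ennreal (exp (- enn2real (emeasure m B)) * enn2real (emeasure m B) ^ n / fact n)"
    using P B(1) fin unfolding P.emeasure_eq_measure poisson_measure_def by auto
  finally show "emeasure (distr P (count_space UNIV) (\<lambda>\<omega>. ennreal_to_nat (config_count \<omega> B))) {n} =
    emeasure (poisson_law (enn2real (emeasure m B))) {n}"
    by (simp add: emeasure_poisson_law_singleton mult.commute)
qed auto

text \<open>The level sets of \<open>H\<close> are disjoint, so the counts in them are independent
  Poisson variables and the mean is a product of their generating functions.\<close>

lemma poisson_point_functional:
  fixes H :: "'e \<Rightarrow> ennreal"
  assumes H[measurable]: "H \<in> borel_measurable borel" and fin: "finite (range H)"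
    and H_le: "\<And>x. H x \<le> 1" and H_out: "\<And>x. x \<notin> C \<Longrightarrow> H x = 1"
  shows "(\<integral>\<^sup>+\<omega>. point_functional C H \<omega> \<partial>P) = ennreal (exp (- enn2real (\<integral>\<^sup>+x. 1 - H x \<partial>m)))"
proof -
  note [measurable_cong] = sets_poisson sets_m
  \<comment> \<open>Points where \<open>H\<close> is 1 do not contribute, and that level set may
    leave \<open>C\<close> and have infinite mass. The other values are enumerated by natural
    numbers because independence is given for families indexed by them.\<close>
  define V where "V = range H - {1}"
  have "finite V" using fin by (simp add: V_def)
  then obtain e where e: "bij_betw e {..<card V} V"
    using ex_bij_betw_nat_finite[of V] by (auto simp: atLeast0LessThan)
  let ?I = "{..<card V}"
  define B where "B i = {x. H x = e i}" for i
  have eV: "e i \<in> V" if "i \<in> ?I" for i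
    using e that by (auto simp: bij_betw_def)
  have e_le: "e i \<le> 1" "e i \<noteq> 1" if "i \<in> ?I" for i
    using eV[OF that] H_le by (auto simp: V_def)
  have e_real: "e i = ennreal (enn2real (e i))" if "i \<in> ?I" for i
    using e_le(1)[OF that] by (metis ennreal_enn2real ennreal_one_less_top le_less_trans)
  have B_sets[measurable]: "B i \<in> sets borel" for i
    unfolding B_def by measurable
  have B_C: "B i \<subseteq> C" if "i \<in> ?I" for i
    using H_out e_le(2)[OF that] unfolding B_def by force
  have e_real_le: "enn2real (e i) \<le> 1" if "i \<in> ?I" for i
    using enn2real_mono[OF e_le(1)[OF that]] by simp
  have B_fin: "emeasure m (B i) < \<infinity>" if "i \<in> ?I" for i
    using emeasure_mono[OF B_C[OF that], of m] m_C C by (auto simp: sets_m borel_compact intro: le_less_trans)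
  have disj: "disjoint_family_on B ?I"
    using e by (auto simp: disjoint_family_on_def B_def bij_betw_def inj_on_def)
  have H_eq: "(\<Prod>i\<in>?I. if x \<in> B i then e i else 1) = H x" for x
  proof (cases "H x = 1")
    case True
    then show ?thesis using e_le(2) by (auto simp: B_def intro!: prod.neutral)
  next
    case False
    then have "H x \<in> e ` ?I"
      using e by (simp add: V_def bij_betw_def)
    then obtain j where j: "j \<in> ?I" "e j = H x"
      by (metis imageE)
    have "(\<Prod>i\<in>?I. if x \<in> B i then e i else 1) = (\<Prod>i\<in>?I. if i = j then H x else 1)"
      using e j by (intro prod.cong refl) (auto simp: B_def bij_betw_def inj_on_def)
    also have "\<dots> = H x" using j by simp
    finally show ?thesis .
  qed
  have one_minus: "1 - H x = (\<Sum>i\<in>?I. (1 - e i) * indicator (B i) x)" for x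
  proof (cases "H x = 1")
    case True
    then show ?thesis using e_le(2) by (auto simp: B_def indicator_def intro!: sum.neutral[symmetric])
  next
    case False
    then have "H x \<in> e ` ?I"
      using e by (simp add: V_def bij_betw_def)
    then obtain j where j: "j \<in> ?I" "e j = H x"
      by (metis imageE)
    have "(\<Sum>i\<in>?I. (1 - e i) * indicator (B i) x) = (\<Sum>i\<in>?I. if i = j then 1 - H x else 0)"
      using e j by (intro sum.cong refl) (auto simp: B_def bij_betw_def inj_on_def indicator_def)
    also have "\<dots> = 1 - H x" using j by simp
    finally show ?thesis ..
  qed
  have "(\<integral>\<^sup>+\<omega>. point_functional C H \<omega> \<partial>P) = (\<integral>\<^sup>+\<omega>. (\<Prod>i\<in>?I. e i ^ ennreal_to_nat (config_count \<omega> (B i))) \<partial>P)"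
  proof (rule nn_integral_cong)
    fix \<omega> assume "\<omega> \<in> space P"
    then have \<omega>: "\<omega> \<in> configs" by (simp add: space_poisson)
    have "(\<Prod>i\<in>?I. e i ^ point_count \<omega> (B i)) = point_functional C (\<lambda>x. \<Prod>i\<in>?I. if x \<in> B i then e i else 1) \<omega>"
      by (rule point_functional_prod[OF configs_finite_subset[OF \<omega> C order_refl] B_C])
    then show "point_functional C H \<omega> = (\<Prod>i\<in>?I. e i ^ ennreal_to_nat (config_count \<omega> (B i)))"
      by (simp add: H_eq config_count_compact[OF \<omega> C B_C])
  qed
  also have "\<dots> = (\<Prod>i\<in>?I. \<integral>\<^sup>+\<omega>. e i ^ ennreal_to_nat (config_count \<omega> (B i)) \<partial>P)"
  proof (rule P.indep_vars_nn_integral)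
    have "P.indep_vars (\<lambda>_. borel) (\<lambda>i \<omega>. config_count \<omega> (B i)) ?I"
      using P disj unfolding poisson_measure_def by auto
    then show "P.indep_vars (\<lambda>_. borel) (\<lambda>i \<omega>. e i ^ ennreal_to_nat (config_count \<omega> (B i))) ?I"
      by (rule P.indep_vars_compose2) measurable
  qed auto
  also have "\<dots> = (\<Prod>i\<in>?I. ennreal (exp (enn2real (emeasure m (B i)) * (enn2real (e i) - 1))))"
  proof (rule prod.cong[OF refl])
    fix i assume i: "i \<in> ?I"
    have [measurable]: "(\<lambda>\<omega>. config_count \<omega> (B i)) \<in> borel_measurable P"
      by measurable
    have "(\<integral>\<^sup>+\<omega>. e i ^ ennreal_to_nat (config_count \<omega> (B i)) \<partial>P) =
      (\<integral>\<^sup>+n. e i ^ n \<partial>distr P (count_space UNIV) (\<lambda>\<omega>. ennreal_to_nat (config_count \<omega> (B i))))"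
      by (subst nn_integral_distr) auto
    also have "\<dots> = (\<integral>\<^sup>+n. e i ^ n \<partial>poisson_law (enn2real (emeasure m (B i))))"
      by (simp add: distr_poisson_count[OF B_sets B_C[OF i]])
    also have "\<dots> = ennreal (exp (enn2real (emeasure m (B i)) * (enn2real (e i) - 1)))"
      by (subst e_real[OF i], rule nn_integral_poisson_law_power) auto
    finally show "(\<integral>\<^sup>+\<omega>. e i ^ ennreal_to_nat (config_count \<omega> (B i)) \<partial>P) =
      ennreal (exp (enn2real (emeasure m (B i)) * (enn2real (e i) - 1)))" .
  qed
  also have "\<dots> = ennreal (exp (\<Sum>i\<in>?I. enn2real (emeasure m (B i)) * (enn2real (e i) - 1)))"
    by (simp add: prod_ennreal exp_sum)
  also have "(\<Sum>i\<in>?I. enn2real (emeasure m (B i)) * (enn2real (e i) - 1)) = - enn2real (\<integral>\<^sup>+x. 1 - H x \<partial>m)"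
  proof -
    have "(\<integral>\<^sup>+x. 1 - H x \<partial>m) = (\<Sum>i\<in>?I. (1 - e i) * emeasure m (B i))"
      unfolding one_minus by (subst nn_integral_sum) (auto simp: nn_integral_cmult)
    also have "\<dots> = (\<Sum>i\<in>?I. ennreal ((1 - enn2real (e i)) * enn2real (emeasure m (B i))))"
    proof (rule sum.cong[OF refl])
      fix i assume i: "i \<in> ?I"
      have "1 - e i = ennreal (1 - enn2real (e i))"
        by (subst (1) e_real[OF i]) (simp flip: ennreal_1 add: ennreal_minus)
      then show "(1 - e i) * emeasure m (B i) = ennreal ((1 - enn2real (e i)) * enn2real (emeasure m (B i)))"
        using B_fin[OF i] e_real_le[OF i] by (simp add: ennreal_mult)
    qed
    also have "\<dots> = ennreal (\<Sum>i\<in>?I. (1 - enn2real (e i)) * enn2real (emeasure m (B i)))"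
      using e_real_le by (intro sum_ennreal mult_nonneg_nonneg) auto
    finally have eq: "(\<integral>\<^sup>+x. 1 - H x \<partial>m) = ennreal (\<Sum>i\<in>?I. (1 - enn2real (e i)) * enn2real (emeasure m (B i)))" .
    have "enn2real (\<integral>\<^sup>+x. 1 - H x \<partial>m) = (\<Sum>i\<in>?I. (1 - enn2real (e i)) * enn2real (emeasure m (B i)))"
      unfolding eq using e_real_le by (intro enn2real_ennreal sum_nonneg mult_nonneg_nonneg) auto
    then show ?thesis
      by (simp add: sum_negf[symmetric] algebra_simps)
  qed
  finally show ?thesis .
qed

end

section \<open>Splitting the intensity\<close>

definition multiplicity_at :: "nat \<times> (nat \<Rightarrow> 'e) \<Rightarrow> 'e \<Rightarrow> nat" where
  "multiplicity_at y x = card {k. k < fst y \<and> snd y k = x}"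

lemma nn_integral_multiplicity_at:
  "(\<integral>\<^sup>+x. f x * ennreal (real (multiplicity_at y x)) \<partial>count_space UNIV) = (\<Sum>k<fst y. f (snd y k))"
proof -
  have "ennreal (real (multiplicity_at y x)) = (\<Sum>k<fst y. indicator {snd y k} x)" for x
  proof -
    have "real (multiplicity_at y x) = (\<Sum>k<fst y. if snd y k = x then 1 else 0)"
      by (auto simp: multiplicity_at_def sum.If_cases intro!: arg_cong[where f = card])
    then have "ennreal (real (multiplicity_at y x)) = (\<Sum>k<fst y. ennreal (if snd y k = x then 1 else 0))"
      by (simp only:) (rule sum_ennreal[symmetric], simp)
    also have "\<dots> = (\<Sum>k<fst y. indicator {snd y k} x)"
      by (intro sum.cong) (auto simp: indicator_def)
    finally show ?thesis .
  qed
  then have "(\<integral>\<^sup>+x. f x * ennreal (real (multiplicity_at y x)) \<partial>count_space UNIV) =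
    (\<integral>\<^sup>+x. (\<Sum>k<fst y. f x * indicator {snd y k} x) \<partial>count_space UNIV)"
    by (simp only: sum_distrib_left)
  also have "\<dots> = (\<Sum>k<fst y. \<integral>\<^sup>+x. f x * indicator {snd y k} x \<partial>count_space UNIV)"
    by (rule nn_integral_sum) simp
  also have "\<dots> = (\<Sum>k<fst y. f (snd y k))"
  proof (rule sum.cong[OF refl])
    fix k
    show "(\<integral>\<^sup>+x. f x * indicator {snd y k} x \<partial>count_space UNIV) = f (snd y k)"
      by (subst nn_integral_count_space'[of "{snd y k}"]) auto
  qed
  finally show ?thesis .
qed

lemma prod_multiplicity_at:
  fixes H :: "'e \<Rightarrow> ennreal"
  assumes "finite X" "snd y ` {..<fst y} \<subseteq> X"
  shows "(\<Prod>k<fst y. H (snd y k)) = (\<Prod>x\<in>X. H x ^ multiplicity_at y x)"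
proof -
  have "(\<Prod>k<fst y. H (snd y k)) = (\<Prod>x\<in>X. \<Prod>k\<in>{k. k \<in> {..<fst y} \<and> snd y k = x}. H (snd y k))"
    using assms by (intro prod.group[symmetric]) auto
  also have "\<dots> = (\<Prod>x\<in>X. H x ^ multiplicity_at y x)"
    by (intro prod.cong refl) (simp add: multiplicity_at_def)
  finally show ?thesis .
qed

text \<open>The intensity \<open>m\<close> is split as \<open>\<Sum>\<^sub>i c\<^sub>i 1\<^bsub>F\<^sub>i\<^esub> m\<close>. Local finiteness of the pieces makes every
  superposition of finite configurations on the pieces a configuration, without exceptional sets.\<close>

locale intensity_pieces =
  fixes m :: "'e::metric_space measure" and F :: "nat \<Rightarrow> 'e set" and c :: "nat \<Rightarrow> real" and U :: "'e set"
  assumes sets_m: "sets m = sets borel"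
    and F_sets [measurable]: "\<And>i. F i \<in> sets borel"
    and F_fin: "\<And>i. emeasure m (F i) < \<infinity>"
    and c_nonneg: "\<And>i. 0 \<le> c i"
    and F_locally_finite: "\<And>C. compact C \<Longrightarrow> finite {i. F i \<inter> C \<noteq> {}}"
    and F_U: "\<And>i. F i \<subseteq> U"
    and weights: "\<And>x. x \<in> U \<Longrightarrow> (\<Sum>i | x \<in> F i. c i) = 1"
begin

text \<open>A piece without mass has rate 0 and so almost surely no points; the point mass only
  keeps its law a probability measure.\<close>

definition piece_law :: "nat \<Rightarrow> 'e measure" where
  "piece_law i = (if emeasure m (F i) = 0 then return borel undefined
     else density m (\<lambda>x. indicator (F i) x / emeasure m (F i)))"

definition piece_rate :: "nat \<Rightarrow> real" where
  "piece_rate i = c i * enn2real (emeasure m (F i))"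

definition piece_process :: "nat \<Rightarrow> (nat \<times> (nat \<Rightarrow> 'e)) measure" where
  "piece_process i = compound_poisson (piece_rate i) (piece_law i)"

text \<open>Points of \<open>y i\<close> outside \<open>F i\<close>, which almost surely do not
  occur, are ignored. This makes the result a configuration for every \<open>y\<close>.\<close>

definition superpose :: "(nat \<Rightarrow> nat \<times> (nat \<Rightarrow> 'e)) \<Rightarrow> 'e \<Rightarrow> nat" where
  "superpose y x = (\<Sum>i | x \<in> F i. multiplicity_at (y i) x)"

lemma finite_pieces_at: "finite {i. x \<in> F i}"
  using F_locally_finite[of "{x}"] by simp

lemma sets_piece_law [simp, measurable_cong]: "sets (piece_law i) = sets borel"
  by (simp add: piece_law_def sets_m)

lemma piece_rate_nonneg [simp]: "0 \<le> piece_rate i"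
  by (simp add: piece_rate_def c_nonneg)

lemma prob_space_piece_law: "prob_space (piece_law i)"
proof (cases "emeasure m (F i) = 0")
  case True
  then show ?thesis by (simp add: piece_law_def prob_space_return)
next
  case False
  note [measurable_cong] = sets_m
  have "emeasure (piece_law i) (space (piece_law i)) = (\<integral>\<^sup>+x. indicator (F i) x / emeasure m (F i) \<partial>m)"
    unfolding piece_law_def using False
    by (simp, subst emeasure_density) (auto intro!: nn_integral_cong)
  also have "\<dots> = 1"
    using False F_fin[of i] by (simp add: nn_integral_divide sets_m ennreal_divide_self)
  finally show ?thesis by (rule prob_spaceI)
qed

lemma nn_integral_piece_law:
  assumes [measurable]: "h \<in> borel_measurable borel"
  shows "ennreal (piece_rate i) * (\<integral>\<^sup>+x. h x * indicator (F i) x \<partial>piece_law i) =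
    ennreal (c i) * (\<integral>\<^sup>+x. h x * indicator (F i) x \<partial>m)"
proof (cases "emeasure m (F i) = 0")
  case True
  then have "F i \<in> null_sets m" by (auto simp: sets_m)
  then have "(\<integral>\<^sup>+x. h x * indicator (F i) x \<partial>m) = 0"
    by (rule nn_integral_null_set)
  then show ?thesis by (simp add: True piece_rate_def)
next
  case False
  note [measurable_cong] = sets_m
  have "(\<integral>\<^sup>+x. h x * indicator (F i) x \<partial>piece_law i) = (\<integral>\<^sup>+x. (indicator (F i) x / emeasure m (F i)) * (h x * indicator (F i) x) \<partial>m)"
    unfolding piece_law_def using False by (simp add: nn_integral_density)
  also have "\<dots> = (\<integral>\<^sup>+x. (h x * indicator (F i) x) / emeasure m (F i) \<partial>m)"
    by (intro nn_integral_cong) (auto simp: indicator_def divide_ennreal_def mult.commute)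
  also have "\<dots> = (\<integral>\<^sup>+x. h x * indicator (F i) x \<partial>m) / emeasure m (F i)"
    by (intro nn_integral_divide) measurable
  finally have eq: "(\<integral>\<^sup>+x. h x * indicator (F i) x \<partial>piece_law i) = (\<integral>\<^sup>+x. h x * indicator (F i) x \<partial>m) / emeasure m (F i)" .
  have "ennreal (piece_rate i) = ennreal (c i) * emeasure m (F i)"
    using F_fin[of i] c_nonneg[of i] by (simp add: piece_rate_def ennreal_mult)
  then have "ennreal (piece_rate i) * ((\<integral>\<^sup>+x. h x * indicator (F i) x \<partial>m) / emeasure m (F i)) =
      (ennreal (c i) * (\<integral>\<^sup>+x. h x * indicator (F i) x \<partial>m)) * emeasure m (F i) / emeasure m (F i)"
    by (simp add: ennreal_times_divide ac_simps)
  also have "\<dots> = ennreal (c i) * (\<integral>\<^sup>+x. h x * indicator (F i) x \<partial>m)"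
    using False F_fin[of i] by (intro ennreal_mult_divide_eq) auto
  finally show ?thesis
    unfolding eq .
qed

lemma prob_space_piece_process: "prob_space (piece_process i)"
  unfolding piece_process_def by (intro prob_space_compound_poisson prob_space_piece_law) simp

lemma product_prob_space_piece_process: "product_prob_space piece_process"
  unfolding product_prob_space_def product_sigma_finite_def product_prob_space_axioms_def
  by (auto simp: prob_space_piece_process prob_space_imp_sigma_finite)

lemma sets_piece_process [measurable_cong]: "sets (piece_process i) = sets (count_space UNIV \<Otimes>\<^sub>M PiM UNIV (\<lambda>_. borel))"
  unfolding piece_process_def by (rule sets_compound_poisson) simp

lemma superpose_configs: "superpose y \<in> configs"
  unfolding configs_def
proof (intro CollectI allI impI)
  fix C :: "'e set" assume C: "compact C"
  have "{x\<in>C. superpose y x \<noteq> 0} \<subseteq> (\<Union>i\<in>{i. F i \<inter> C \<noteq> {}}. snd (y i) ` {..<fst (y i)})"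
  proof
    fix x assume x: "x \<in> {x\<in>C. superpose y x \<noteq> 0}"
    then have "(\<Sum>i | x \<in> F i. multiplicity_at (y i) x) \<noteq> 0" by (simp add: superpose_def)
    then obtain i where i: "x \<in> F i" "multiplicity_at (y i) x \<noteq> 0"
      by (metis (mono_tags, lifting) mem_Collect_eq sum.neutral)
    then have "{k. k < fst (y i) \<and> snd (y i) k = x} \<noteq> {}"
      unfolding multiplicity_at_def by (metis card.empty)
    with i x show "x \<in> (\<Union>i\<in>{i. F i \<inter> C \<noteq> {}}. snd (y i) ` {..<fst (y i)})"
      by auto
  qed
  moreover have "finite (\<Union>i\<in>{i. F i \<inter> C \<noteq> {}}. snd (y i) ` {..<fst (y i)})"
    using F_locally_finite[OF C] by auto
  ultimately show "finite {x\<in>C. superpose y x \<noteq> 0}"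
    by (rule finite_subset)
qed

lemma superpose_suminf:
  "ennreal (real (superpose y x)) = (\<Sum>i. indicator (F i) x * ennreal (real (multiplicity_at (y i) x)))"
proof -
  have "(\<Sum>i. indicator (F i) x * ennreal (real (multiplicity_at (y i) x))) =
    (\<Sum>i | x \<in> F i. indicator (F i) x * ennreal (real (multiplicity_at (y i) x)))"
    by (rule suminf_finite[OF finite_pieces_at]) auto
  also have "\<dots> = (\<Sum>i | x \<in> F i. ennreal (real (multiplicity_at (y i) x)))"
    by (intro sum.cong) auto
  also have "\<dots> = ennreal (real (superpose y x))"
    by (simp add: superpose_def)
  finally show ?thesis ..
qed

lemma config_count_superpose:
  "config_count (superpose y) B = (\<Sum>i. \<Sum>k<fst (y i). indicator (F i \<inter> B) (snd (y i) k))"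
proof -
  have "config_count (superpose y) B =
    (\<integral>\<^sup>+x. (\<Sum>i. indicator (F i \<inter> B) x * ennreal (real (multiplicity_at (y i) x))) \<partial>count_space UNIV)"
    unfolding config_count_def superpose_suminf
    by (intro nn_integral_cong) (simp add: indicator_inter_arith flip: ennreal_suminf_multc; simp add: ac_simps)
  also have "\<dots> = (\<Sum>i. \<integral>\<^sup>+x. indicator (F i \<inter> B) x * ennreal (real (multiplicity_at (y i) x)) \<partial>count_space UNIV)"
    by (rule nn_integral_suminf) simp
  finally show ?thesis
    by (simp add: nn_integral_multiplicity_at)
qed

lemma superpose_measurable [measurable]: "superpose \<in> PiM UNIV piece_process \<rightarrow>\<^sub>M config_space"
proof (rule measurable_config_spaceI)
  fix B :: "'e set" assume [measurable]: "B \<in> sets borel"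
  have "(\<lambda>(n, z). (\<Sum>k<n. indicator (F i \<inter> B) (z k)) :: ennreal) \<in> borel_measurable (piece_process i)" for i
    using measurable_point_sum[of "indicator (F i \<inter> B)" borel] by (simp cong: measurable_cong_sets[OF sets_piece_process refl])
  then have [measurable]: "(\<lambda>y. (\<Sum>k<fst y. indicator (F i \<inter> B) (snd y k)) :: ennreal) \<in> borel_measurable (piece_process i)" for i
    by (simp add: case_prod_beta')
  have [measurable]: "(\<lambda>y. (\<Sum>k<fst (y i). indicator (F i \<inter> B) (snd (y i) k)) :: ennreal) \<in> borel_measurable (PiM UNIV piece_process)" for i
    by (rule measurable_compose[OF measurable_component_singleton]) auto
  show "(\<lambda>y. config_count (superpose y) B) \<in> borel_measurable (PiM UNIV piece_process)"
    unfolding config_count_superpose by measurable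
qed (rule superpose_configs)

text \<open>As \<open>H\<close> is 1 off \<open>C\<close>, only the finitely many pieces meeting
  \<open>C\<close> matter, and the functional factorises over pieces.\<close>

lemma point_functional_superpose:
  assumes C: "compact C" and H_out: "\<And>x. x \<notin> C \<Longrightarrow> H x = 1"
  shows "point_functional C H (superpose y) =
    (\<Prod>i\<in>{i. F i \<inter> C \<noteq> {}}. \<Prod>k<fst (y i). if snd (y i) k \<in> F i then H (snd (y i) k) else 1)"
proof -
  let ?I = "{i. F i \<inter> C \<noteq> {}}"
  define X where "X = (\<Union>i\<in>?I. snd (y i) ` {..<fst (y i)}) \<union> {x\<in>C. superpose y x \<noteq> 0}"
  have fin_C: "finite {x\<in>C. superpose y x \<noteq> 0}"
    by (rule configs_finite_subset[OF superpose_configs C order_refl])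
  have X: "finite X"
    using F_locally_finite[OF C] fin_C by (auto simp: X_def)
  have "point_functional C H (superpose y) = (\<Prod>x\<in>X. H x ^ superpose y x)"
    unfolding point_functional_def
  proof (rule prod.mono_neutral_left[OF X])
    show "\<forall>x\<in>X - {x\<in>C. superpose y x \<noteq> 0}. H x ^ superpose y x = 1"
    proof
      fix x assume "x \<in> X - {x\<in>C. superpose y x \<noteq> 0}"
      then have "x \<notin> C \<or> superpose y x = 0" by simp
      then show "H x ^ superpose y x = 1" using H_out by auto
    qed
  qed (simp add: X_def)
  also have "\<dots> = (\<Prod>x\<in>X. \<Prod>i\<in>?I. (if x \<in> F i then H x else 1) ^ multiplicity_at (y i) x)"
  proof (rule prod.cong[OF refl])
    fix x assume "x \<in> X"
    show "H x ^ superpose y x = (\<Prod>i\<in>?I. (if x \<in> F i then H x else 1) ^ multiplicity_at (y i) x)"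
    proof (cases "x \<in> C")
      case True
      have "H x ^ superpose y x = (\<Prod>i | x \<in> F i. (if x \<in> F i then H x else 1) ^ multiplicity_at (y i) x)"
        by (simp add: superpose_def power_sum)
      also have "\<dots> = (\<Prod>i\<in>?I. (if x \<in> F i then H x else 1) ^ multiplicity_at (y i) x)"
        using True F_locally_finite[OF C] by (intro prod.mono_neutral_left) auto
      finally show ?thesis .
    next
      case False
      then have "H x = 1" by (rule H_out)
      then have "(if x \<in> F i then H x else 1) = 1" for i by simp
      then show ?thesis by (simp only: \<open>H x = 1\<close> power_one prod.neutral_const)
    qed
  qed
  also have "\<dots> = (\<Prod>i\<in>?I. \<Prod>x\<in>X. (if x \<in> F i then H x else 1) ^ multiplicity_at (y i) x)"
    by (rule prod.swap)
  also have "\<dots> = (\<Prod>i\<in>?I. \<Prod>k<fst (y i). if snd (y i) k \<in> F i then H (snd (y i) k) else 1)"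
    using X by (intro prod.cong refl prod_multiplicity_at[symmetric]) (auto simp: X_def)
  finally show ?thesis .
qed

text \<open>The same value as in \<open>poisson_point_functional\<close>: piece \<open>i\<close>
  contributes \<open>exp (- L i)\<close>, and since the weights \<open>c\<close> add up to 1 at
  every point of \<open>C\<close>, the \<open>L i\<close> add up to the integral of
  \<open>1 - H\<close>.\<close>

lemma superpose_point_functional:
  fixes H :: "'e \<Rightarrow> ennreal"
  assumes C: "compact C" "C \<subseteq> U" and H[measurable]: "H \<in> borel_measurable borel"
    and H_le: "\<And>x. H x \<le> 1" and H_out: "\<And>x. x \<notin> C \<Longrightarrow> H x = 1"
  shows "(\<integral>\<^sup>+y. point_functional C H (superpose y) \<partial>PiM UNIV piece_process) =
    ennreal (exp (- enn2real (\<integral>\<^sup>+x. 1 - H x \<partial>m)))"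
proof -
  note [measurable_cong] = sets_m
  let ?I = "{i. F i \<inter> C \<noteq> {}}"
  have I: "finite ?I" by (rule F_locally_finite[OF C(1)])
  define L where "L i = enn2real (ennreal (c i) * (\<integral>\<^sup>+x. (1 - H x) * indicator (F i) x \<partial>m))" for i
  have L_fin: "(\<integral>\<^sup>+x. (1 - H x) * indicator (F i) x \<partial>m) < \<infinity>" for i
  proof -
    have "(\<integral>\<^sup>+x. (1 - H x) * indicator (F i) x \<partial>m) \<le> (\<integral>\<^sup>+x. indicator (F i) x \<partial>m)"
      by (intro nn_integral_mono) (auto simp: indicator_def)
    also have "\<dots> = emeasure m (F i)" by (simp add: sets_m)
    finally show ?thesis using F_fin[of i] by (rule le_less_trans)
  qed
  then have L_eq: "ennreal (L i) = ennreal (c i) * (\<integral>\<^sup>+x. (1 - H x) * indicator (F i) x \<partial>m)" for i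
    unfolding L_def by (intro ennreal_enn2real) (auto simp: ennreal_mult_less_top)
  have factor: "(\<integral>\<^sup>+y. (\<Prod>k<fst y. if snd y k \<in> F i then H (snd y k) else 1) \<partial>piece_process i) = ennreal (exp (- L i))" for i
  proof -
    interpret p: prob_space "piece_law i" by (rule prob_space_piece_law)
    let ?H = "\<lambda>x. if x \<in> F i then H x else 1"
    have [measurable]: "?H \<in> borel_measurable borel" by measurable
    have "(\<integral>\<^sup>+x. ?H x \<partial>piece_law i) \<le> (\<integral>\<^sup>+x. 1 \<partial>piece_law i)"
      using H_le by (intro nn_integral_mono) auto
    then have "(\<integral>\<^sup>+x. ?H x \<partial>piece_law i) \<le> 1" by (simp add: p.emeasure_space_1)
    then obtain h where h: "(\<integral>\<^sup>+x. ?H x \<partial>piece_law i) = ennreal h" "0 \<le> h" "h \<le> 1"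
      by (cases "\<integral>\<^sup>+x. ?H x \<partial>piece_law i" rule: ennreal_cases) (auto simp: top_unique)
    have "(\<integral>\<^sup>+x. (1 - H x) * indicator (F i) x \<partial>piece_law i) + (\<integral>\<^sup>+x. ?H x \<partial>piece_law i) = (\<integral>\<^sup>+x. 1 \<partial>piece_law i)"
    proof (subst nn_integral_add[symmetric])
      show "(\<integral>\<^sup>+x. (1 - H x) * indicator (F i) x + ?H x \<partial>piece_law i) = (\<integral>\<^sup>+x. 1 \<partial>piece_law i)"
        using H_le by (intro nn_integral_cong) (simp add: indicator_def diff_add_cancel_ennreal)
    qed measurable
    then have "(\<integral>\<^sup>+x. (1 - H x) * indicator (F i) x \<partial>piece_law i) + ennreal h = ennreal (1 - h) + ennreal h"
      using h by (simp add: p.emeasure_space_1 flip: ennreal_plus)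
    then have "(\<integral>\<^sup>+x. (1 - H x) * indicator (F i) x \<partial>piece_law i) = ennreal (1 - h)"
      by (simp add: add.commute[of _ "ennreal h"] ennreal_add_left_cancel)
    then have "ennreal (L i) = ennreal (piece_rate i * (1 - h))"
      unfolding L_eq using nn_integral_piece_law[of "\<lambda>x. 1 - H x" i] h
      by (simp add: ennreal_mult)
    then have L: "L i = piece_rate i * (1 - h)"
      using h by (subst (asm) ennreal_inj) (auto simp: L_def)
    have "(\<integral>\<^sup>+y. (\<Prod>k<fst y. ?H (snd y k)) \<partial>piece_process i) = ennreal (exp (piece_rate i * (h - 1)))"
      using compound_poisson_functional[OF piece_rate_nonneg prob_space_piece_law _ h(1,2), of i]
      by (simp add: piece_process_def case_prod_beta' cong: measurable_cong_sets)
    then show ?thesis by (simp add: L algebra_simps)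
  qed
  have "(\<integral>\<^sup>+y. point_functional C H (superpose y) \<partial>PiM UNIV piece_process) =
    (\<integral>\<^sup>+y. (\<Prod>i\<in>?I. (\<lambda>y. \<Prod>k<fst y. if snd y k \<in> F i then H (snd y k) else 1) (y i)) \<partial>PiM UNIV piece_process)"
    by (intro nn_integral_cong point_functional_superpose[OF C(1)] H_out)
  also have "\<dots> = (\<Prod>i\<in>?I. \<integral>\<^sup>+y. (\<Prod>k<fst y. if snd y k \<in> F i then H (snd y k) else 1) \<partial>piece_process i)"
  proof (rule product_prob_space.nn_integral_PiM_prod[OF product_prob_space_piece_process I])
    fix i
    show "(\<lambda>y. \<Prod>k<fst y. if snd y k \<in> F i then H (snd y k) else 1) \<in> borel_measurable (piece_process i)"
      using measurable_point_prod[of "\<lambda>x. if x \<in> F i then H x else 1" borel]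
      by (simp add: case_prod_beta' cong: measurable_cong_sets[OF sets_piece_process refl])
  qed simp
  also have "\<dots> = ennreal (exp (- (\<Sum>i\<in>?I. L i)))"
    by (simp add: factor prod_ennreal exp_sum[symmetric] I sum_negf)
  also have "(\<Sum>i\<in>?I. L i) = enn2real (\<integral>\<^sup>+x. 1 - H x \<partial>m)"
  proof -
    have "1 - H x = (\<Sum>i\<in>?I. ennreal (c i) * ((1 - H x) * indicator (F i) x))" for x
    proof (cases "x \<in> C")
      case True
      have "(\<Sum>i\<in>?I. ennreal (c i) * ((1 - H x) * indicator (F i) x)) = (\<Sum>i | x \<in> F i. ennreal (c i) * (1 - H x))"
        using True I by (intro sum.mono_neutral_cong_right) auto
      also have "\<dots> = (\<Sum>i | x \<in> F i. ennreal (c i)) * (1 - H x)"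
        by (simp add: sum_distrib_right)
      also have "(\<Sum>i | x \<in> F i. ennreal (c i)) = 1"
        using weights[of x] True C(2) c_nonneg by (simp add: sum_ennreal subset_iff)
      finally show ?thesis by simp
    qed (simp add: H_out)
    then have "(\<integral>\<^sup>+x. 1 - H x \<partial>m) = (\<integral>\<^sup>+x. (\<Sum>i\<in>?I. ennreal (c i) * ((1 - H x) * indicator (F i) x)) \<partial>m)"
      by simp
    also have "\<dots> = (\<Sum>i\<in>?I. ennreal (L i))"
      by (simp add: nn_integral_sum nn_integral_cmult L_eq)
    also have "\<dots> = ennreal (\<Sum>i\<in>?I. L i)"
      by (rule sum_ennreal) (simp add: L_def)
    finally show ?thesis
      by (simp add: sum_nonneg L_def)
  qed
  finally show ?thesis .
qed

text \<open>Almost surely neither law has points outside \<open>U\<close>, and the generating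
  functionals on each \<open>K J\<close> coincide; hence so do all joint counts of subsets of
  \<open>K J\<close>.\<close>

lemma distr_superpose:
  assumes P: "poisson_measure m P" and K: "\<And>n::nat. compact (K n)" "incseq K" "U = (\<Union>n. K n)"
    and K_fin: "\<And>n. emeasure m (K n) < \<infinity>" and null: "emeasure m (- U) = 0"
  shows "distr (PiM UNIV piece_process) config_space superpose = P"
proof -
  interpret PP: prob_space "PiM UNIV piece_process"
    by (intro prob_space_PiM prob_space_piece_process)
  let ?D = "distr (PiM UNIV piece_process) config_space superpose"
  interpret D: prob_space ?D
    by (rule PP.prob_space_distr) measurable
  interpret P: prob_space P
    using P by (simp add: poisson_measure_def)
  have sets_P: "sets P = sets config_space"
    using P by (simp add: poisson_measure_def)
  then have space_P: "space P = configs"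
    using sets_eq_imp_space_eq[OF sets_P] by simp
  note [measurable_cong] = sets_P
  have U[measurable]: "U \<in> sets borel"
    unfolding K(3) using K(1) by (intro sets.countable_UN) (auto intro!: borel_compact)
  have U'[measurable]: "- U \<in> sets borel"
    using U by (simp add: Compl_eq_Diff_UNIV)
  have "{\<omega>\<in>space config_space. config_count \<omega> (- U) = 0} \<in> sets config_space"
    by measurable
  then have no_points: "{\<omega>\<in>configs. config_count \<omega> (- U) = 0} \<in> sets config_space"
    by simp
  show ?thesis
  proof (rule config_law_eqI[OF D.prob_space_axioms _ P.prob_space_axioms sets_P K(1,2)])
    have "config_count (superpose y) (- U) = 0" for y
    proof -
      have "F i \<inter> - U = {}" for i using F_U[of i] by blast
      then show ?thesis by (simp add: config_count_superpose)
    qed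
    then show "AE \<omega> in ?D. config_count \<omega> (- (\<Union>n. K n)) = 0"
      unfolding K(3)[symmetric] by (subst AE_distr_iff) (use no_points in auto)
    from P have "\<forall>B\<in>sets borel. emeasure m B < \<infinity> \<longrightarrow>
        (\<forall>n::nat. measure P {\<omega>\<in>space P. config_count \<omega> B = of_nat n}
            = exp (- enn2real (emeasure m B)) * enn2real (emeasure m B) ^ n / fact n)"
      unfolding poisson_measure_def by blast
    \<comment> \<open>The Poisson formula with mean 0, where \<open>0 ^ 0 = 1\<close>.\<close>
    from this[rule_format, OF U', of 0] null have "P.prob {\<omega>\<in>space P. config_count \<omega> (- U) = 0} = 1" by simp
    then show "AE \<omega> in P. config_count \<omega> (- (\<Union>n. K n)) = 0"
      unfolding K(3)[symmetric] by (subst (asm) P.prob_Collect_eq_1) auto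
  next
    fix k :: nat and B :: "nat \<Rightarrow> 'e set" and n J
    assume B: "\<And>i. i < k \<Longrightarrow> B i \<in> sets borel" "\<And>i. i < k \<Longrightarrow> B i \<subseteq> K J"
    have pc: "(\<lambda>\<omega>. point_count \<omega> (B i)) \<in> config_space \<rightarrow>\<^sub>M count_space UNIV" if "i \<in> {..<k}" for i
    proof -
      have [measurable]: "B i \<in> sets borel" using that B(1) by simp
      have "(\<lambda>\<omega>. point_count \<omega> (B i)) \<in> config_space \<rightarrow>\<^sub>M count_space UNIV \<longleftrightarrow>
        (\<lambda>\<omega>. ennreal_to_nat (config_count \<omega> (B i))) \<in> config_space \<rightarrow>\<^sub>M count_space UNIV"
        using that B by (intro measurable_cong) (simp add: config_count_compact[OF _ K(1)[of J]])
      also have \<dots> by measurable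
      finally show ?thesis .
    qed
    have emeasure_eq: "emeasure \<nu> {\<omega>\<in>configs. \<forall>i<k. point_count \<omega> (B i) = n i} =
      (\<integral>\<^sup>+\<omega>. 1 * (\<Prod>i\<in>{..<k}. indicator {\<omega>. point_count \<omega> (B i) = n i} \<omega>) \<partial>\<nu>)"
      if \<nu>: "sets \<nu> = sets config_space" for \<nu>
    proof -
      have space: "space \<nu> = configs" using sets_eq_imp_space_eq[OF \<nu>] by simp
      have "{\<omega>\<in>configs. \<forall>i<k. point_count \<omega> (B i) = n i} =
        {\<omega>\<in>space config_space. \<forall>i\<in>{..<k}. \<omega> \<in> {\<omega>\<in>space config_space. point_count \<omega> (B i) = n i}}"
        by auto
      also have "\<dots> \<in> sets config_space"
      proof (intro sets.sets_Collect_finite_All)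
        fix i assume "i \<in> {..<k}"
        from measurable_sets[OF pc[OF this], of "{n i}"]
        show "{\<omega>\<in>space config_space. \<omega> \<in> {\<omega>\<in>space config_space. point_count \<omega> (B i) = n i}} \<in> sets config_space"
          by (simp add: vimage_def Int_def conj_commute)
      qed simp
      finally have event: "{\<omega>\<in>configs. \<forall>i<k. point_count \<omega> (B i) = n i} \<in> sets \<nu>"
        by (simp only: \<nu>)
      have "emeasure \<nu> {\<omega>\<in>configs. \<forall>i<k. point_count \<omega> (B i) = n i} =
        (\<integral>\<^sup>+\<omega>. indicator {\<omega>\<in>configs. \<forall>i<k. point_count \<omega> (B i) = n i} \<omega> \<partial>\<nu>)"
        by (rule nn_integral_indicator[OF event, symmetric])
      also have "\<dots> = (\<integral>\<^sup>+\<omega>. 1 * (\<Prod>i\<in>{..<k}. indicator {\<omega>. point_count \<omega> (B i) = n i} \<omega>) \<partial>\<nu>)"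
        by (intro nn_integral_cong) (auto simp: space indicator_def)
      finally show ?thesis .
    qed
    have "(\<integral>\<^sup>+\<omega>. 1 * (\<Prod>i\<in>{..<k}. indicator {\<omega>. point_count \<omega> (B i) = n i} \<omega>) \<partial>?D) =
      (\<integral>\<^sup>+\<omega>. 1 * (\<Prod>i\<in>{..<k}. indicator {\<omega>. point_count \<omega> (B i) = n i} \<omega>) \<partial>P)"
    proof (rule generating_function_determines_joint_law)
      show "finite_measure ?D" "finite_measure P" by unfold_locales
      show "(\<lambda>\<omega>. point_count \<omega> (B i)) \<in> ?D \<rightarrow>\<^sub>M count_space UNIV"
        "(\<lambda>\<omega>. point_count \<omega> (B i)) \<in> P \<rightarrow>\<^sub>M count_space UNIV" if "i \<in> {..<k}" for i
        using pc[OF that] by (simp_all cong: measurable_cong_sets add: sets_P)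
      fix s :: "nat \<Rightarrow> real" assume s: "\<And>t. 0 < s t \<and> s t < 1"
      define H where "H x = (\<Prod>i\<in>{..<k}. if x \<in> B i then ennreal (s i) else 1)" for x
      have H_meas[measurable]: "H \<in> borel_measurable borel"
        unfolding H_def[abs_def] using B(1) by (intro borel_measurable_prod_ennreal measurable_If) auto
      have H_le: "H x \<le> 1" for x
        unfolding H_def using s by (intro prod_le_1) (auto simp: ennreal_le_1 less_imp_le)
      have H_out: "H x = 1" if "x \<notin> K J" for x
        unfolding H_def using B(2) that by (intro prod.neutral) auto
      have H_fin: "finite (range H)"
      proof -
        have "H x = (\<Prod>i\<in>{i\<in>{..<k}. x \<in> B i}. ennreal (s i))" for x
          unfolding H_def by (rule prod.inter_filter[symmetric]) simp
        then have "range H \<subseteq> (\<lambda>T. \<Prod>i\<in>T. ennreal (s i)) ` Pow {..<k}" by auto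
        then show ?thesis by (rule finite_subset) simp
      qed
      have eq: "(\<Prod>i\<in>{..<k}. ennreal (s i) ^ point_count \<omega> (B i)) = point_functional (K J) H \<omega>" if "\<omega> \<in> configs" for \<omega>
        unfolding H_def[abs_def]
        by (rule point_functional_prod[OF configs_finite_subset[OF that K(1) order_refl]]) (use B(2) in auto)
      have KU: "K J \<subseteq> U" unfolding K(3) by blast
      have "(\<integral>\<^sup>+\<omega>. 1 * (\<Prod>i\<in>{..<k}. ennreal (s i) ^ point_count \<omega> (B i)) \<partial>?D) =
        (\<integral>\<^sup>+y. (\<Prod>i\<in>{..<k}. ennreal (s i) ^ point_count (superpose y) (B i)) \<partial>PiM UNIV piece_process)"
        using pc by (subst nn_integral_distr)
          (auto intro!: borel_measurable_prod_ennreal measurable_compose[where N = "count_space UNIV" and g = "\<lambda>n. ennreal (s i) ^ n" for i])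
      also have "\<dots> = (\<integral>\<^sup>+y. point_functional (K J) H (superpose y) \<partial>PiM UNIV piece_process)"
        by (intro nn_integral_cong eq superpose_configs)
      also have "\<dots> = ennreal (exp (- enn2real (\<integral>\<^sup>+x. 1 - H x \<partial>m)))"
        by (rule superpose_point_functional[OF K(1) KU H_meas H_le H_out])
      also have "\<dots> = (\<integral>\<^sup>+\<omega>. point_functional (K J) H \<omega> \<partial>P)"
        by (rule poisson_point_functional[OF P K(1) K_fin sets_m H_meas H_fin H_le H_out, symmetric])
      also have "\<dots> = (\<integral>\<^sup>+\<omega>. 1 * (\<Prod>i\<in>{..<k}. ennreal (s i) ^ point_count \<omega> (B i)) \<partial>P)"
        by (intro nn_integral_cong) (simp add: eq space_P)
      finally show "(\<integral>\<^sup>+\<omega>. 1 * (\<Prod>i\<in>{..<k}. ennreal (s i) ^ point_count \<omega> (B i)) \<partial>?D) =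
        (\<integral>\<^sup>+\<omega>. 1 * (\<Prod>i\<in>{..<k}. ennreal (s i) ^ point_count \<omega> (B i)) \<partial>P)" .
    qed auto
    then show "emeasure ?D {\<omega>\<in>configs. \<forall>i<k. point_count \<omega> (B i) = n i} =
      emeasure P {\<omega>\<in>configs. \<forall>i<k. point_count \<omega> (B i) = n i}"
      by (simp only: emeasure_eq[OF sets_distr] emeasure_eq[OF sets_P])
  qed simp
qed

text \<open>Triangle inequality over the pieces: equal pieces cancel, and unequal ones are charged
  the mass of both.\<close>

lemma d_phi_superpose:
  assumes \<phi>: "\<And>x. 0 \<le> \<phi> x"
  shows "d_phi \<phi> (superpose y) (superpose y') \<le>
    (\<Sum>i. if y i = y' i then 0
      else ennreal (\<Sum>k<fst (y i). \<phi> (snd (y i) k)) + ennreal (\<Sum>k<fst (y' i). \<phi> (snd (y' i) k)))"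
proof -
  let ?m = "\<lambda>y i x. ennreal (\<phi> x) * ennreal (real (multiplicity_at (y i) x))"
  have "ennreal (\<phi> x * \<bar>real (superpose y x) - real (superpose y' x)\<bar>) \<le>
    (\<Sum>i. if y i = y' i then 0 else ?m y i x + ?m y' i x)" for x
  proof -
    let ?I = "{i. x \<in> F i}"
    have "\<bar>real (superpose y x) - real (superpose y' x)\<bar> =
      \<bar>\<Sum>i\<in>?I. real (multiplicity_at (y i) x) - real (multiplicity_at (y' i) x)\<bar>"
      by (simp add: superpose_def sum_subtractf)
    also have "\<dots> \<le> (\<Sum>i\<in>?I. \<bar>real (multiplicity_at (y i) x) - real (multiplicity_at (y' i) x)\<bar>)"
      by (rule sum_abs)
    also have "\<dots> \<le> (\<Sum>i\<in>?I. if y i = y' i then 0 else real (multiplicity_at (y i) x) + real (multiplicity_at (y' i) x))"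
      by (intro sum_mono) auto
    finally have "\<phi> x * \<bar>real (superpose y x) - real (superpose y' x)\<bar> \<le>
      (\<Sum>i\<in>?I. \<phi> x * (if y i = y' i then 0 else real (multiplicity_at (y i) x) + real (multiplicity_at (y' i) x)))"
      using \<phi> by (simp add: sum_distrib_left[symmetric] mult_left_mono)
    then have "ennreal (\<phi> x * \<bar>real (superpose y x) - real (superpose y' x)\<bar>) \<le>
      ennreal (\<Sum>i\<in>?I. \<phi> x * (if y i = y' i then 0 else real (multiplicity_at (y i) x) + real (multiplicity_at (y' i) x)))"
      by (rule ennreal_leI)
    also have "\<dots> = (\<Sum>i\<in>?I. ennreal (\<phi> x * (if y i = y' i then 0 else real (multiplicity_at (y i) x) + real (multiplicity_at (y' i) x))))"
      using \<phi> by (intro sum_ennreal[symmetric] mult_nonneg_nonneg) auto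
    also have "\<dots> = (\<Sum>i\<in>?I. if y i = y' i then 0 else ?m y i x + ?m y' i x)"
      using \<phi> by (intro sum.cong refl) (auto simp: ennreal_mult distrib_left ennreal_plus)
    also have "\<dots> \<le> (\<Sum>i. if y i = y' i then 0 else ?m y i x + ?m y' i x)"
      by (intro sum_le_suminf finite_pieces_at) auto
    finally show ?thesis .
  qed
  then have "d_phi \<phi> (superpose y) (superpose y') \<le>
    (\<integral>\<^sup>+x. (\<Sum>i. if y i = y' i then 0 else ?m y i x + ?m y' i x) \<partial>count_space UNIV)"
    unfolding d_phi_def by (intro nn_integral_mono)
  also have "\<dots> = (\<Sum>i. \<integral>\<^sup>+x. (if y i = y' i then 0 else ?m y i x + ?m y' i x) \<partial>count_space UNIV)"
    by (rule nn_integral_suminf) simp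
  also have "\<dots> = (\<Sum>i. if y i = y' i then 0
      else ennreal (\<Sum>k<fst (y i). \<phi> (snd (y i) k)) + ennreal (\<Sum>k<fst (y' i). \<phi> (snd (y' i) k)))"
    using \<phi> by (intro suminf_cong) (auto simp: nn_integral_add nn_integral_multiplicity_at)
  finally show ?thesis .
qed

end

text \<open>The transport cost need not be jointly measurable on a non-separable space; the integral
  of a non-measurable \<open>f\<close> is its lower integral.\<close>

lemma nn_integral_distr_le:
  assumes T: "T \<in> M \<rightarrow>\<^sub>M N" and le: "\<And>x. x \<in> space M \<Longrightarrow> f (T x) \<le> h x"
  shows "(\<integral>\<^sup>+y. f y \<partial>distr M N T) \<le> (\<integral>\<^sup>+x. h x \<partial>M)"
  unfolding nn_integral_def[of "distr M N T"]
proof (rule SUP_least)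
  fix g assume "g \<in> {g. simple_function (distr M N T) g \<and> g \<le> f}"
  then have g: "simple_function (distr M N T) g" "\<And>y. g y \<le> f y" by (auto simp: le_fun_def)
  then have [measurable]: "g \<in> borel_measurable N"
    using borel_measurable_simple_function[OF g(1)] by simp
  have "integral\<^sup>S (distr M N T) g = (\<integral>\<^sup>+y. g y \<partial>distr M N T)"
    by (rule nn_integral_eq_simple_integral[OF g(1), symmetric])
  also have "\<dots> = (\<integral>\<^sup>+x. g (T x) \<partial>M)"
    using T by (intro nn_integral_distr) auto
  also have "\<dots> \<le> (\<integral>\<^sup>+x. h x \<partial>M)"
    using g(2) le by (intro nn_integral_mono) (auto intro: order_trans)
  finally show "integral\<^sup>S (distr M N T) g \<le> (\<integral>\<^sup>+x. h x \<partial>M)" .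
qed

context intensity_pieces
begin

lemma nn_integral_piece_law_full:
  assumes [measurable]: "h \<in> borel_measurable borel"
  shows "ennreal (piece_rate i) * (\<integral>\<^sup>+x. h x \<partial>piece_law i) = ennreal (c i) * (\<integral>\<^sup>+x. h x * indicator (F i) x \<partial>m)"
proof (cases "emeasure m (F i) = 0")
  case True
  then show ?thesis
    using nn_integral_piece_law[of h i] by (simp add: piece_rate_def)
next
  case False
  note [measurable_cong] = sets_m
  have "(\<integral>\<^sup>+x. h x \<partial>piece_law i) = (\<integral>\<^sup>+x. h x * indicator (F i) x \<partial>piece_law i)"
    unfolding piece_law_def using False
    by (simp add: nn_integral_density) (intro nn_integral_cong, auto simp: indicator_def)
  then show ?thesis by (simp add: nn_integral_piece_law)
qed

lemma sum_pieces_le: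
  assumes [measurable]: "h \<in> borel_measurable borel"
  shows "(\<Sum>i. ennreal (c i) * (\<integral>\<^sup>+x. h x * indicator (F i) x \<partial>m)) \<le> (\<integral>\<^sup>+x. h x \<partial>m)"
proof -
  note [measurable_cong] = sets_m
  have "(\<Sum>i. ennreal (c i) * (\<integral>\<^sup>+x. h x * indicator (F i) x \<partial>m)) =
    (\<integral>\<^sup>+x. (\<Sum>i. ennreal (c i) * (h x * indicator (F i) x)) \<partial>m)"
    by (simp add: nn_integral_suminf nn_integral_cmult)
  also have "\<dots> \<le> (\<integral>\<^sup>+x. h x \<partial>m)"
  proof (rule nn_integral_mono)
    fix x
    have "(\<Sum>i. ennreal (c i) * (h x * indicator (F i) x)) = (\<Sum>i | x \<in> F i. ennreal (c i) * (h x * indicator (F i) x))"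
      by (rule suminf_finite[OF finite_pieces_at]) auto
    also have "\<dots> = (\<Sum>i | x \<in> F i. ennreal (c i)) * h x"
      unfolding sum_distrib_right by (intro sum.cong) auto
    also have "(\<Sum>i | x \<in> F i. ennreal (c i)) = ennreal (\<Sum>i | x \<in> F i. c i)"
      by (rule sum_ennreal) (rule c_nonneg)
    also have "ennreal (\<Sum>i | x \<in> F i. c i) * h x \<le> h x"
    proof (cases "x \<in> U")
      case True
      then show ?thesis by (simp add: weights)
    next
      case False
      then have "{i. x \<in> F i} = {}" using F_U by blast
      then show ?thesis by simp
    qed
    finally show "(\<Sum>i. ennreal (c i) * (h x * indicator (F i) x)) \<le> h x" .
  qed
  finally show ?thesis .
qed

text \<open>The coupling is the image of \<open>joint_law\<close> when both the sample and its
  target are superposed. The marginals are then the images of the lifted density and of the product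
  law, which are \<open>density P f\<close> and \<open>P\<close>.\<close>

lemma W1_bound_pieces:
  fixes \<phi> :: "'e \<Rightarrow> real" and f :: "('e \<Rightarrow> nat) \<Rightarrow> ennreal"
  assumes P: "distr (PiM UNIV piece_process) config_space superpose = P"
    and f[measurable]: "f \<in> borel_measurable config_space" and f_int: "(\<integral>\<^sup>+\<omega>. f \<omega> \<partial>P) = 1"
    and \<phi>[measurable]: "\<phi> \<in> borel_measurable borel" and \<phi>_nonneg: "\<And>x. 0 \<le> \<phi> x" and \<phi>_le: "\<And>x. \<phi> x \<le> M"
    and \<theta>: "0 \<le> \<theta>" and small: "\<And>i. piece_rate i * (exp (\<theta> * M) - 1) \<le> 1"
  shows "ennreal \<theta> * W1 config_space (d_phi \<phi>) (density P f) P \<le>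
    (\<integral>\<^sup>+\<omega>. ennreal (entropy_fun (enn2real (f \<omega>))) \<partial>P) + (\<integral>\<^sup>+x. ennreal (exp_excess (\<theta> * \<phi> x)) \<partial>m)
    + (\<Sum>i. ennreal ((piece_rate i * (exp (\<theta> * M) - 1))\<^sup>2))"
proof -
  let ?PP = "PiM UNIV piece_process"
  interpret PP: product_prob_space piece_process UNIV
    by (rule product_prob_space_piece_process)
  \<comment> \<open>A density composed with \<open>superpose\<close> has the right image law and the
    same entropy as \<open>f\<close>, so nothing is lost by lifting.\<close>
  interpret S: sequence_density piece_process "\<lambda>y. f (superpose y)"
  proof unfold_locales
    show "(\<lambda>y. f (superpose y)) \<in> borel_measurable ?PP" by measurable
    have "(\<integral>\<^sup>+y. f (superpose y) \<partial>?PP) = (\<integral>\<^sup>+\<omega>. f \<omega> \<partial>P)"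
      unfolding P[symmetric] by (subst nn_integral_distr) auto
    then show "(\<integral>\<^sup>+y. f (superpose y) \<partial>?PP) = 1" by (simp add: f_int)
  qed
  define D where "D i y = (\<Sum>k<fst y. \<phi> (snd y k))" for i :: nat and y :: "nat \<times> (nat \<Rightarrow> 'e)"
  have D_meas: "D i \<in> borel_measurable (piece_process i)" for i
    using measurable_point_sum[of \<phi> borel] unfolding D_def[abs_def]
    by (simp add: case_prod_beta' cong: measurable_cong_sets[OF sets_piece_process refl])
  have D_nonneg: "0 \<le> D i y" for i y
    unfolding D_def using \<phi>_nonneg by (intro sum_nonneg)
  define T where "T y = (superpose (fst y), superpose (S.target y))" for y
  have T: "T \<in> S.joint_law \<rightarrow>\<^sub>M config_space \<Otimes>\<^sub>M config_space"
    unfolding T_def[abs_def] by measurable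
  define \<pi> where "\<pi> = distr S.joint_law (config_space \<Otimes>\<^sub>M config_space) T"
  interpret J: prob_space S.joint_law by (rule S.prob_space_joint_law)
  have "\<pi> \<in> couplings config_space (density P f) P"
    unfolding couplings_def
  proof (intro CollectI conjI)
    show "prob_space \<pi>" unfolding \<pi>_def by (rule J.prob_space_distr[OF T])
    show "sets \<pi> = sets (config_space \<Otimes>\<^sub>M config_space)" by (simp add: \<pi>_def)
    have "distr \<pi> config_space fst = distr S.joint_law config_space (\<lambda>y. superpose (fst y))"
      unfolding \<pi>_def by (subst distr_distr[OF _ T]) (auto simp: comp_def T_def)
    also have "\<dots> = distr (distr S.joint_law ?PP fst) config_space superpose"
      by (subst distr_distr) (auto simp: comp_def)
    also have "\<dots> = distr (density ?PP (\<lambda>y. f (superpose y))) config_space superpose"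
      by (simp add: S.distr_joint_law_fst)
    also have "\<dots> = density P f"
      unfolding P[symmetric] by (rule density_distr[symmetric]) auto
    finally show "distr \<pi> config_space fst = density P f" .
    have "distr \<pi> config_space snd = distr S.joint_law config_space (\<lambda>y. superpose (S.target y))"
      unfolding \<pi>_def by (subst distr_distr[OF _ T]) (auto simp: comp_def T_def)
    also have "\<dots> = distr (distr S.joint_law ?PP S.target) config_space superpose"
      by (subst distr_distr) (auto simp: comp_def)
    also have "\<dots> = P"
      by (simp add: S.distr_joint_law_target P)
    finally show "distr \<pi> config_space snd = P" .
  qed
  then have "W1 config_space (d_phi \<phi>) (density P f) P \<le> (\<integral>\<^sup>+p. d_phi \<phi> (fst p) (snd p) \<partial>\<pi>)"
    unfolding W1_def by (rule INF_lower)
  also have "\<dots> \<le> (\<integral>\<^sup>+y. (\<Sum>i. S.mismatch_cost D i y) \<partial>S.joint_law)"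
    unfolding \<pi>_def
  proof (rule nn_integral_distr_le[OF T])
    fix y
    have "d_phi \<phi> (fst (T y)) (snd (T y)) \<le>
      (\<Sum>i. if fst y i = S.target y i then 0 else ennreal (D i (fst y i)) + ennreal (D i (S.target y i)))"
      unfolding T_def D_def fst_conv snd_conv by (rule d_phi_superpose[OF \<phi>_nonneg])
    \<comment> \<open>Pieces can differ only where the flag is \<open>False\<close>, and there the
      target is the spare piece.\<close>
    also have "\<dots> \<le> (\<Sum>i. S.mismatch_cost D i y)"
      unfolding S.mismatch_cost_def[OF D_meas D_nonneg \<theta>] S.target_def by (intro suminf_le) auto
    finally show "d_phi \<phi> (fst (T y)) (snd (T y)) \<le> (\<Sum>i. S.mismatch_cost D i y)" .
  qed
  finally have "ennreal \<theta> * W1 config_space (d_phi \<phi>) (density P f) P \<le>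
      ennreal \<theta> * (\<integral>\<^sup>+y. (\<Sum>i. S.mismatch_cost D i y) \<partial>S.joint_law)"
    by (rule mult_left_mono) simp
  also have "\<dots> \<le> (\<integral>\<^sup>+y. ennreal (entropy_fun (enn2real (f (superpose y)))) \<partial>?PP)
      + (\<Sum>i. \<integral>\<^sup>+u. ennreal (exp_excess (\<theta> * D i u)) \<partial>piece_process i)"
    by (rule S.transport_cost_bound[OF D_meas D_nonneg \<theta>])
  also have "(\<integral>\<^sup>+y. ennreal (entropy_fun (enn2real (f (superpose y)))) \<partial>?PP) = (\<integral>\<^sup>+\<omega>. ennreal (entropy_fun (enn2real (f \<omega>))) \<partial>P)"
    unfolding P[symmetric] by (subst nn_integral_distr) auto
  finally have W: "ennreal \<theta> * W1 config_space (d_phi \<phi>) (density P f) P \<le>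
      (\<integral>\<^sup>+\<omega>. ennreal (entropy_fun (enn2real (f \<omega>))) \<partial>P) + (\<Sum>i. \<integral>\<^sup>+u. ennreal (exp_excess (\<theta> * D i u)) \<partial>piece_process i)" .
  have "(\<Sum>i. \<integral>\<^sup>+u. ennreal (exp_excess (\<theta> * D i u)) \<partial>piece_process i) \<le>
      (\<Sum>i. ennreal (c i) * (\<integral>\<^sup>+x. ennreal (exp_excess (\<theta> * \<phi> x)) * indicator (F i) x \<partial>m) + ennreal ((piece_rate i * (exp (\<theta> * M) - 1))\<^sup>2))"
  proof (rule suminf_le)
    fix i
    interpret p: prob_space "piece_law i" by (rule prob_space_piece_law)
    have [measurable]: "\<phi> \<in> borel_measurable (piece_law i)"
      by measurable
    have bnd: "\<bar>exp_excess (\<theta> * \<phi> x)\<bar> \<le> exp (\<theta> * M)" for x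
    proof -
      have "exp_excess (\<theta> * \<phi> x) \<le> exp (\<theta> * \<phi> x)"
        using mult_nonneg_nonneg[OF \<theta> \<phi>_nonneg[of x]] unfolding exp_excess_def by linarith
      also have "\<dots> \<le> exp (\<theta> * M)"
        using \<theta> \<phi>_le[of x] by (simp add: mult_left_mono)
      finally show ?thesis by simp
    qed
    have int: "integrable (piece_law i) (\<lambda>x. exp_excess (\<theta> * \<phi> x))"
      using bnd by (intro p.integrable_const_bound[of _ "exp (\<theta> * M)"]) auto
    have "(\<integral>\<^sup>+u. ennreal (exp_excess (\<theta> * D i u)) \<partial>piece_process i) \<le>
      ennreal (piece_rate i * (\<integral>x. exp_excess (\<theta> * \<phi> x) \<partial>piece_law i) + (piece_rate i * (exp (\<theta> * M) - 1))\<^sup>2)"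
      using compound_poisson_exp_excess[where \<phi> = \<phi>, OF piece_rate_nonneg prob_space_piece_law[of i] _ \<phi>_nonneg \<phi>_le \<theta> small[of i]]
      by (simp add: D_def piece_process_def case_prod_beta')
    also have "\<dots> = ennreal (piece_rate i) * ennreal (\<integral>x. exp_excess (\<theta> * \<phi> x) \<partial>piece_law i) + ennreal ((piece_rate i * (exp (\<theta> * M) - 1))\<^sup>2)"
      by (simp add: ennreal_plus ennreal_mult)
    also have "ennreal (\<integral>x. exp_excess (\<theta> * \<phi> x) \<partial>piece_law i) = (\<integral>\<^sup>+x. ennreal (exp_excess (\<theta> * \<phi> x)) \<partial>piece_law i)"
      by (rule nn_integral_eq_integral[symmetric, OF int]) simp
    finally show "(\<integral>\<^sup>+u. ennreal (exp_excess (\<theta> * D i u)) \<partial>piece_process i) \<le>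
      ennreal (c i) * (\<integral>\<^sup>+x. ennreal (exp_excess (\<theta> * \<phi> x)) * indicator (F i) x \<partial>m) + ennreal ((piece_rate i * (exp (\<theta> * M) - 1))\<^sup>2)"
      by (simp add: nn_integral_piece_law_full)
  qed auto
  also have "\<dots> = (\<Sum>i. ennreal (c i) * (\<integral>\<^sup>+x. ennreal (exp_excess (\<theta> * \<phi> x)) * indicator (F i) x \<partial>m)) + (\<Sum>i. ennreal ((piece_rate i * (exp (\<theta> * M) - 1))\<^sup>2))"
    by (rule suminf_add[symmetric]) auto
  also have "\<dots> \<le> (\<integral>\<^sup>+x. ennreal (exp_excess (\<theta> * \<phi> x)) \<partial>m) + (\<Sum>i. ennreal ((piece_rate i * (exp (\<theta> * M) - 1))\<^sup>2))"
    by (intro add_right_mono sum_pieces_le) measurable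
  finally show ?thesis
    unfolding add.assoc by (intro order_trans[OF W] add_left_mono)
qed

end

section \<open>The transportation inequality\<close>

lemma W1_bound:
  fixes m :: "'e::metric_space measure" and \<phi> :: "'e \<Rightarrow> real" and f :: "('e \<Rightarrow> nat) \<Rightarrow> ennreal"
  assumes lc: "locally_compact_space (euclidean :: 'e topology)"
    and radon: "radon_measure m" and sf: "sigma_finite_measure m" and P: "poisson_measure m P"
    and f: "f \<in> borel_measurable config_space" "(\<integral>\<^sup>+\<omega>. f \<omega> \<partial>P) = 1"
    and \<phi>: "\<phi> \<in> borel_measurable borel" "\<And>x. 0 \<le> \<phi> x" "\<And>x. \<phi> x \<le> M"
    and \<theta>: "0 \<le> \<theta>"
  shows "ennreal \<theta> * W1 config_space (d_phi \<phi>) (density P f) P \<le>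
    (\<integral>\<^sup>+\<omega>. ennreal (entropy_fun (enn2real (f \<omega>))) \<partial>P) + (\<integral>\<^sup>+x. ennreal (exp_excess (\<theta> * \<phi> x)) \<partial>m)"
proof (rule ennreal_le_epsilon)
  fix \<epsilon> :: real assume \<epsilon>: "0 < \<epsilon>"
  have sets_m: "sets m = sets borel" and m_compact: "\<And>K. compact K \<Longrightarrow> emeasure m K < \<infinity>"
    using radon by (auto simp: radon_measure_def)
  obtain L where L: "\<And>n::nat. compact (L n)" "emeasure m (- (\<Union>n. L n)) = 0"
    by (rule radon_measure_compact_exhaustion[OF radon sf]) (rule that)
  obtain K where K: "\<And>n. compact (K n)" "incseq K" "\<And>n. L n \<subseteq> K n"
    and K_exhaust: "\<And>C. compact C \<Longrightarrow> \<exists>n. C \<inter> (\<Union>n. K n) \<subseteq> K n"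
    by (rule locally_compact_exhaustion[OF lc L(1)]) (rule that)
  define U where "U = (\<Union>n. K n)"
  have K_sets[measurable]: "K n \<in> sets borel" for n
    using K(1) by (rule borel_compact)
  have null: "emeasure m (- U) = 0"
  proof -
    have "- U \<subseteq> - (\<Union>n. L n)" using K(3) by (auto simp: U_def)
    moreover have "L n \<in> sets borel" for n
      using L(1) by (rule borel_compact)
    then have "- (\<Union>n. L n) \<in> sets m"
      unfolding sets_m Compl_eq_Diff_UNIV by (intro sets.Diff sets.countable_UN) auto
    ultimately have "emeasure m (- U) \<le> emeasure m (- (\<Union>n. L n))"
      by (rule emeasure_mono)
    then show ?thesis using L(2) by simp
  qed
  \<comment> \<open>The layers of the exhaustion. A compact set meets finitely many of them, as its
    part in \<open>U\<close> lies in one \<open>K n\<close>.\<close>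
  define E where "E = disjointed K"
  have E_sets[measurable]: "E j \<in> sets borel" for j
  proof -
    have "range K \<subseteq> sets borel" using K_sets by blast
    from sets.range_disjointed_sets[OF this] show ?thesis
      unfolding E_def by blast
  qed
  have E_K: "E j \<subseteq> K j" for j
    unfolding E_def by (rule disjointed_subset)
  have E_disj: "disjoint_family E"
    unfolding E_def by (rule disjoint_family_disjointed)
  have E_UN: "(\<Union>j. E j) = U"
    unfolding E_def U_def by (rule UN_disjointed_eq)
  have E_late: "E j \<inter> K N = {}" if "N < j" for N j
    using that unfolding E_def disjointed_def by auto
  have E_fin: "emeasure m (E j) < \<infinity>" for j
    using emeasure_mono[OF E_K[of j], of m] m_compact[OF K(1), of j] by (auto simp: sets_m intro: le_less_trans)
  define \<mu> where "\<mu> j = enn2real (emeasure m (E j)) * (exp (\<theta> * M) - 1)" for j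
  have "0 \<le> M" using \<phi>(2,3) order_trans by blast
  then have b: "0 \<le> exp (\<theta> * M) - 1" using \<theta> by simp
  have \<mu>_nonneg: "0 \<le> \<mu> j" for j
    using b by (simp add: \<mu>_def)
  \<comment> \<open>Layer \<open>j\<close> is cut into \<open>N j\<close> copies of weight
    \<open>1 / N j\<close>, each with scaled rate \<open>\<mu> j / N j\<close>. The second condition
    makes this at most 1, the third bounds the squared errors of the layer by a term of a geometric
    series with sum \<epsilon>.\<close>
  have "\<exists>N. (0::nat) < N \<and> \<mu> j \<le> real N \<and> (\<mu> j)\<^sup>2 / real N \<le> \<epsilon> * (1 / 2) ^ Suc j" for j
  proof -
    obtain N :: nat where N: "max 1 (max (\<mu> j) ((\<mu> j)\<^sup>2 / (\<epsilon> * (1 / 2) ^ Suc j))) \<le> N"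
      using real_arch_simple by blast
    have pos: "0 < \<epsilon> * (1 / 2) ^ Suc j" using \<epsilon> by simp
    have "(\<mu> j)\<^sup>2 / (\<epsilon> * (1 / 2) ^ Suc j) \<le> N" using N by simp
    then have "(\<mu> j)\<^sup>2 / N \<le> \<epsilon> * (1 / 2) ^ Suc j"
      using pos N by (subst (asm) pos_divide_le_eq[OF pos]) (auto simp: divide_le_eq mult.commute)
    then show ?thesis using N by (intro exI[of _ N]) auto
  qed
  then obtain N :: "nat \<Rightarrow> nat" where N: "\<And>j. 0 < N j" "\<And>j. \<mu> j \<le> N j" "\<And>j. (\<mu> j)\<^sup>2 / N j \<le> \<epsilon> * (1 / 2) ^ Suc j"
    by metis
  define F where "F i = (case prod_decode i of (j, l) \<Rightarrow> if l < N j then E j else {})" for i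
  define c where "c i = 1 / real (N (fst (prod_decode i)))" for i
  have F_encode: "F (prod_encode (j, l)) = (if l < N j then E j else {})" for j l
    by (simp add: F_def)
  interpret intensity_pieces m F c U
  proof
    show "sets m = sets borel" by fact
    show "F i \<in> sets borel" for i by (auto simp: F_def split: prod.split)
    show "emeasure m (F i) < \<infinity>" for i using E_fin by (auto simp: F_def split: prod.split)
    show "0 \<le> c i" for i by (simp add: c_def)
    show "F i \<subseteq> U" for i using E_UN by (auto simp: F_def split: prod.split)
  next
    fix C :: "'e set" assume "compact C"
    then obtain n where n: "C \<inter> U \<subseteq> K n" using K_exhaust unfolding U_def by blast
    have "{i. F i \<inter> C \<noteq> {}} \<subseteq> prod_encode ` (SIGMA j:{..n}. {..<N j})"
    proof
      fix i assume i: "i \<in> {i. F i \<inter> C \<noteq> {}}"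
      obtain j l where jl: "i = prod_encode (j, l)"
        by (metis prod_decode_inverse surj_pair)
      from i obtain x where x: "l < N j" "x \<in> E j" "x \<in> C"
        by (auto simp: jl F_encode split: if_splits)
      then have "x \<in> K n" using n E_UN by blast
      then have "j \<le> n" using E_late[of n j] x(2) by (meson disjoint_iff not_less)
      then show "i \<in> prod_encode ` (SIGMA j:{..n}. {..<N j})"
        using x(1) by (auto simp: jl)
    qed
    then show "finite {i. F i \<inter> C \<noteq> {}}"
      by (rule finite_subset) auto
  next
    fix x assume "x \<in> U"
    then obtain j where j: "x \<in> E j" using E_UN by blast
    have uniq: "j' = j" if "x \<in> E j'" for j'
      using E_disj j that by (auto simp: disjoint_family_on_def)
    have "{i. x \<in> F i} = (\<lambda>l. prod_encode (j, l)) ` {..<N j}"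
    proof (intro set_eqI iffI)
      fix i assume i: "i \<in> {i. x \<in> F i}"
      obtain j' l where jl: "i = prod_encode (j', l)"
        by (metis prod_decode_inverse surj_pair)
      show "i \<in> (\<lambda>l. prod_encode (j, l)) ` {..<N j}"
        using i uniq[of j'] by (auto simp: jl F_encode split: if_splits)
    qed (auto simp: F_encode j)
    then have "(\<Sum>i | x \<in> F i. c i) = (\<Sum>l<N j. c (prod_encode (j, l)))"
      by (simp add: sum.reindex inj_on_def)
    also have "\<dots> = 1"
      using N(1)[of j] by (simp add: c_def)
    finally show "(\<Sum>i | x \<in> F i. c i) = 1" .
  qed
  have rate: "piece_rate (prod_encode (j, l)) * (exp (\<theta> * M) - 1) = (if l < N j then \<mu> j / N j else 0)" for j l
    by (simp add: piece_rate_def F_encode c_def \<mu>_def)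
  have "piece_rate i * (exp (\<theta> * M) - 1) \<le> 1" for i
  proof -
    obtain j l where jl: "i = prod_encode (j, l)"
      by (metis prod_decode_inverse surj_pair)
    show ?thesis
      using N(1,2)[of j] by (simp add: jl rate)
  qed
  then have W: "ennreal \<theta> * W1 config_space (d_phi \<phi>) (density P f) P \<le>
    (\<integral>\<^sup>+\<omega>. ennreal (entropy_fun (enn2real (f \<omega>))) \<partial>P) + (\<integral>\<^sup>+x. ennreal (exp_excess (\<theta> * \<phi> x)) \<partial>m)
    + (\<Sum>i. ennreal ((piece_rate i * (exp (\<theta> * M) - 1))\<^sup>2))"
    by (intro W1_bound_pieces[OF distr_superpose[OF P K(1,2) U_def m_compact[OF K(1)] null] f \<phi> \<theta>])
  have "(\<Sum>i. ennreal ((piece_rate i * (exp (\<theta> * M) - 1))\<^sup>2)) \<le> ennreal \<epsilon>"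
  proof -
    let ?g = "\<lambda>p. ennreal ((piece_rate (prod_encode p) * (exp (\<theta> * M) - 1))\<^sup>2)"
    have "(\<Sum>i. ennreal ((piece_rate i * (exp (\<theta> * M) - 1))\<^sup>2)) = (\<Sum>i. ?g (prod_decode i))"
      by simp
    also have "\<dots> = (\<Sum>j. \<Sum>l. ?g (j, l))"
      by (rule suminf_ennreal_2dimen) simp
    also have "\<dots> \<le> (\<Sum>j. ennreal (\<epsilon> * (1 / 2) ^ Suc j))"
    proof (rule suminf_le)
      fix j
      have "(\<Sum>l. ?g (j, l)) = (\<Sum>l<N j. ?g (j, l))"
        by (rule suminf_finite) (auto simp: rate)
      also have "\<dots> = (\<Sum>l<N j. ennreal ((\<mu> j / N j)\<^sup>2))"
        by (intro sum.cong) (auto simp: rate)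
      also have "\<dots> = ennreal (real (N j) * (\<mu> j / N j)\<^sup>2)"
        by (simp add: ennreal_mult ennreal_of_nat_eq_real_of_nat)
      also have "real (N j) * (\<mu> j / N j)\<^sup>2 = (\<mu> j)\<^sup>2 / N j"
        using N(1)[of j] by (simp add: power2_eq_square)
      finally show "(\<Sum>l. ?g (j, l)) \<le> ennreal (\<epsilon> * (1 / 2) ^ Suc j)"
        using N(3)[of j] by (simp add: ennreal_leI del: power_Suc)
    qed auto
    also have "\<dots> = ennreal \<epsilon>"
    proof (rule suminf_ennreal_eq)
      show "(\<lambda>j. \<epsilon> * (1 / 2) ^ Suc j) sums \<epsilon>"
        using sums_mult[OF power_half_series, of \<epsilon>] by simp
    qed (use \<epsilon> in simp)
    finally show ?thesis .
  qed
  then show "ennreal \<theta> * W1 config_space (d_phi \<phi>) (density P f) P \<le>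
    (\<integral>\<^sup>+\<omega>. ennreal (entropy_fun (enn2real (f \<omega>))) \<partial>P) + (\<integral>\<^sup>+x. ennreal (exp_excess (\<theta> * \<phi> x)) \<partial>m) + ennreal \<epsilon>"
    by (intro order_trans[OF W] add_left_mono)
qed

text \<open>As \<open>r\<close> has integral 1, \<open>r ln r - r + 1\<close> and
  \<open>r ln r\<close> have the same integral. In terms of the parts \<open>A\<close> and
  \<open>B\<close> of \<open>rel_entropy\<close> this reads \<open>I + B = A\<close>, and
  \<open>I\<close> can be isolated because \<open>B\<close> is at most 1.\<close>

lemma entropy_integral_le_rel_entropy:
  assumes P: "prob_space P" and Q: "prob_space Q" "sets Q = sets P" and ac: "absolutely_continuous P Q"
  shows "enn2ereal (\<integral>\<^sup>+x. ennreal (entropy_fun (enn2real (RN_deriv P Q x))) \<partial>P) \<le> rel_entropy Q P"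
proof -
  interpret P: prob_space P by fact
  interpret Q: prob_space Q by fact
  define f where "f = RN_deriv P Q"
  define r where "r x = enn2real (f x)" for x
  have f[measurable]: "f \<in> borel_measurable P" by (simp add: f_def)
  have r[measurable]: "r \<in> borel_measurable P" unfolding r_def by measurable
  have r_nonneg: "0 \<le> r x" for x by (simp add: r_def)
  have Q_eq: "density P f = Q"
    unfolding f_def using ac Q(2) by (rule P.density_RN_deriv)
  have f_int: "(\<integral>\<^sup>+x. f x \<partial>P) = 1"
    using Q.emeasure_space_1 unfolding Q_eq[symmetric] by (simp add: emeasure_density cong: nn_integral_cong)
  have "AE x in P. f x \<noteq> \<infinity>"
    by (rule nn_integral_PInf_AE) (auto simp: f_int)
  then have f_r: "AE x in P. f x = ennreal (r x)"
    by eventually_elim (simp add: r_def less_top)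
  define I A B where "I = (\<integral>\<^sup>+x. ennreal (entropy_fun (r x)) \<partial>P)"
    and "A = (\<integral>\<^sup>+x. ennreal (max 0 (ln (r x))) \<partial>Q)" and "B = (\<integral>\<^sup>+x. ennreal (max 0 (- ln (r x))) \<partial>Q)"
  have Q_int: "(\<integral>\<^sup>+x. ennreal (h (r x)) \<partial>Q) = (\<integral>\<^sup>+x. ennreal (r x * h (r x)) \<partial>P)"
    if [measurable]: "h \<in> borel_measurable borel" and h: "\<And>x. 0 \<le> h x" for h
  proof -
    have "(\<integral>\<^sup>+x. ennreal (h (r x)) \<partial>Q) = (\<integral>\<^sup>+x. f x * ennreal (h (r x)) \<partial>P)"
      unfolding Q_eq[symmetric] by (rule nn_integral_density) measurable
    also have "\<dots> = (\<integral>\<^sup>+x. ennreal (r x * h (r x)) \<partial>P)"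
      using f_r by (intro nn_integral_cong_AE) (auto simp: ennreal_mult r_nonneg h)
    finally show ?thesis .
  qed
  have A_eq: "A = (\<integral>\<^sup>+x. ennreal (r x * max 0 (ln (r x))) \<partial>P)"
    unfolding A_def by (rule Q_int) auto
  have B_eq: "B = (\<integral>\<^sup>+x. ennreal (r x * max 0 (- ln (r x))) \<partial>P)"
    unfolding B_def by (rule Q_int[of "\<lambda>t. max 0 (- ln t)"]) auto
  have r_int: "(\<integral>\<^sup>+x. ennreal (r x) \<partial>P) = 1"
    using f_r unfolding f_int[symmetric] by (intro nn_integral_cong_AE) auto
  have "B \<le> (\<integral>\<^sup>+x. 1 \<partial>P)"
    unfolding B_eq
  proof (rule nn_integral_mono)
    fix x
    \<comment> \<open>\<open>exp_young\<close> at slope 0 gives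
      \<open>- r ln r \<le> 1 - r\<close>.\<close>
    have "r x * max 0 (- ln (r x)) \<le> 1"
      using exp_young[OF r_nonneg[of x], of 0] r_nonneg[of x] by (auto simp: max_def)
    then show "ennreal (r x * max 0 (- ln (r x))) \<le> 1" by simp
  qed
  then have B_fin: "B \<le> 1" by (simp add: P.emeasure_space_1)
  have "I + B + 1 = (\<integral>\<^sup>+x. ennreal (entropy_fun (r x)) + ennreal (r x * max 0 (- ln (r x))) + ennreal (r x) \<partial>P)"
    by (simp add: I_def B_eq nn_integral_add r_int)
  also have "\<dots> = (\<integral>\<^sup>+x. ennreal (r x * max 0 (ln (r x))) + 1 \<partial>P)"
  proof (rule nn_integral_cong)
    fix x
    have "entropy_fun (r x) + r x * max 0 (- ln (r x)) + r x = r x * max 0 (ln (r x)) + 1"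
      by (auto simp: entropy_fun_def max_def)
    then show "ennreal (entropy_fun (r x)) + ennreal (r x * max 0 (- ln (r x))) + ennreal (r x) = ennreal (r x * max 0 (ln (r x))) + 1"
      using r_nonneg[of x] by (simp flip: ennreal_plus ennreal_1)
  qed
  also have "\<dots> = A + 1"
    by (simp add: A_eq nn_integral_add P.emeasure_space_1)
  finally have IBA: "I + B = A"
    by (simp add: add.commute[of _ 1] ennreal_add_left_cancel)
  have rel: "rel_entropy Q P = enn2ereal A - enn2ereal B"
    using ac by (simp add: rel_entropy_def A_def B_def r_def f_def Let_def)
  have "B \<noteq> \<top>" using B_fin by (auto simp: top_unique)
  then obtain b where b: "B = ennreal b" "0 \<le> b" by (cases B rule: ennreal_cases) auto
  show ?thesis
    unfolding rel IBA[symmetric] f_def[symmetric] r_def[symmetric] I_def[symmetric] b(1)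
    using b(2) by (cases "enn2ereal I") (auto simp: plus_ennreal.rep_eq)
qed

theorem theorem2p4:
  fixes m :: "'e::complete_space measure"
    and P0 :: "('e \<Rightarrow> nat) measure"
    and \<phi> :: "'e \<Rightarrow> real"
    and M :: real
  assumes "locally_compact_space (euclidean :: 'e topology)"
    and "radon_measure m"
    and "sigma_finite_measure m"
    and "poisson_measure m P0"
    and "continuous_on UNIV \<phi>"
    and "bounded (range \<phi>)"
    and "\<And>x. 0 < \<phi> x"
    and "\<And>x. \<phi> x \<le> M"
    and "(\<integral>\<^sup>+ x. ennreal ((\<phi> x)\<^sup>2) \<partial>m) < \<infinity>"
    and "Q \<in> {Q. prob_space Q \<and> sets Q = sets config_space}"
  shows "enn2ereal (ennreal (1 / M) *
           h_c (enn2real (\<integral>\<^sup>+ x. ennreal ((\<phi> x)\<^sup>2) \<partial>m) / M)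
               (W1 config_space (d_phi \<phi>) Q P0))
         \<le> rel_entropy Q P0"
proof (cases "absolutely_continuous P0 Q")
  case False
  then show ?thesis by (simp add: rel_entropy_def)
next
  case True
  have Q: "prob_space Q" "sets Q = sets config_space" using assms(10) by auto
  have P0: "prob_space P0" "sets P0 = sets config_space"
    using assms(4) by (auto simp: poisson_measure_def)
  interpret P0: prob_space P0 by fact
  interpret Q: prob_space Q by fact
  have sets_m: "sets m = sets borel"
    using assms(2) by (simp add: radon_measure_def)
  note [measurable_cong] = sets_m
  have \<phi>[measurable]: "\<phi> \<in> borel_measurable borel"
    using assms(5) by (rule borel_measurable_continuous_onI)
  have M: "0 < M" using assms(7,8) less_le_trans by blast
  define f where "f = RN_deriv P0 Q"
  have f: "f \<in> borel_measurable config_space"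
    unfolding f_def using borel_measurable_RN_deriv[of P0 Q] by (simp cong: measurable_cong_sets[OF P0(2) refl])
  have Q_eq: "density P0 f = Q"
    unfolding f_def using True by (rule P0.density_RN_deriv) (simp add: Q P0)
  have f_int: "(\<integral>\<^sup>+\<omega>. f \<omega> \<partial>P0) = 1"
    using Q.emeasure_space_1 unfolding Q_eq[symmetric]
    by (simp add: emeasure_density f_def cong: nn_integral_cong)
  define I W where "I = (\<integral>\<^sup>+\<omega>. ennreal (entropy_fun (enn2real (f \<omega>))) \<partial>P0)"
    and "W = W1 config_space (d_phi \<phi>) Q P0"
  define \<sigma>2 where "\<sigma>2 = enn2real (\<integral>\<^sup>+ x. ennreal ((\<phi> x)\<^sup>2) \<partial>m)"
  define c where "c = \<sigma>2 / M"
  have \<sigma>2: "0 \<le> \<sigma>2" "(\<integral>\<^sup>+ x. ennreal ((\<phi> x)\<^sup>2) \<partial>m) = ennreal \<sigma>2"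
    using assms(9) by (auto simp: \<sigma>2_def)
  have c: "0 \<le> c" using \<sigma>2 M by (simp add: c_def)
  \<comment> \<open>The factor \<open>c / M\<close> is \<open>\<sigma>2 / M\<^sup>2\<close>, the
    integral of the squared ratio \<open>\<phi> x / M\<close> that \<open>exp_excess_scale\<close>
    produces.\<close>
  have bound: "ennreal \<theta> * W \<le> I + ennreal (c / M * exp_excess (\<theta> * M))" if \<theta>: "0 \<le> \<theta>" for \<theta>
  proof -
    have W: "ennreal \<theta> * W \<le> I + (\<integral>\<^sup>+x. ennreal (exp_excess (\<theta> * \<phi> x)) \<partial>m)"
      unfolding W_def I_def Q_eq[symmetric]
      using assms(7) by (intro W1_bound[OF assms(1-4) f f_int \<phi> _ assms(8) \<theta>]) (simp add: less_imp_le)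
    have "(\<integral>\<^sup>+x. ennreal (exp_excess (\<theta> * \<phi> x)) \<partial>m) \<le> (\<integral>\<^sup>+x. ennreal (exp_excess (\<theta> * M) / M\<^sup>2) * ennreal ((\<phi> x)\<^sup>2) \<partial>m)"
    proof (rule nn_integral_mono)
      fix x
      have "exp_excess (\<theta> * \<phi> x) = exp_excess (\<phi> x / M * (\<theta> * M))"
        using M by (simp add: mult.commute)
      also have "\<dots> \<le> (\<phi> x / M)\<^sup>2 * exp_excess (\<theta> * M)"
        using assms(7,8)[of x] M \<theta> by (intro exp_excess_scale) auto
      also have "\<dots> = exp_excess (\<theta> * M) / M\<^sup>2 * (\<phi> x)\<^sup>2"
        by (simp add: power_divide)
      finally show "ennreal (exp_excess (\<theta> * \<phi> x)) \<le> ennreal (exp_excess (\<theta> * M) / M\<^sup>2) * ennreal ((\<phi> x)\<^sup>2)"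
        by (simp add: ennreal_leI flip: ennreal_mult)
    qed
    also have "\<dots> = ennreal (exp_excess (\<theta> * M) / M\<^sup>2) * ennreal \<sigma>2"
      by (subst nn_integral_cmult) (auto simp: \<sigma>2)
    also have "\<dots> = ennreal (c / M * exp_excess (\<theta> * M))"
      using \<sigma>2(1) M by (simp add: ennreal_mult[symmetric] c_def power2_eq_square field_simps)
    finally show ?thesis by (intro order_trans[OF W] add_left_mono)
  qed
  have "ennreal (1 / M) * h_c c W \<le> I"
  proof (cases "I = \<top>")
    case False
    then obtain i where i: "I = ennreal i" "0 \<le> i" by (cases I rule: ennreal_cases) auto
    \<comment> \<open>Finite entropy forces a finite transport cost, so that the optimisation can be
      done over the reals.\<close>
    have "W \<le> I + ennreal (c / M * exp_excess (1 * M))"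
      using bound[of 1] by simp
    also have "\<dots> < \<top>" by (simp add: i)
    finally obtain w where w: "W = ennreal w" "0 \<le> w" by (cases W rule: ennreal_cases) auto
    have bound': "\<theta> * w \<le> i + c / M * exp_excess (\<theta> * M)" if "0 \<le> \<theta>" for \<theta>
    proof -
      have "ennreal (\<theta> * w) \<le> ennreal (i + c / M * exp_excess (\<theta> * M))"
        using bound[OF that] that w i c M by (simp add: ennreal_mult)
      then show ?thesis
        using i(2) c M by (subst (asm) ennreal_le_iff) auto
    qed
    show ?thesis
    proof (cases "c = 0")
      case True
      have "w = 0"
      proof (rule ccontr)
        assume "w \<noteq> 0"
        with w have "0 < w" by simp
        \<comment> \<open>With \<open>c = 0\<close> the bound reads
          \<open>\<theta> * w \<le> i\<close> for all \<open>\<theta> \<ge> 0\<close>; the chosen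
          value makes the left side \<open>i + 1\<close>.\<close>
        then show False
          using bound'[of "(i + 1) / w"] i(2) True by simp
      qed
      then show ?thesis by (simp add: h_c_def True w)
    next
      case False
      with c have c_pos: "0 < c" by simp
      \<comment> \<open>The maximiser of \<open>s * w - c * exp_excess s\<close>, found from
        \<open>w = c * (exp s - 1)\<close>; it corresponds to
        \<open>\<theta> = s / M\<close>.\<close>
      define s where "s = ln (1 + w / c)"
      have exp_s: "exp s = 1 + w / c" and s: "0 \<le> s"
        using w(2) c_pos by (auto simp: s_def add_pos_nonneg)
      have "s / M * w \<le> i + c / M * exp_excess s"
        using bound'[of "s / M"] s M by simp
      then have "1 / M * (s * w - c * exp_excess s) \<le> i"
        by (simp add: diff_divide_distrib)
      moreover have "s * w - c * exp_excess s = c * h_fun (w / c)"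
        unfolding exp_excess_def exp_s h_fun_def s_def[symmetric] using c_pos by (simp add: field_simps)
      ultimately have "1 / M * (c * h_fun (w / c)) \<le> i" by simp
      then have "ennreal (1 / M * (c * h_fun (w / c))) \<le> ennreal i"
        by (rule ennreal_leI)
      then show ?thesis
        using M c_pos w by (simp add: h_c_def i ennreal_mult'[symmetric])
    qed
  qed simp
  then have "enn2ereal (ennreal (1 / M) * h_c c W) \<le> enn2ereal I"
    by (simp add: less_eq_ennreal.rep_eq)
  also have "\<dots> \<le> rel_entropy Q P0"
    unfolding I_def f_def by (rule entropy_integral_le_rel_entropy[OF P0(1) Q(1) _ True]) (simp add: Q P0)
  finally show ?thesis
    unfolding W_def c_def \<sigma>2_def .
qed

end
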